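(* Let $(S_n)_{n\ge0}$ be the Dynamic Elephant Random Walk with $p\le 3/4$ or $\ell_{\sup}(\alpha)<\frac{1}{4p-2}$, where $\ell_{\inf}(\alpha)=\liminf_{n\to\infty}g(\alpha,n)$ and $\ell_{\sup}(\alpha)=\limsup_{n\to\infty}g(\alpha,n)$. Let $x\in\mathcal{X}$ and suppose that at least one of the following holds: (i) $p<1$ and $\ell_{\inf}(\alpha)>0$; or (ii) $p\cdot\ell_{\sup}(\alpha)<1$ and both of the following implications hold: (D$_1$) if $p=1$, then $\liminf_{n\to\infty}f(T^n(x))>0$ and $\limsup_{n\to\infty}f(T^n(x))<\frac{1-\ell_{\sup}(\alpha)}{1-\ell_{\inf}(\alpha)}$; (D$_2$) if $\ell_{\inf}(\alpha)=0$, then $\liminf_{n\to\infty}f(T^n(x))>0$, $\limsup_{n\to\infty}f(T^n(x))<1-p\cdot\ell_{\sup}(\alpha)$, and $\ell_{\sup}(\alpha)<1$. Then $$\limsup_{n\to\infty}\frac{|S_n-\mathbb{E}_x[S_n]|}{a_nA_n\sqrt{\log\log(A_n)}}=\sqrt2\qquad\mathbb{P}_x\text{-almost surely},$$ where $$a_n=\prod_{j=1}^{n-1}\Bigl(1+\frac{(2p-1)g(\alpha,j+1)}{j}\Bigr),\qquad A_n\ge0,\quad A_n^2=\sum_{k=1}^n\frac{1}{a_k^2}\bigl(1-\mathbb{E}_x[X_k]^2\bigr).$$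
   Context: Dynamic Elephant Random Walk (DERW). Let $(\mathcal{X},\mathscr{A},\mu)$ be a probability space and $T:\mathcal{X}\to\mathcal{X}$ a measurable $\mu$-preserving map ($\mu(T^{-1}A)=\mu(A)$ for all $A\in\mathscr{A}$); $T^n$ denotes the $n$-fold iterate. Let $f:\mathcal{X}\to[0,1]$ be $\mathscr{A}$-measurable. Let $p,q\in[0,1]$, let $g:R\subset\mathbb{R}\times\mathbb{N}\to[0,1]$ be a function and fix $\alpha\in\mathbb{R}$ with $(\alpha,n)\in R$ for all $n\ge1$; write $\alpha_n:=g(\alpha,n)\in[0,1]$. For $x\in\mathcal{X}$, the DERW under the probability $\mathbb{P}_x$ (expectation $\mathbb{E}_x$) is the process $S_0=0$, $S_n=\sum_{i=1}^n X_i$, with $\{-1,1\}$-valued increments such that $\mathbb{P}_x[X_1=1]=\alpha_1 q+(1-\alpha_1)f(Tx)$ and, for $n\ge1$, $\eta\in\{-1,1\}$, with $\mathscr{F}_n=\sigma(X_1,\dots,X_n)$, $$\mathbb{P}_x[X_{n+1}=\eta\mid\mathscr{F}_n]=\alpha_{n+1}\,\frac{1}{2n}\sum_{k=1}^{n}\bigl(1+(2p-1)X_k\eta\bigr)+(1-\alpha_{n+1})\,d_{n+1}(\eta),$$ where $d_m(1)=f(T^m x)$ and $d_m(-1)=1-f(T^m x)$. Standing assumption: the case where both $g(\alpha,2)=1$ and $p=0$ is excluded (so that $a_n>0$ for all $n$; $a_1=1$ as an empty product). The expression $\log\log(A_n)$ is considered for $n$ large enough. *)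

theory Defs
  imports "HOL-Probability.Probability"
begin

(* The sigma-algebra generated by X 1, ..., X n, as a measure space for use with real_cond_exp
   (only its space and its measurable sets matter there). *)
definition past :: "'b measure \<Rightarrow> (nat \<Rightarrow> 'b \<Rightarrow> real) \<Rightarrow> nat \<Rightarrow> 'b measure" where
  "past P X n = sigma (space P) {X k -` B \<inter> space P | k B. k \<in> {1..n} \<and> B \<in> sets borel}"

definition dyn_weight :: "('a \<Rightarrow> 'a) \<Rightarrow> ('a \<Rightarrow> real) \<Rightarrow> 'a \<Rightarrow> nat \<Rightarrow> real \<Rightarrow> real" where
  "dyn_weight T f x m \<eta> = (if \<eta> = 1 then f ((T ^^ m) x) else 1 - f ((T ^^ m) x))"

(* M is the probability space carrying the dynamical system. For the given starting point x,
   (P, X) is any realisation of the increments under the law P_x; X 0 is irrelevant.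
   The memory function is the restriction of g to R; its values off R are never used. *)
locale derw = dyn: prob_space M + walk: prob_space P
  for M :: "'a measure" and T :: "'a \<Rightarrow> 'a" and f :: "'a \<Rightarrow> real"
    and p q :: real and R :: "(real \<times> nat) set" and g :: "real \<Rightarrow> nat \<Rightarrow> real" and \<alpha> :: real
    and x :: 'a and P :: "'b measure" and X :: "nat \<Rightarrow> 'b \<Rightarrow> real" +
  assumes T_measurable: "T \<in> M \<rightarrow>\<^sub>M M"
    and T_preserving: "A \<in> sets M \<Longrightarrow> emeasure M (T -` A \<inter> space M) = emeasure M A"
    and f_measurable: "f \<in> borel_measurable M"
    and f_range: "y \<in> space M \<Longrightarrow> f y \<in> {0..1}"
    and p_range: "p \<in> {0..1}"
    and q_range: "q \<in> {0..1}"
    and g_range: "(a, n) \<in> R \<Longrightarrow> g a n \<in> {0..1}"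
    and \<alpha>_dom: "n \<ge> 1 \<Longrightarrow> (\<alpha>, n) \<in> R"
    and nondegenerate: "\<not> (g \<alpha> 2 = 1 \<and> p = 0)"
    and x_in: "x \<in> space M"
    and X_measurable: "n \<ge> 1 \<Longrightarrow> X n \<in> borel_measurable P"
    and X_values: "n \<ge> 1 \<Longrightarrow> \<omega> \<in> space P \<Longrightarrow> X n \<omega> \<in> {-1, 1}"
    and first_step:
      "measure P {\<omega> \<in> space P. X 1 \<omega> = 1} = g \<alpha> 1 * q + (1 - g \<alpha> 1) * f (T x)"
    and next_step: "n \<ge> 1 \<Longrightarrow> \<eta> \<in> {-1, 1} \<Longrightarrow>
      AE \<omega> in P.
        real_cond_exp P (past P X n) (indicat_real {\<omega>' \<in> space P. X (n + 1) \<omega>' = \<eta>}) \<omega>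
        = g \<alpha> (n + 1) * (1 / (2 * real n) * (\<Sum>k = 1..n. 1 + (2 * p - 1) * X k \<omega> * \<eta>))
          + (1 - g \<alpha> (n + 1)) * dyn_weight T f x (n + 1) \<eta>"

definition walk :: "(nat \<Rightarrow> 'b \<Rightarrow> real) \<Rightarrow> nat \<Rightarrow> 'b \<Rightarrow> real" where
  "walk X n \<omega> = (\<Sum>i = 1..n. X i \<omega>)"

definition ell_inf :: "(real \<Rightarrow> nat \<Rightarrow> real) \<Rightarrow> real \<Rightarrow> ereal" where
  "ell_inf g \<alpha> = liminf (\<lambda>n. ereal (g \<alpha> n))"

definition ell_sup :: "(real \<Rightarrow> nat \<Rightarrow> real) \<Rightarrow> real \<Rightarrow> ereal" where
  "ell_sup g \<alpha> = limsup (\<lambda>n. ereal (g \<alpha> n))"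

definition orbit_inf :: "('a \<Rightarrow> 'a) \<Rightarrow> ('a \<Rightarrow> real) \<Rightarrow> 'a \<Rightarrow> ereal" where
  "orbit_inf T f x = liminf (\<lambda>n. ereal (f ((T ^^ n) x)))"

definition orbit_sup :: "('a \<Rightarrow> 'a) \<Rightarrow> ('a \<Rightarrow> real) \<Rightarrow> 'a \<Rightarrow> ereal" where
  "orbit_sup T f x = limsup (\<lambda>n. ereal (f ((T ^^ n) x)))"

definition a_coef :: "real \<Rightarrow> (real \<Rightarrow> nat \<Rightarrow> real) \<Rightarrow> real \<Rightarrow> nat \<Rightarrow> real" where
  "a_coef p g \<alpha> n = (\<Prod>j = 1..<n. 1 + (2 * p - 1) * g \<alpha> (j + 1) / real j)"

(* The summands are nonnegative because the increments take values in {-1, 1}. *)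
definition A_coef ::
  "real \<Rightarrow> (real \<Rightarrow> nat \<Rightarrow> real) \<Rightarrow> real \<Rightarrow> 'b measure \<Rightarrow> (nat \<Rightarrow> 'b \<Rightarrow> real) \<Rightarrow> nat \<Rightarrow> real" where
  "A_coef p g \<alpha> P X n =
    sqrt (\<Sum>k = 1..n. 1 / (a_coef p g \<alpha> k)\<^sup>2 * (1 - (integral\<^sup>L P (X k))\<^sup>2))"

end

theory Submission
  imports Defs "HOL-Real_Asymp.Real_Asymp"
begin

text \<open>
  Dividing the centred walk by \<open>a\<^sub>n\<close> gives a martingale with bounded increments whose
  predictable quadratic variation \<open>V\<^sub>n\<close> is close in mean to \<open>1 + A\<^sub>n\<^sup>2\<close>; the error and the
  squares of the increments are of polynomially smaller order, because
  \<open>a\<^sub>n\<^sup>2 \<Sum>\<^bsub>k\<le>n\<^esub> 1 / a\<^sub>k\<^sup>2 = O(n\<^bsup>3/2\<^esup>)\<close>. The law of the iterated logarithm for such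
  martingales follows along the times at which \<open>1 + A\<^sub>n\<^sup>2\<close> passes a power of \<open>\<theta>\<close>: the upper bound
  from the exponential supermartingale and a maximal inequality, the lower bound from an
  exponential tilt of each block. The tilted mass is shown to concentrate by comparing the
  exponential moment at \<open>\<lambda>\<close> with those at \<open>(1 \<plusminus> \<epsilon>) \<lambda>\<close>, and blocks where \<open>V\<^sub>n\<close> deviates from its
  expected size are rare enough to be absorbed in a summable error of the Borel--Cantelli argument.
\<close>

section \<open>Exponential moments of martingale increments\<close>

text \<open>The means obey the same linear recursion as the one-step predictions, so centring turns
  a step of the walk into multiplication by \<open>1 + memory n / n\<close> plus a bounded
  martingale difference; the product of these factors is \<open>a n\<close>. The obstacle is that
  the quadratic variation depends on the walk itself. It is controlled only in mean:
  \<open>E|S_k - E S_k| / k\<close> is at most \<open>a k * sqrt (Q k) / k = O(k^(-1/4))\<close>,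
  where \<open>Q k\<close> is the sum of the \<open>1 / a_j^2\<close>, and
  \<open>Q n = O(n^3)\<close> turns this into the exponent \<open>1/12\<close> in terms of
  \<open>Q\<close>. A polynomial rate is geometric along \<open>\<theta>^k\<close>, whereas the tilt
  costs only powers of a logarithm, so Markov's inequality suffices. The bound on \<open>p\<close>
  or \<open>ell_sup\<close> makes \<open>memory n\<close> eventually at most \<open>1/2\<close>, the
  source of the exponent \<open>3/2\<close>; alternative (i) or (ii) keeps \<open>|E X_n|\<close>
  away from 1, so that \<open>A_n^2\<close> is comparable to \<open>Q n\<close>. Blocks are
  dependent; therefore the lower tail is proved on an arbitrary event of the past, and
  Borel-Cantelli is run on the event that no block has succeeded yet.\<close>

lemma exp_Taylor2_bounds:
  fixes y :: real
  assumes "\<bar>y\<bar> \<le> 1"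
  shows "exp y \<le> 1 + y + y\<^sup>2 / 2 * (1 + 3 * \<bar>y\<bar>)"
    and "1 + y + y\<^sup>2 / 2 * (1 - 3 * \<bar>y\<bar>) \<le> exp y"
proof -
  have "\<bar>exp y - (\<Sum>i\<le>2. y ^ i / fact i)\<bar> \<le> exp \<bar>y\<bar> * (\<bar>y\<bar> ^ 3) / 2"
    using Taylor_exp_field[of y 2] by (simp add: numeral_eq_Suc)
  moreover have "exp \<bar>y\<bar> \<le> 3"
    using exp_le assms by (smt (verit) exp_le_cancel_iff)
  then have "exp \<bar>y\<bar> * (\<bar>y\<bar> ^ 3) / 2 \<le> 3 * (\<bar>y\<bar> ^ 3) / 2"
    by (intro divide_right_mono mult_right_mono) auto
  moreover have "(\<Sum>i\<le>2. y ^ i / fact i) = 1 + y + y\<^sup>2 / 2"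
    by (simp add: numeral_eq_Suc)
  moreover have "\<bar>y\<bar> ^ 3 = y\<^sup>2 * \<bar>y\<bar>"
    by (simp add: power3_eq_cube power2_eq_square abs_mult_self_eq)
  \<comment> \<open>The cubic remainder is recast below as a relative error of the quadratic term,
    because the square is what conditioning turns into \<open>s n\<close>.\<close>
  ultimately have T: "\<bar>exp y - (1 + y + y\<^sup>2 / 2)\<bar> \<le> 3 * (y\<^sup>2 * \<bar>y\<bar>) / 2"
    by (simp only:)
  have "y\<^sup>2 / 2 * (1 + 3 * \<bar>y\<bar>) = y\<^sup>2 / 2 + 3 * (y\<^sup>2 * \<bar>y\<bar>) / 2"
    by (simp add: distrib_left)
  with T show "exp y \<le> 1 + y + y\<^sup>2 / 2 * (1 + 3 * \<bar>y\<bar>)"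
    unfolding abs_le_iff by linarith
  have "y\<^sup>2 / 2 * (1 - 3 * \<bar>y\<bar>) = y\<^sup>2 / 2 - 3 * (y\<^sup>2 * \<bar>y\<bar>) / 2"
    by (simp add: right_diff_distrib)
  with T show "1 + y + y\<^sup>2 / 2 * (1 - 3 * \<bar>y\<bar>) \<le> exp y"
    unfolding abs_le_iff by linarith
qed

text \<open>For \<open>v = u * (1 - h)\<close> one has \<open>exp v \<le> 1 + v + v^2\<close>, and
  the part \<open>u * h\<close> cut off from \<open>u\<close> pays for the square. This reverses
  \<open>1 + u \<le> exp u\<close>, as lower bounds on exponential moments require.\<close>

lemma one_plus_ge_exp:
  fixes u h :: real
  assumes "0 \<le> u" "u \<le> h" "h \<le> 1"
  shows "exp (u * (1 - h)) \<le> 1 + u"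
proof -
  define v where "v = u * (1 - h)"
  have v: "0 \<le> v" "v \<le> u"
    using assms by (auto simp: v_def mult_left_le)
  then have "exp v \<le> 1 + v + v\<^sup>2"
    using assms by (intro exp_bound) auto
  also have "v\<^sup>2 \<le> u * u"
    using v by (auto simp: power2_eq_square intro!: mult_mono)
  also have "u * u \<le> u * h"
    using assms by (intro mult_left_mono) auto
  also have "1 + v + u * h = 1 + u"
    by (simp add: v_def algebra_simps)
  finally show ?thesis by (simp add: v_def)
qed

text \<open>The indices are shifted: \<open>d n\<close> is revealed at time \<open>n + 1\<close>,
  while its conditional variance \<open>s n\<close> is known at time \<open>n\<close>, so
  \<open>qvar (n + 1)\<close> is measurable at time \<open>n\<close>. The bounds \<open>c n\<close>
  are deterministic and pointwise, which makes all exponential moments finite.\<close>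

locale martingale_increments = prob_space P
  for P :: "'b measure" +
  fixes F :: "nat \<Rightarrow> 'b measure" and d s :: "nat \<Rightarrow> 'b \<Rightarrow> real" and c :: "nat \<Rightarrow> real"
  assumes subalg: "subalgebra P (F n)"
    and F_Suc: "sets (F n) \<subseteq> sets (F (Suc n))"
    and d_measurable: "d n \<in> borel_measurable (F (Suc n))"
    and d_bound: "\<omega> \<in> space P \<Longrightarrow> \<bar>d n \<omega>\<bar> \<le> c n"
    and s_measurable: "s n \<in> borel_measurable (F n)"
    and s_nonneg: "\<omega> \<in> space P \<Longrightarrow> 0 \<le> s n \<omega>"
    and s_bound: "\<omega> \<in> space P \<Longrightarrow> s n \<omega> \<le> (c n)\<^sup>2"
    and cond_mean: "AE \<omega> in P. real_cond_exp P (F n) (d n) \<omega> = 0"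
    and cond_var: "AE \<omega> in P. real_cond_exp P (F n) (\<lambda>\<omega>. (d n \<omega>)\<^sup>2) \<omega> = s n \<omega>"
begin

definition mart :: "nat \<Rightarrow> 'b \<Rightarrow> real" where
  "mart n \<omega> = (\<Sum>k<n. d k \<omega>)"

definition qvar :: "nat \<Rightarrow> 'b \<Rightarrow> real" where
  "qvar n \<omega> = (\<Sum>k<n. s k \<omega>)"

text \<open>Bounded functions of the past at time \<open>n\<close>. The class is closed under ring
  operations and \<open>exp\<close>, so most measurability and integrability obligations reduce to
  the rules in \<open>test_intros\<close>.\<close>

definition test :: "nat \<Rightarrow> ('b \<Rightarrow> real) \<Rightarrow> bool" where
  "test n Z \<longleftrightarrow> Z \<in> borel_measurable (F n) \<and> (\<exists>K. \<forall>\<omega>\<in>space P. \<bar>Z \<omega>\<bar> \<le> K)"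

lemma space_F [simp]: "space (F n) = space P"
  using subalg by (simp add: subalgebra_def)

lemma sets_F: "sets (F n) \<subseteq> sets P"
  using subalg by (simp add: subalgebra_def)

lemma F_mono: "m \<le> n \<Longrightarrow> sets (F m) \<subseteq> sets (F n)"
  using F_Suc by (rule lift_Suc_mono_le)

lemma measurable_F_mono:
  assumes "m \<le> n" "Z \<in> borel_measurable (F m)"
  shows "Z \<in> borel_measurable (F n)"
  by (rule measurable_from_subalg[OF _ assms(2)]) (simp add: subalgebra_def F_mono[OF assms(1)])

lemma measurable_P: "Z \<in> borel_measurable (F n) \<Longrightarrow> Z \<in> borel_measurable P"
  using measurable_from_subalg[OF subalg] .

lemma c_nonneg: "0 \<le> c n"
  using d_bound[of _ n] not_empty by (smt (verit) ex_in_conv)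

lemma test_mono: "test m Z \<Longrightarrow> m \<le> n \<Longrightarrow> test n Z"
  by (auto simp: test_def intro: measurable_F_mono)

lemma test_const [simp, intro]: "test n (\<lambda>_. a)"
  by (auto simp: test_def)

lemma test_d: "Suc k \<le> n \<Longrightarrow> test n (d k)"
  using d_measurable d_bound measurable_F_mono unfolding test_def by blast

lemma test_s: "k \<le> n \<Longrightarrow> test n (s k)"
  using s_measurable s_bound s_nonneg measurable_F_mono unfolding test_def
  by (metis abs_of_nonneg)

lemma test_add:
  assumes "test n Y" "test n Z"
  shows "test n (\<lambda>\<omega>. Y \<omega> + Z \<omega>)"
proof -
  obtain K L where "\<forall>\<omega>\<in>space P. \<bar>Y \<omega>\<bar> \<le> K" "\<forall>\<omega>\<in>space P. \<bar>Z \<omega>\<bar> \<le> L"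
    using assms by (auto simp: test_def)
  then have "\<forall>\<omega>\<in>space P. \<bar>Y \<omega> + Z \<omega>\<bar> \<le> K + L"
    by fastforce
  then show ?thesis
    using assms by (auto simp: test_def)
qed

lemma test_mult:
  assumes "test n Y" "test n Z"
  shows "test n (\<lambda>\<omega>. Y \<omega> * Z \<omega>)"
proof -
  obtain K L where "\<forall>\<omega>\<in>space P. \<bar>Y \<omega>\<bar> \<le> K" "\<forall>\<omega>\<in>space P. \<bar>Z \<omega>\<bar> \<le> L"
    using assms by (auto simp: test_def)
  then have "\<forall>\<omega>\<in>space P. \<bar>Y \<omega> * Z \<omega>\<bar> \<le> K * L"
    by (auto simp: abs_mult intro!: mult_mono order_trans[OF abs_ge_zero])
  then show ?thesis
    using assms by (auto simp: test_def)
qed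

lemma test_diff: "test n Y \<Longrightarrow> test n Z \<Longrightarrow> test n (\<lambda>\<omega>. Y \<omega> - Z \<omega>)"
  using test_add[of n Y "\<lambda>\<omega>. (- 1) * Z \<omega>"] test_mult[of n "\<lambda>_. - 1" Z] by simp

lemma test_power: "test n Z \<Longrightarrow> test n (\<lambda>\<omega>. Z \<omega> ^ k)"
  by (induction k) (auto intro: test_mult)

lemma test_sum: "(\<And>i. i \<in> I \<Longrightarrow> test n (Z i)) \<Longrightarrow> test n (\<lambda>\<omega>. \<Sum>i\<in>I. Z i \<omega>)"
  by (induction I rule: infinite_finite_induct) (auto intro: test_add)

lemma test_exp:
  assumes "test n Z"
  shows "test n (\<lambda>\<omega>. exp (Z \<omega>))"
proof -
  obtain K where "\<forall>\<omega>\<in>space P. \<bar>Z \<omega>\<bar> \<le> K"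
    using assms by (auto simp: test_def)
  then have "\<forall>\<omega>\<in>space P. \<bar>exp (Z \<omega>)\<bar> \<le> exp K"
    by (auto simp: abs_le_iff)
  then show ?thesis
    using assms by (auto simp: test_def)
qed

lemma test_indicator: "A \<in> sets (F n) \<Longrightarrow> test n (indicator A)"
  unfolding test_def by (auto intro!: exI[of _ 1] simp: indicator_def)

lemma test_mart: "m \<le> n \<Longrightarrow> test n (mart m)"
  unfolding mart_def[abs_def] by (intro test_sum test_d) auto

lemma test_qvar: "m \<le> Suc n \<Longrightarrow> test n (qvar m)"
  unfolding qvar_def[abs_def] by (intro test_sum test_s) auto

lemmas test_intros = test_add test_mult test_diff test_exp test_power test_indicator
  test_const test_d test_s test_mart test_qvar

lemma test_integrable: "test n Z \<Longrightarrow> integrable P Z"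
  unfolding test_def by (auto intro!: integrable_const_bound measurable_P AE_I2)

lemma sub_sigma: "finite_measure_subalgebra P (F n)"
  by unfold_locales (rule subalg)

text \<open>In the exponential estimates, conditional expectations enter only through integrals
  against bounded functions of the past. Here \<open>Y\<close> may belong to a later time
  \<open>m\<close>.\<close>

lemma integral_mult_cond_exp:
  assumes Z: "test n Z" and Y: "test m Y"
    and Yc: "AE \<omega> in P. real_cond_exp P (F n) Y \<omega> = Yc \<omega>" "test n Yc"
  shows "(\<integral>\<omega>. Z \<omega> * Y \<omega> \<partial>P) = (\<integral>\<omega>. Z \<omega> * Yc \<omega> \<partial>P)"
proof -
  interpret sub: finite_measure_subalgebra P "F n" by (rule sub_sigma)
  have meas: "Z \<in> borel_measurable (F n)" "Y \<in> borel_measurable P"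
    "Z \<in> borel_measurable P" "Yc \<in> borel_measurable P"
    using Z Y Yc by (auto simp: test_def intro: measurable_P)
  have "integrable P (\<lambda>\<omega>. Z \<omega> * Y \<omega>)"
    using test_mult[OF test_mono[OF Z, of "max m n"] test_mono[OF Y, of "max m n"]]
    by (auto intro: test_integrable)
  from sub.real_cond_exp_intg(2)[OF this meas(1,2)]
  have "(\<integral>\<omega>. Z \<omega> * Y \<omega> \<partial>P) = (\<integral>\<omega>. Z \<omega> * real_cond_exp P (F n) Y \<omega> \<partial>P)"
    by simp
  also have "\<dots> = (\<integral>\<omega>. Z \<omega> * Yc \<omega> \<partial>P)"
    using Yc(1) meas by (intro integral_cong_AE) (auto intro: borel_measurable_times)
  finally show ?thesis .
qed

lemma integral_mult_d: "test n Z \<Longrightarrow> (\<integral>\<omega>. Z \<omega> * d n \<omega> \<partial>P) = 0"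
  using integral_mult_cond_exp[OF _ test_d[OF order_refl] cond_mean test_const] by simp

lemma integral_mult_d2:
  "test n Z \<Longrightarrow> (\<integral>\<omega>. Z \<omega> * (d n \<omega>)\<^sup>2 \<partial>P) = (\<integral>\<omega>. Z \<omega> * s n \<omega> \<partial>P)"
  by (rule integral_mult_cond_exp[OF _ test_power[OF test_d] cond_var]) (auto intro: test_s)

text \<open>The linear Taylor term integrates to zero and the square becomes \<open>s n\<close>;
  then \<open>1 + u\<close> is compared with an exponential. For the upper bound this is free, for
  the lower bound \<open>one_plus_ge_exp\<close> costs one more \<open>h\<close>: hence
  \<open>3 * h\<close> against \<open>4 * h\<close>.\<close>

lemma exp_step:
  assumes Z: "test n Z" and Z0: "\<And>\<omega>. \<omega> \<in> space P \<Longrightarrow> 0 \<le> Z \<omega>"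
    and h: "\<bar>l\<bar> * c n \<le> h" "h \<le> 1 / 3"
  shows "(\<integral>\<omega>. Z \<omega> * exp (l * d n \<omega>) \<partial>P) \<le> (\<integral>\<omega>. Z \<omega> * exp (l\<^sup>2 * (1 + 3 * h) / 2 * s n \<omega>) \<partial>P)"
    and "(\<integral>\<omega>. Z \<omega> * exp (l\<^sup>2 * (1 - 4 * h) / 2 * s n \<omega>) \<partial>P) \<le> (\<integral>\<omega>. Z \<omega> * exp (l * d n \<omega>) \<partial>P)"
proof -
  have h0: "0 \<le> h"
    by (rule order_trans[OF mult_nonneg_nonneg h(1)]) (auto simp: c_nonneg)
  have Z': "test (Suc n) Z"
    using Z by (rule test_mono) simp
  have ld: "\<bar>l * d n \<omega>\<bar> \<le> h" if "\<omega> \<in> space P" for \<omega>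
    unfolding abs_mult by (rule order_trans[OF mult_left_mono h(1)]) (use d_bound[OF that] in auto)
  have quad: "(\<integral>\<omega>. Z \<omega> * (1 + l * d n \<omega> + a * (d n \<omega>)\<^sup>2) \<partial>P) = (\<integral>\<omega>. Z \<omega> * (1 + a * s n \<omega>) \<partial>P)"
    for a
  proof -
    have i: "integrable P (\<lambda>\<omega>. Z \<omega> * d n \<omega>)" "integrable P (\<lambda>\<omega>. Z \<omega> * (d n \<omega>)\<^sup>2)"
      "integrable P (\<lambda>\<omega>. Z \<omega> * s n \<omega>)" "integrable P Z"
      by (auto intro!: test_integrable[of "Suc n"] test_intros Z')
    have "(\<integral>\<omega>. Z \<omega> * (1 + l * d n \<omega> + a * (d n \<omega>)\<^sup>2) \<partial>P)
        = (\<integral>\<omega>. Z \<omega> + l * (Z \<omega> * d n \<omega>) + a * (Z \<omega> * (d n \<omega>)\<^sup>2) \<partial>P)"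
      by (intro Bochner_Integration.integral_cong) (auto simp: algebra_simps)
    also have "\<dots> = (\<integral>\<omega>. Z \<omega> \<partial>P) + a * (\<integral>\<omega>. Z \<omega> * s n \<omega> \<partial>P)"
      using i by (simp add: integral_mult_d[OF Z] integral_mult_d2[OF Z])
    also have "\<dots> = (\<integral>\<omega>. Z \<omega> + a * (Z \<omega> * s n \<omega>) \<partial>P)"
      using i by simp
    also have "\<dots> = (\<integral>\<omega>. Z \<omega> * (1 + a * s n \<omega>) \<partial>P)"
      by (intro Bochner_Integration.integral_cong) (auto simp: algebra_simps)
    finally show ?thesis .
  qed
  have up: "exp (l * d n \<omega>) \<le> 1 + l * d n \<omega> + l\<^sup>2 * (1 + 3 * h) / 2 * (d n \<omega>)\<^sup>2"
    and lo: "1 + l * d n \<omega> + l\<^sup>2 * (1 - 3 * h) / 2 * (d n \<omega>)\<^sup>2 \<le> exp (l * d n \<omega>)"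
    if "\<omega> \<in> space P" for \<omega>
  proof -
    have 1: "\<bar>l * d n \<omega>\<bar> \<le> 1"
      using ld[OF that] h by linarith
    have "(l * d n \<omega>)\<^sup>2 / 2 * (1 + 3 * \<bar>l * d n \<omega>\<bar>) \<le> (l * d n \<omega>)\<^sup>2 / 2 * (1 + 3 * h)"
      "(l * d n \<omega>)\<^sup>2 / 2 * (1 - 3 * h) \<le> (l * d n \<omega>)\<^sup>2 / 2 * (1 - 3 * \<bar>l * d n \<omega>\<bar>)"
      using ld[OF that] by (auto intro!: mult_left_mono)
    with exp_Taylor2_bounds[OF 1]
    show "exp (l * d n \<omega>) \<le> 1 + l * d n \<omega> + l\<^sup>2 * (1 + 3 * h) / 2 * (d n \<omega>)\<^sup>2"
      "1 + l * d n \<omega> + l\<^sup>2 * (1 - 3 * h) / 2 * (d n \<omega>)\<^sup>2 \<le> exp (l * d n \<omega>)"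
      by (simp_all add: power_mult_distrib field_simps)
  qed
  note I = test_integrable[of "Suc n"]
  have "(\<integral>\<omega>. Z \<omega> * exp (l * d n \<omega>) \<partial>P)
      \<le> (\<integral>\<omega>. Z \<omega> * (1 + l * d n \<omega> + l\<^sup>2 * (1 + 3 * h) / 2 * (d n \<omega>)\<^sup>2) \<partial>P)"
    using up Z0 by (intro integral_mono I test_intros Z' mult_left_mono) auto
  also have "\<dots> = (\<integral>\<omega>. Z \<omega> * (1 + l\<^sup>2 * (1 + 3 * h) / 2 * s n \<omega>) \<partial>P)"
    by (rule quad)
  also have "\<dots> \<le> (\<integral>\<omega>. Z \<omega> * exp (l\<^sup>2 * (1 + 3 * h) / 2 * s n \<omega>) \<partial>P)"
    using Z0 by (intro integral_mono I test_intros Z' mult_left_mono exp_ge_add_one_self) auto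
  finally show "(\<integral>\<omega>. Z \<omega> * exp (l * d n \<omega>) \<partial>P)
      \<le> (\<integral>\<omega>. Z \<omega> * exp (l\<^sup>2 * (1 + 3 * h) / 2 * s n \<omega>) \<partial>P)" .
  \<comment> \<open>By \<open>1 - 4 * h \<le> (1 - 3 * h) * (1 - h)\<close> the loss is split
    between the Taylor error and the passage from \<open>exp\<close> to \<open>1 + u\<close>;
    \<open>h \<le> 1 / 3\<close> keeps the first factor nonnegative.\<close>
  have ex: "exp (l\<^sup>2 * (1 - 4 * h) / 2 * s n \<omega>) \<le> 1 + l\<^sup>2 * (1 - 3 * h) / 2 * s n \<omega>"
    if w: "\<omega> \<in> space P" for \<omega>
  proof -
    define v where "v = l\<^sup>2 * s n \<omega> / 2"
    have v0: "0 \<le> v"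
      using s_nonneg[OF w] by (simp add: v_def)
    have "l\<^sup>2 * s n \<omega> \<le> l\<^sup>2 * (c n)\<^sup>2"
      using s_bound[OF w] by (simp add: mult_left_mono)
    also have "\<dots> = (\<bar>l\<bar> * c n)\<^sup>2"
      by (simp add: power_mult_distrib)
    also have "\<dots> \<le> h\<^sup>2"
      using h c_nonneg by (intro power_mono) auto
    also have "\<dots> \<le> h"
      using h h0 by (simp add: power2_eq_square mult_left_le)
    finally have vh: "v \<le> h"
      using h0 by (simp add: v_def)
    have "exp (v * (1 - 4 * h)) \<le> exp ((v * (1 - 3 * h)) * (1 - h))"
      using v0 h0 by (auto simp: algebra_simps)
    also have "\<dots> \<le> 1 + v * (1 - 3 * h)"
    proof (rule one_plus_ge_exp)
      have "v * (1 - 3 * h) \<le> v * 1"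
        using v0 h0 by (intro mult_left_mono) auto
      then show "v * (1 - 3 * h) \<le> h"
        using vh by simp
    qed (use v0 h in auto)
    finally show ?thesis by (simp add: v_def algebra_simps)
  qed
  have "(\<integral>\<omega>. Z \<omega> * exp (l\<^sup>2 * (1 - 4 * h) / 2 * s n \<omega>) \<partial>P)
      \<le> (\<integral>\<omega>. Z \<omega> * (1 + l\<^sup>2 * (1 - 3 * h) / 2 * s n \<omega>) \<partial>P)"
    using Z0 ex by (intro integral_mono I test_intros Z' mult_left_mono) auto
  also have "\<dots> = (\<integral>\<omega>. Z \<omega> * (1 + l * d n \<omega> + l\<^sup>2 * (1 - 3 * h) / 2 * (d n \<omega>)\<^sup>2) \<partial>P)"
    by (rule quad[symmetric])
  also have "\<dots> \<le> (\<integral>\<omega>. Z \<omega> * exp (l * d n \<omega>) \<partial>P)"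
    using lo Z0 by (intro integral_mono I test_intros Z' mult_left_mono) auto
  finally show "(\<integral>\<omega>. Z \<omega> * exp (l\<^sup>2 * (1 - 4 * h) / 2 * s n \<omega>) \<partial>P)
      \<le> (\<integral>\<omega>. Z \<omega> * exp (l * d n \<omega>) \<partial>P)" .
qed


text \<open>Supermartingale property of the compensated exponential after time \<open>m\<close>; the
  weight \<open>Z\<close> from the past stands in for conditioning.\<close>

lemma exp_upper:
  assumes mn: "m \<le> n" and Z: "test m Z" and Z0: "\<And>\<omega>. \<omega> \<in> space P \<Longrightarrow> 0 \<le> Z \<omega>"
    and h: "\<And>j. m \<le> j \<Longrightarrow> j < n \<Longrightarrow> \<bar>l\<bar> * c j \<le> h" "h \<le> 1 / 3"
    and k: "k = l\<^sup>2 * (1 + 3 * h) / 2"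
  shows "(\<integral>\<omega>. Z \<omega> * exp (l * (mart n \<omega> - mart m \<omega>) - k * (qvar n \<omega> - qvar m \<omega>)) \<partial>P)
    \<le> (\<integral>\<omega>. Z \<omega> \<partial>P)"
  using mn h(1)
proof (induction n rule: dec_induct)
  case base
  then show ?case by simp
next
  case (step n)
  \<comment> \<open>Here \<open>qvar\<close> already runs to \<open>Suc n\<close>: being predictable
    it may be part of the weight, and the factor \<open>exp (k * s n)\<close> produced by
    \<open>exp_step\<close> cancels its last term.\<close>
  define Z' where "Z' \<omega> = Z \<omega> * exp (l * (mart n \<omega> - mart m \<omega>) - k * (qvar (Suc n) \<omega> - qvar m \<omega>))" for \<omega>
  have "test n Z'"
    unfolding Z'_def[abs_def] using step.hyps by (intro test_intros test_mono[OF Z]) auto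
  note st = exp_step(1)[OF this _ step.prems[OF step.hyps(1) lessI] h(2), folded k]
  have "(\<integral>\<omega>. Z \<omega> * exp (l * (mart (Suc n) \<omega> - mart m \<omega>) - k * (qvar (Suc n) \<omega> - qvar m \<omega>)) \<partial>P)
      = (\<integral>\<omega>. Z' \<omega> * exp (l * d n \<omega>) \<partial>P)"
    by (simp add: Z'_def mart_def algebra_simps flip: exp_add)
  also have "\<dots> \<le> (\<integral>\<omega>. Z' \<omega> * exp (k * s n \<omega>) \<partial>P)"
    using Z0 by (intro st) (auto simp: Z'_def)
  also have "\<dots> = (\<integral>\<omega>. Z \<omega> * exp (l * (mart n \<omega> - mart m \<omega>) - k * (qvar n \<omega> - qvar m \<omega>)) \<partial>P)"
    by (simp add: Z'_def qvar_def algebra_simps flip: exp_add)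
  also have "\<dots> \<le> (\<integral>\<omega>. Z \<omega> \<partial>P)"
    using step by auto
  finally show ?case .
qed

text \<open>With the smaller compensator the exponential is a submartingale. This bounds the total
  mass of the tilted measure from below in \<open>lower_tail\<close>.\<close>

lemma exp_lower:
  assumes mn: "m \<le> n" and Z: "test m Z" and Z0: "\<And>\<omega>. \<omega> \<in> space P \<Longrightarrow> 0 \<le> Z \<omega>"
    and h: "\<And>j. m \<le> j \<Longrightarrow> j < n \<Longrightarrow> \<bar>l\<bar> * c j \<le> h" "h \<le> 1 / 3"
    and k: "k = l\<^sup>2 * (1 - 4 * h) / 2"
  shows "(\<integral>\<omega>. Z \<omega> \<partial>P)
    \<le> (\<integral>\<omega>. Z \<omega> * exp (l * (mart n \<omega> - mart m \<omega>) - k * (qvar n \<omega> - qvar m \<omega>)) \<partial>P)"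
  using mn h(1)
proof (induction n rule: dec_induct)
  case base
  then show ?case by simp
next
  case (step n)
  define Z' where "Z' \<omega> = Z \<omega> * exp (l * (mart n \<omega> - mart m \<omega>) - k * (qvar (Suc n) \<omega> - qvar m \<omega>))" for \<omega>
  have "test n Z'"
    unfolding Z'_def[abs_def] using step.hyps by (intro test_intros test_mono[OF Z]) auto
  note st = exp_step(2)[OF this _ step.prems[OF step.hyps(1) lessI] h(2), folded k]
  have "(\<integral>\<omega>. Z \<omega> \<partial>P)
      \<le> (\<integral>\<omega>. Z \<omega> * exp (l * (mart n \<omega> - mart m \<omega>) - k * (qvar n \<omega> - qvar m \<omega>)) \<partial>P)"
    using step by auto
  also have "\<dots> = (\<integral>\<omega>. Z' \<omega> * exp (k * s n \<omega>) \<partial>P)"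
    by (simp add: Z'_def qvar_def algebra_simps flip: exp_add)
  also have "\<dots> \<le> (\<integral>\<omega>. Z' \<omega> * exp (l * d n \<omega>) \<partial>P)"
    using Z0 by (intro st) (auto simp: Z'_def)
  also have "\<dots> = (\<integral>\<omega>. Z \<omega> * exp (l * (mart (Suc n) \<omega> - mart m \<omega>) - k * (qvar (Suc n) \<omega> - qvar m \<omega>)) \<partial>P)"
    by (simp add: Z'_def mart_def algebra_simps flip: exp_add)
  finally show ?case .
qed

section \<open>A maximal inequality and the upper and lower tail bounds\<close>

lemma maximal_inequality:
  assumes Z: "\<And>j. test j (Z j)" and Z0: "\<And>j \<omega>. \<omega> \<in> space P \<Longrightarrow> 0 \<le> Z j \<omega>"
    and super: "\<And>j A. j < n \<Longrightarrow> A \<in> sets (F j) \<Longrightarrow>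
      (\<integral>\<omega>. indicator A \<omega> * Z (Suc j) \<omega> \<partial>P) \<le> (\<integral>\<omega>. indicator A \<omega> * Z j \<omega> \<partial>P)"
    and u: "0 < u"
  shows "u * prob {\<omega> \<in> space P. \<exists>j\<le>n. u \<le> Z j \<omega>} \<le> (\<integral>\<omega>. Z 0 \<omega> \<partial>P)"
proof -
  define A where "A j = {\<omega> \<in> space P. \<forall>i\<le>j. Z i \<omega> < u}" for j
  have A: "A j \<in> sets (F j)" for j
  proof -
    have "{\<omega> \<in> space (F j). Z i \<omega> < u} \<in> sets (F j)" if "i \<le> j" for i
    proof -
      have [measurable]: "Z i \<in> borel_measurable (F j)"
        using test_mono[OF Z that] by (simp only: test_def)
      show ?thesis by measurable
    qed
    then have "(\<Inter>i\<in>{..j}. {\<omega> \<in> space (F j). Z i \<omega> < u}) \<in> sets (F j)"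
      by (intro sets.finite_INT) auto
    also have "(\<Inter>i\<in>{..j}. {\<omega> \<in> space (F j). Z i \<omega> < u}) = A j"
      by (auto simp: A_def)
    finally show ?thesis .
  qed
  have AP [measurable]: "A j \<in> sets P" for j
    using A sets_F by blast
  \<comment> \<open>Mass that has reached level \<open>u\<close> is frozen at \<open>u\<close>, the
    rest is carried by \<open>Z m\<close>. In each step the set \<open>D\<close> of first crossings
    moves from the second term to the first.\<close>
  have key: "m \<le> n \<Longrightarrow> u * prob (space P - A m) + (\<integral>\<omega>. indicator (A m) \<omega> * Z m \<omega> \<partial>P) \<le> (\<integral>\<omega>. Z 0 \<omega> \<partial>P)"
    for m
  proof (induction m)
    case 0
    have 1: "test 0 (\<lambda>\<omega>. u * indicator (space P - A 0) \<omega>)"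
      using A[of 0] by (intro test_intros) (metis sets.compl_sets space_F)
    have 2: "test 0 (\<lambda>\<omega>. indicator (A 0) \<omega> * Z 0 \<omega>)"
      by (intro test_intros Z A)
    have "(\<integral>\<omega>. u * indicator (space P - A 0) \<omega> + indicator (A 0) \<omega> * Z 0 \<omega> \<partial>P) \<le> (\<integral>\<omega>. Z 0 \<omega> \<partial>P)"
      using Z0 by (intro integral_mono test_integrable[of 0] test_add 1 2 Z) (auto simp: A_def indicator_def)
    then show ?case
      using test_integrable[OF 1] test_integrable[OF 2] by simp
  next
    case (Suc m)
    define D where "D = A m - A (Suc m)"
    have D: "D \<in> sets (F (Suc m))"
      unfolding D_def using A F_Suc by blast
    have Dsub: "D \<in> sets P" using D sets_F by blast
    have ASub: "A (Suc m) \<subseteq> A m" by (auto simp: A_def)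
    have 1: "test (Suc m) (\<lambda>\<omega>. u * indicator D \<omega>)"
      by (intro test_intros D)
    have 2: "test (Suc m) (\<lambda>\<omega>. indicator (A (Suc m)) \<omega> * Z (Suc m) \<omega>)"
      by (intro test_intros Z A)
    have 3: "test (Suc m) (\<lambda>\<omega>. indicator (A m) \<omega> * Z (Suc m) \<omega>)"
      using A F_Suc by (intro test_intros Z) blast
    have "(\<integral>\<omega>. u * indicator D \<omega> + indicator (A (Suc m)) \<omega> * Z (Suc m) \<omega> \<partial>P)
        \<le> (\<integral>\<omega>. indicator (A m) \<omega> * Z (Suc m) \<omega> \<partial>P)"
      using Z0 ASub
      by (intro integral_mono test_integrable[of "Suc m"] test_add 1 2 3)
        (auto simp: A_def D_def indicator_def le_Suc_eq not_less)
    then have "u * prob D + (\<integral>\<omega>. indicator (A (Suc m)) \<omega> * Z (Suc m) \<omega> \<partial>P)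
        \<le> (\<integral>\<omega>. indicator (A m) \<omega> * Z (Suc m) \<omega> \<partial>P)"
      using test_integrable[OF 1] test_integrable[OF 2] Dsub by simp
    also have "\<dots> \<le> (\<integral>\<omega>. indicator (A m) \<omega> * Z m \<omega> \<partial>P)"
      using Suc.prems A by (intro super) auto
    finally have "u * (prob (space P - A m) + prob D) + (\<integral>\<omega>. indicator (A (Suc m)) \<omega> * Z (Suc m) \<omega> \<partial>P)
        \<le> (\<integral>\<omega>. Z 0 \<omega> \<partial>P)"
      using Suc by (simp add: distrib_left)
    moreover have "prob (space P - A m) + prob D = prob (space P - A (Suc m))"
    proof -
      have "space P - A (Suc m) = (space P - A m) \<union> D"
        using ASub AP[THEN sets.sets_into_space] by (auto simp: D_def)
      then show ?thesis
        using Dsub by (simp add: D_def finite_measure_Union[symmetric] Diff_Int_distrib)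
          (subst finite_measure_Union, auto)
    qed
    ultimately show ?case by simp
  qed
  have "{\<omega> \<in> space P. \<exists>j\<le>n. u \<le> Z j \<omega>} = space P - A n"
    by (auto simp: A_def not_less)
  moreover have "0 \<le> (\<integral>\<omega>. indicator (A n) \<omega> * Z n \<omega> \<partial>P)"
    using Z0 by (intro integral_nonneg_AE AE_I2) auto
  ultimately show ?thesis
    using key[of n] by simp
qed

lemma qvar_mono: "\<omega> \<in> space P \<Longrightarrow> m \<le> n \<Longrightarrow> qvar m \<omega> \<le> qvar n \<omega>"
  unfolding qvar_def by (intro sum_mono2) (auto simp: s_nonneg)

lemma mart_measurable [measurable]: "mart n \<in> borel_measurable P"
  using test_mart[OF order_refl] by (auto simp: test_def intro: measurable_P)

lemma qvar_measurable [measurable]: "qvar n \<in> borel_measurable P"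
  using test_qvar[of n n] by (auto simp: test_def intro: measurable_P)

text \<open>Paths with \<open>qvar n \<le> v\<close> that reach \<open>a\<close> push the
  exponential supermartingale above \<open>exp (l * a - k * v)\<close>. The other paths are merely
  counted, their probability being estimated separately.\<close>

lemma max_tail:
  assumes l: "0 < l" and h: "\<And>j. j < n \<Longrightarrow> l * c j \<le> h" "h \<le> 1 / 3"
    and k: "k = l\<^sup>2 * (1 + 3 * h) / 2" "0 \<le> k"
  shows "prob {\<omega> \<in> space P. \<exists>j\<le>n. a \<le> mart j \<omega>}
    \<le> exp (k * v - l * a) + prob {\<omega> \<in> space P. v < qvar n \<omega>}"
proof -
  define Z where "Z j \<omega> = exp (l * mart j \<omega> - k * qvar j \<omega>)" for j \<omega>
  have tZ: "test j (Z j)" for j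
    unfolding Z_def[abs_def] by (intro test_intros) auto
  define u where "u = exp (l * a - k * v)"
  have "u * prob {\<omega> \<in> space P. \<exists>j\<le>n. u \<le> Z j \<omega>} \<le> (\<integral>\<omega>. Z 0 \<omega> \<partial>P)"
  proof (rule maximal_inequality[OF tZ])
    fix j A assume j: "j < n" and A: "A \<in> sets (F j)"
    have "test j (\<lambda>\<omega>. indicator A \<omega> * Z j \<omega>)"
      by (intro test_intros tZ A)
    note up = exp_upper[OF _ this, of "Suc j" l h k]
    have "(\<integral>\<omega>. indicator A \<omega> * Z (Suc j) \<omega> \<partial>P) = (\<integral>\<omega>. indicator A \<omega> * Z j \<omega> *
        exp (l * (mart (Suc j) \<omega> - mart j \<omega>) - k * (qvar (Suc j) \<omega> - qvar j \<omega>)) \<partial>P)"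
      by (simp add: Z_def algebra_simps flip: exp_add)
    also have "\<dots> \<le> (\<integral>\<omega>. indicator A \<omega> * Z j \<omega> \<partial>P)"
    proof (rule up)
      show "\<bar>l\<bar> * c i \<le> h" if "j \<le> i" "i < Suc j" for i
        using that j h(1)[of i] l by auto
    qed (use h k in \<open>auto simp: Z_def\<close>)
    finally show "(\<integral>\<omega>. indicator A \<omega> * Z (Suc j) \<omega> \<partial>P) \<le> (\<integral>\<omega>. indicator A \<omega> * Z j \<omega> \<partial>P)" .
  qed (auto simp: Z_def u_def)
  also have "(\<integral>\<omega>. Z 0 \<omega> \<partial>P) = 1"
    by (simp add: Z_def mart_def qvar_def prob_space)
  finally have "prob {\<omega> \<in> space P. \<exists>j\<le>n. u \<le> Z j \<omega>} \<le> 1 / u"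
    by (simp add: u_def field_simps)
  also have "1 / u = exp (k * v - l * a)"
    by (simp add: u_def exp_diff)
  finally have 1: "prob {\<omega> \<in> space P. \<exists>j\<le>n. u \<le> Z j \<omega>} \<le> exp (k * v - l * a)" .
  have Zm [measurable]: "Z j \<in> borel_measurable P" for j
    using tZ by (auto simp: test_def intro: measurable_P)
  have "{\<omega> \<in> space P. \<exists>j\<le>n. a \<le> mart j \<omega>}
      \<subseteq> {\<omega> \<in> space P. \<exists>j\<le>n. u \<le> Z j \<omega>} \<union> {\<omega> \<in> space P. v < qvar n \<omega>}"
  proof safe
    fix \<omega> j assume w: "\<omega> \<in> space P" "j \<le> n" "a \<le> mart j \<omega>" "\<not> v < qvar n \<omega>"
    then have "qvar j \<omega> \<le> v"
      using qvar_mono[of \<omega> j n] by linarith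
    then have "u \<le> Z j \<omega>"
      unfolding u_def Z_def using w l k by (auto intro!: diff_mono mult_left_mono)
    then show "\<exists>j\<le>n. u \<le> Z j \<omega>"
      using w by blast
  qed
  then have "prob {\<omega> \<in> space P. \<exists>j\<le>n. a \<le> mart j \<omega>}
      \<le> prob ({\<omega> \<in> space P. \<exists>j\<le>n. u \<le> Z j \<omega>} \<union> {\<omega> \<in> space P. v < qvar n \<omega>})"
    by (intro finite_measure_mono) auto
  also have "\<dots> \<le> prob {\<omega> \<in> space P. \<exists>j\<le>n. u \<le> Z j \<omega>} + prob {\<omega> \<in> space P. v < qvar n \<omega>}"
    by (intro measure_Un_le) auto
  finally show ?thesis using 1 by linarith
qed

text \<open>Under the tilt by \<open>l\<close> the block increment should sit near
  \<open>l * w\<close>, at the Gaussian cost \<open>r = l^2 * w / 2\<close>. The tilted mass of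
  \<open>A\<close> is at least \<open>prob A\<close>. At most a quarter of \<open>prob A\<close> is
  lost to each of the ranges \<open>D \<le> (1 - e) * l * w\<close> and
  \<open>D \<ge> (1 + e) * l * w\<close>, and in between the density is at most
  \<open>exp ((1 + 3 * e) * r)\<close>. On \<open>bad\<close>, where the block variance is wrong,
  the crude deterministic bound \<open>K\<close> controls the second exponential moment. That
  \<open>A\<close> is an arbitrary event of the past makes up for the lack of independence.\<close>

lemma lower_tail:
  assumes mn: "m \<le> n" and A: "A \<in> sets (F m)" and l: "0 < l" and w: "0 < w" and t: "0 < t"
    and h: "\<And>j. m \<le> j \<Longrightarrow> j < n \<Longrightarrow> 2 * l * c j \<le> h" "0 \<le> h"
    and e: "0 < e" "e < 1" and \<delta>: "0 \<le> \<delta>" "4 * h + \<delta> + 3 * h * \<delta> \<le> e\<^sup>2 / 16"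
    and r: "r = l\<^sup>2 * w / 2" "4 \<le> r * e\<^sup>2"
    and K: "\<And>\<omega>. \<omega> \<in> space P \<Longrightarrow> qvar n \<omega> - qvar m \<omega> \<le> K * w"
    and bad: "bad = {\<omega> \<in> space P. qvar n \<omega> - qvar m \<omega> \<notin> {(1 - \<delta>) * w..(1 + \<delta>) * w}}"
  shows "exp (- (1 + 3 * e) * r) * prob A / 2 - (t * exp (8 * K * r) + prob bad / t) / 2
    \<le> prob (A \<inter> {\<omega> \<in> space P. (1 - e) * l * w < mart n \<omega> - mart m \<omega>})"
proof -
  define D where "D \<omega> = mart n \<omega> - mart m \<omega>" for \<omega>
  define V where "V \<omega> = qvar n \<omega> - qvar m \<omega>" for \<omega>
  \<comment> \<open>\<open>k0\<close> is the compensator of the submartingale. The other constants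
    compensate supermartingales with tilts \<open>(1 - e) * l\<close>, \<open>(1 + e) * l\<close>
    and \<open>2 * l\<close>; the last one controls the square of the density on
    \<open>bad\<close>.\<close>
  define k0 where "k0 = l\<^sup>2 * (1 - 4 * h) / 2"
  define lm where "lm = (1 - e) * l"
  define km where "km = lm\<^sup>2 * (1 + 3 * h) / 2"
  define lp where "lp = (1 + e) * l"
  define kp where "kp = lp\<^sup>2 * (1 + 3 * h) / 2"
  define k2 where "k2 = (2 * l)\<^sup>2 * (1 + 3 * h) / 2"
  define B where "B = A \<inter> {\<omega> \<in> space P. (1 - e) * l * w < D \<omega>}"
  define G where "G = exp ((1 + 3 * e) * r)"
  have e2: "e\<^sup>2 \<le> e" "0 \<le> e\<^sup>2"
    using e by (auto simp: power2_eq_square mult_left_le)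
  have hd: "0 \<le> h * \<delta>"
    using h \<delta> by simp
  have h4: "4 * h \<le> 1" and h3: "h \<le> 1 / 3"
    using \<delta> h e2 e hd by linarith+
  have r0: "0 < r"
    using l w by (simp add: r)
  have [measurable]: "A \<in> sets P" "D \<in> borel_measurable P" "V \<in> borel_measurable P"
    using A sets_F unfolding D_def[abs_def] V_def[abs_def] by (auto intro: borel_measurable_diff)
  have [measurable]: "B \<in> sets P" "bad \<in> sets P"
    unfolding B_def bad V_def[symmetric] by measurable
  have V0: "0 \<le> V \<omega>" if "\<omega> \<in> space P" for \<omega>
    using qvar_mono[OF that mn] by (simp add: V_def)
  have tA: "test m (indicator A)" and tA': "test n (indicator A)"
    using A F_mono[OF mn] by (auto intro: test_indicator)
  have hl: "\<bar>x\<bar> * c j \<le> h" if "m \<le> j" "j < n" "\<bar>x\<bar> \<le> 2 * l" for j x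
    using h(1)[OF that(1,2)] mult_right_mono[OF that(3) c_nonneg[of j]] by linarith
  have lm2: "\<bar>l\<bar> \<le> 2 * l" "\<bar>lm\<bar> \<le> 2 * l" "\<bar>lp\<bar> \<le> 2 * l" "\<bar>2 * l\<bar> \<le> 2 * l"
    using l e by (simp_all add: lm_def lp_def abs_mult)
  have I: "integrable P (\<lambda>\<omega>. indicator A \<omega> * exp (x * D \<omega> - y * V \<omega>))"
    "integrable P (\<lambda>\<omega>. exp (x * D \<omega> - y * V \<omega>))" for x y
    unfolding D_def V_def using mn by (auto intro!: test_integrable[of n] test_intros tA')
  have lo: "prob A \<le> (\<integral>\<omega>. indicator A \<omega> * exp (l * D \<omega> - k0 * V \<omega>) \<partial>P)"
    using exp_lower[OF mn tA _ hl[OF _ _ lm2(1)] h3 k0_def] by (auto simp: D_def V_def)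
  have um: "(\<integral>\<omega>. indicator A \<omega> * exp (lm * D \<omega> - km * V \<omega>) \<partial>P) \<le> prob A"
    using exp_upper[OF mn tA _ hl[OF _ _ lm2(2)] h3 km_def] by (auto simp: D_def V_def)
  have up: "(\<integral>\<omega>. indicator A \<omega> * exp (lp * D \<omega> - kp * V \<omega>) \<partial>P) \<le> prob A"
    using exp_upper[OF mn tA _ hl[OF _ _ lm2(3)] h3 kp_def] by (auto simp: D_def V_def)
  have u2: "(\<integral>\<omega>. exp (2 * l * D \<omega> - k2 * V \<omega>) \<partial>P) \<le> 1"
    using exp_upper[OF mn test_const[of m 1] _ hl[OF _ _ lm2(4)] h3 k2_def]
    by (auto simp: D_def V_def prob_space)
  \<comment> \<open>On blocks outside \<open>bad\<close> the compensators are expressed in units of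
    \<open>r\<close>, and the errors from \<open>h\<close> and \<open>\<delta>\<close> are absorbed
    into multiples of \<open>e\<^sup>2\<close>.\<close>
  have k0w: "(1 - e\<^sup>2 / 4) * r \<le> k0 * ((1 - \<delta>) * w)"
  proof -
    have "(1 - e\<^sup>2 / 4) \<le> (1 - 4 * h) * (1 - \<delta>)"
    proof -
      have "(1 - 4 * h) * (1 - \<delta>) = 1 - 4 * h - \<delta> + 4 * (h * \<delta>)"
        by (simp add: algebra_simps)
      then show ?thesis
        using \<delta> hd e2(2) h(2) by linarith
    qed
    then have "(1 - e\<^sup>2 / 4) * r \<le> (1 - 4 * h) * (1 - \<delta>) * r"
      using r0 by (intro mult_right_mono) auto
    also have "\<dots> = k0 * ((1 - \<delta>) * w)"
      by (simp add: k0_def r)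
    finally show ?thesis .
  qed
  have hd1: "(1 + 3 * h) * (1 + \<delta>) \<le> 1 + e\<^sup>2 / 16"
    using \<delta> h by (simp add: algebra_simps)
  have kmw: "km * ((1 + \<delta>) * w) \<le> (1 - e)\<^sup>2 * (1 + e\<^sup>2 / 16) * r"
  proof -
    have "km * ((1 + \<delta>) * w) = (1 - e)\<^sup>2 * r * ((1 + 3 * h) * (1 + \<delta>))"
      by (simp add: km_def lm_def r power_mult_distrib)
    also have "\<dots> \<le> (1 - e)\<^sup>2 * r * (1 + e\<^sup>2 / 16)"
      using hd1 r0 by (intro mult_left_mono) auto
    finally show ?thesis by (simp only: mult_ac)
  qed
  have kpw: "kp * ((1 + \<delta>) * w) \<le> (1 + e)\<^sup>2 * (1 + e\<^sup>2 / 16) * r"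
  proof -
    have "kp * ((1 + \<delta>) * w) = (1 + e)\<^sup>2 * r * ((1 + 3 * h) * (1 + \<delta>))"
      by (simp add: kp_def lp_def r power_mult_distrib)
    also have "\<dots> \<le> (1 + e)\<^sup>2 * r * (1 + e\<^sup>2 / 16)"
      using hd1 r0 by (intro mult_left_mono) auto
    finally show ?thesis by (simp only: mult_ac)
  qed
  \<comment> \<open>The hypothesis \<open>4 \<le> r * e\<^sup>2\<close> bounds the left side by
    \<open>exp (- 2)\<close>.\<close>
  have quarter: "exp (- (r * e\<^sup>2 / 2)) \<le> 1 / 4"
  proof -
    have "(4::real) \<le> 2 * 2" by simp
    also have "\<dots> \<le> exp 1 * exp 1"
      using exp_ge_add_one_self[of 1] by (intro mult_mono) auto
    also have "\<dots> = exp 2" by (simp flip: exp_add)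
    also have "\<dots> \<le> exp (r * e\<^sup>2 / 2)" using r by simp
    finally show ?thesis by (simp add: exp_minus field_simps)
  qed
  have k2w: "exp (k2 * (K * w)) \<le> exp (8 * K * r)" if "\<omega> \<in> space P" for \<omega>
  proof -
    have "0 \<le> K * w" using V0[OF that] K[OF that] by (simp add: V_def)
    then have "0 \<le> K" using w by (simp add: zero_le_mult_iff)
    then have "(1 + 3 * h) * (4 * K * r) \<le> 2 * (4 * K * r)"
      using h3 r0 by (intro mult_right_mono) auto
    then show ?thesis by (simp add: k2_def r power_mult_distrib algebra_simps)
  qed
  have pt: "indicator A \<omega> * exp (l * D \<omega> - k0 * V \<omega>)
      \<le> (t * (exp (8 * K * r) * exp (2 * l * D \<omega> - k2 * V \<omega>)) + indicator bad \<omega> / t) / 2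
        + 1 / 4 * (indicator A \<omega> * exp (lm * D \<omega> - km * V \<omega>))
        + 1 / 4 * (indicator A \<omega> * exp (lp * D \<omega> - kp * V \<omega>)) + G * indicator B \<omega>"
    (is "?L \<le> ?b + ?m + ?p + ?B")
    if w': "\<omega> \<in> space P" for \<omega>
  proof -
    have nn: "0 \<le> ?b" "0 \<le> ?m" "0 \<le> ?p" "0 \<le> ?B"
      using t by (auto simp: G_def indicator_def)
    consider "\<omega> \<notin> A" | "\<omega> \<in> A" "\<omega> \<in> bad" | "\<omega> \<in> A" "\<omega> \<notin> bad" "D \<omega> \<le> (1 - e) * l * w"
      | "\<omega> \<in> A" "\<omega> \<notin> bad" "(1 + e) * l * w \<le> D \<omega>"
      | "\<omega> \<in> A" "\<omega> \<notin> bad" "(1 - e) * l * w < D \<omega>" "D \<omega> < (1 + e) * l * w"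
      by fastforce
    then show ?thesis
    proof cases
      case 1
      then show ?thesis using nn by simp
    next
      case 2
      define y where "y = exp (l * D \<omega>)"
      have "?L \<le> y"
        using h4 V0[OF w'] 2 by (simp add: y_def k0_def)
      \<comment> \<open>AM-GM with the free parameter \<open>t\<close> replaces the Cauchy--Schwarz inequality\<close>
      also have "y \<le> (t * y\<^sup>2 + 1 / t) / 2"
      proof -
        have "0 \<le> (t * y - 1)\<^sup>2 / t" using t by simp
        then show ?thesis using t by (simp add: power2_eq_square field_simps)
      qed
      also have "y\<^sup>2 = exp (k2 * V \<omega>) * exp (2 * l * D \<omega> - k2 * V \<omega>)"
        by (simp add: y_def flip: exp_add exp_double)
      also have "exp (k2 * V \<omega>) \<le> exp (k2 * (K * w))"
        using K[OF w'] h by (auto simp: k2_def V_def intro!: mult_left_mono)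
      also have "\<dots> \<le> exp (8 * K * r)"
        by (rule k2w[OF w'])
      finally have "?L \<le> ?b"
        using 2 t by simp
      then show ?thesis using nn by linarith
    next
      case 3
      then have V: "(1 - \<delta>) * w \<le> V \<omega>" "V \<omega> \<le> (1 + \<delta>) * w"
        using w' by (auto simp: bad V_def)
      have "k0 * ((1 - \<delta>) * w) \<le> k0 * V \<omega>" "km * V \<omega> \<le> km * ((1 + \<delta>) * w)"
        using V h4 h by (auto simp: k0_def km_def intro!: mult_left_mono)
      moreover have "e * (l * D \<omega>) \<le> e * (l * ((1 - e) * l * w))"
        using 3 e l by (intro mult_left_mono) auto
      moreover have "e * (l * ((1 - e) * l * w)) = 2 * e * (1 - e) * r"
        by (simp add: r power2_eq_square)
      \<comment> \<open>Without error terms the exponent is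
        \<open>2 * e * (1 - e) + (1 - e)\<^sup>2 - 1 = - e\<^sup>2\<close>; the errors may use up
        half of this gain.\<close>
      moreover have "2 * e * (1 - e) * r + (1 - e)\<^sup>2 * (1 + e\<^sup>2 / 16) * r - (1 - e\<^sup>2 / 4) * r
          \<le> - (r * e\<^sup>2 / 2)"
      proof -
        have "(1 - e)\<^sup>2 \<le> 1" using e by (simp add: power_le_one)
        then have "(1 - e)\<^sup>2 * (e\<^sup>2 / 16) \<le> 1 * (e\<^sup>2 / 16)"
          using e2 by (intro mult_right_mono) auto
        then have "2 * e * (1 - e) + (1 - e)\<^sup>2 * (1 + e\<^sup>2 / 16) - (1 - e\<^sup>2 / 4) \<le> - (e\<^sup>2 / 2)"
        proof -
          have "2 * e * (1 - e) + (1 - e)\<^sup>2 * (1 + e\<^sup>2 / 16) - (1 - e\<^sup>2 / 4)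
              = (1 - e)\<^sup>2 * (e\<^sup>2 / 16) - 3 / 4 * e\<^sup>2"
            by (simp add: power2_eq_square algebra_simps)
          then show ?thesis
            using \<open>(1 - e)\<^sup>2 * (e\<^sup>2 / 16) \<le> 1 * (e\<^sup>2 / 16)\<close> e2(2) by linarith
        qed
        from mult_right_mono[OF this less_imp_le[OF r0]] show ?thesis
          by (simp add: algebra_simps)
      qed
      moreover have "l * D \<omega> = lm * D \<omega> + e * (l * D \<omega>)"
        by (simp add: lm_def algebra_simps)
      ultimately have "l * D \<omega> - k0 * V \<omega> \<le> - (r * e\<^sup>2 / 2) + (lm * D \<omega> - km * V \<omega>)"
        using k0w kmw by linarith
      then have "exp (l * D \<omega> - k0 * V \<omega>) \<le> exp (- (r * e\<^sup>2 / 2)) * exp (lm * D \<omega> - km * V \<omega>)"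
        by (simp flip: exp_add)
      also have "\<dots> \<le> 1 / 4 * exp (lm * D \<omega> - km * V \<omega>)"
        using quarter by (intro mult_right_mono) auto
      finally have "?L \<le> ?m" using 3 by simp
      then show ?thesis using nn by linarith
    next
      case 4
      then have V: "(1 - \<delta>) * w \<le> V \<omega>" "V \<omega> \<le> (1 + \<delta>) * w"
        using w' by (auto simp: bad V_def)
      have "k0 * ((1 - \<delta>) * w) \<le> k0 * V \<omega>" "kp * V \<omega> \<le> kp * ((1 + \<delta>) * w)"
        using V h4 h by (auto simp: k0_def kp_def intro!: mult_left_mono)
      moreover have "e * (l * ((1 + e) * l * w)) \<le> e * (l * D \<omega>)"
        using 4 e l by (intro mult_left_mono) auto
      moreover have "e * (l * ((1 + e) * l * w)) = 2 * e * (1 + e) * r"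
        by (simp add: r power2_eq_square)
      \<comment> \<open>The leading terms are now
        \<open>(1 + e)\<^sup>2 - 2 * e * (1 + e) - 1\<close>, again
        \<open>- e\<^sup>2\<close>.\<close>
      moreover have "(1 + e)\<^sup>2 * (1 + e\<^sup>2 / 16) * r - 2 * e * (1 + e) * r - (1 - e\<^sup>2 / 4) * r
          \<le> - (r * e\<^sup>2 / 2)"
      proof -
        have "(1 + e)\<^sup>2 \<le> 2\<^sup>2" using e by (intro power_mono) auto
        then have "(1 + e)\<^sup>2 * (e\<^sup>2 / 16) \<le> 4 * (e\<^sup>2 / 16)"
          using e2 by (intro mult_right_mono) auto
        then have "(1 + e)\<^sup>2 * (1 + e\<^sup>2 / 16) - 2 * e * (1 + e) - (1 - e\<^sup>2 / 4) \<le> - (e\<^sup>2 / 2)"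
        proof -
          have "(1 + e)\<^sup>2 * (1 + e\<^sup>2 / 16) - 2 * e * (1 + e) - (1 - e\<^sup>2 / 4)
              = (1 + e)\<^sup>2 * (e\<^sup>2 / 16) - 3 / 4 * e\<^sup>2"
            by (simp add: power2_eq_square algebra_simps)
          then show ?thesis
            using \<open>(1 + e)\<^sup>2 * (e\<^sup>2 / 16) \<le> 4 * (e\<^sup>2 / 16)\<close> e2(2) by linarith
        qed
        from mult_right_mono[OF this less_imp_le[OF r0]] show ?thesis
          by (simp add: algebra_simps)
      qed
      moreover have "l * D \<omega> = lp * D \<omega> - e * (l * D \<omega>)"
        by (simp add: lp_def algebra_simps)
      ultimately have "l * D \<omega> - k0 * V \<omega> \<le> - (r * e\<^sup>2 / 2) + (lp * D \<omega> - kp * V \<omega>)"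
        using k0w kpw by linarith
      then have "exp (l * D \<omega> - k0 * V \<omega>) \<le> exp (- (r * e\<^sup>2 / 2)) * exp (lp * D \<omega> - kp * V \<omega>)"
        by (simp flip: exp_add)
      also have "\<dots> \<le> 1 / 4 * exp (lp * D \<omega> - kp * V \<omega>)"
        using quarter by (intro mult_right_mono) auto
      finally have "?L \<le> ?p" using 4 by simp
      then show ?thesis using nn by linarith
    next
      case 5
      then have V: "(1 - \<delta>) * w \<le> V \<omega>"
        using w' by (auto simp: bad V_def)
      have "k0 * ((1 - \<delta>) * w) \<le> k0 * V \<omega>"
        using V h4 by (auto simp: k0_def intro!: mult_left_mono)
      moreover have "l * D \<omega> \<le> l * ((1 + e) * l * w)"
        using 5 l by (intro mult_left_mono) auto
      moreover have "l * ((1 + e) * l * w) = 2 * (1 + e) * r"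
        by (simp add: r power2_eq_square)
      \<comment> \<open>The leading cost is \<open>(1 + 2 * e) * r\<close>; the spare
        \<open>e * r\<close> covers the error \<open>e\<^sup>2 / 4 * r\<close>.\<close>
      moreover have "2 * (1 + e) * r - (1 - e\<^sup>2 / 4) * r \<le> (1 + 3 * e) * r"
      proof -
        have "2 * (1 + e) - (1 - e\<^sup>2 / 4) \<le> 1 + 3 * e"
          using e2 e by simp
        from mult_right_mono[OF this less_imp_le[OF r0]] show ?thesis
          by (simp add: algebra_simps)
      qed
      ultimately have "l * D \<omega> - k0 * V \<omega> \<le> (1 + 3 * e) * r"
        using k0w by linarith
      then have "?L \<le> ?B"
        using 5 w' by (simp add: G_def B_def)
      then show ?thesis using nn by linarith
    qed
  qed
  have "prob A \<le> (\<integral>\<omega>. indicator A \<omega> * exp (l * D \<omega> - k0 * V \<omega>) \<partial>P)"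
    by (rule lo)
  also have "\<dots> \<le> (\<integral>\<omega>. (t * (exp (8 * K * r) * exp (2 * l * D \<omega> - k2 * V \<omega>)) + indicator bad \<omega> / t) / 2
        + 1 / 4 * (indicator A \<omega> * exp (lm * D \<omega> - km * V \<omega>))
        + 1 / 4 * (indicator A \<omega> * exp (lp * D \<omega> - kp * V \<omega>)) + G * indicator B \<omega> \<partial>P)"
    using pt by (intro integral_mono I Bochner_Integration.integrable_add integrable_mult_right
        integrable_divide) (auto simp: integrable_real_indicator less_top[symmetric])
  also have "\<dots> = (t * (exp (8 * K * r) * (\<integral>\<omega>. exp (2 * l * D \<omega> - k2 * V \<omega>) \<partial>P)) + prob bad / t) / 2
        + 1 / 4 * (\<integral>\<omega>. indicator A \<omega> * exp (lm * D \<omega> - km * V \<omega>) \<partial>P)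
        + 1 / 4 * (\<integral>\<omega>. indicator A \<omega> * exp (lp * D \<omega> - kp * V \<omega>) \<partial>P) + G * prob B"
    using I(1)[of lm km] I(1)[of lp kp] I(2)[of "2 * l" k2] by (simp add: less_top[symmetric])
  also have "\<dots> \<le> (t * (exp (8 * K * r) * 1) + prob bad / t) / 2 + 1 / 4 * prob A + 1 / 4 * prob A + G * prob B"
    using um up u2 t by (intro add_mono divide_right_mono mult_left_mono) (auto simp: G_def)
  finally have fin: "prob A / 2 - (t * exp (8 * K * r) + prob bad / t) / 2 \<le> G * prob B"
    by simp
  \<comment> \<open>Division by \<open>G\<close> only shrinks the error term, which is therefore
    kept at its original size.\<close>
  have G1: "1 \<le> G" using e r0 by (simp add: G_def)
  have Ginv: "exp (- (1 + 3 * e) * r) = 1 / G"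
    by (simp add: G_def field_simps flip: exp_add exp_minus)
  have "exp (- (1 + 3 * e) * r) * prob A / 2 - (t * exp (8 * K * r) + prob bad / t) / 2 / G \<le> prob B"
    unfolding Ginv using divide_right_mono[OF fin, of G] G1 by (simp add: diff_divide_distrib)
  moreover have "(t * exp (8 * K * r) + prob bad / t) / 2 / G \<le> (t * exp (8 * K * r) + prob bad / t) / 2 / 1"
    using G1 t by (intro divide_left_mono) auto
  ultimately have "exp (- (1 + 3 * e) * r) * prob A / 2 - (t * exp (8 * K * r) + prob bad / t) / 2 \<le> prob B"
    by linarith
  then show ?thesis
    unfolding B_def D_def .
qed

end

text \<open>Independence is replaced by a lower bound for \<open>B k\<close> on the event that no
  \<open>B j\<close> with \<open>m \<le> j < k\<close> has occurred. If the probability of that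
  event had a positive limit \<open>q\<close>, step \<open>k\<close> would remove at least
  \<open>q * pr k\<close> from it, up to the summable \<open>r k\<close>; this is impossible when
  \<open>pr\<close> is not summable.\<close>

lemma (in prob_space) AE_infinitely_often:
  fixes r pr :: "nat \<Rightarrow> real"
  assumes meas: "\<And>k. B k \<in> events" and p: "\<And>k. 0 \<le> pr k" "\<not> summable pr" and r: "summable r" "\<And>k. 0 \<le> r k"
    and step: "\<And>m k. m \<le> k \<Longrightarrow> K \<le> m \<Longrightarrow> pr k * prob (space M - (\<Union>j\<in>{m..<k}. B j)) - r k
      \<le> prob ((space M - (\<Union>j\<in>{m..<k}. B j)) \<inter> B k)"
  shows "AE \<omega> in M. \<exists>\<^sub>F k in sequentially. \<omega> \<in> B k"
proof -
  define N where "N m k = space M - (\<Union>j\<in>{m..<k}. B j)" for m k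
  have N [measurable]: "N m k \<in> events" for m k
    unfolding N_def using meas by (intro sets.Diff sets.finite_UN) auto
  define Ninf where "Ninf m = space M - (\<Union>j\<in>{m..}. B j)" for m
  have Ninf [measurable]: "Ninf m \<in> events" for m
    unfolding Ninf_def using meas by (intro sets.Diff sets.countable_UN'') auto
  have NS: "N m (Suc k) = N m k - (N m k \<inter> B k)" if "m \<le> k" for m k
    using that by (auto simp: N_def less_Suc_eq)
  have rec: "prob (N m (Suc k)) \<le> (1 - pr k) * prob (N m k) + r k" if "m \<le> k" "K \<le> m" for m k
  proof -
    have "prob (N m (Suc k)) = prob (N m k) - prob (N m k \<inter> B k)"
      unfolding NS[OF that(1)] using meas N by (intro finite_measure_Diff sets.Int) auto
    then show ?thesis
      using step[OF that] unfolding N_def[symmetric] by (simp add: algebra_simps)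
  qed
  have le: "prob (Ninf m) \<le> (\<Sum>k. r (k + m))" if m: "K \<le> m" for m
  proof -
    define q where "q = prob (Ninf m)"
    have q: "q \<le> prob (N m k)" for k
      unfolding q_def by (rule finite_measure_mono[OF _ N]) (auto simp: N_def Ninf_def)
    have tel: "prob (N m (m + k)) \<le> 1 - q * (\<Sum>i<k. pr (i + m)) + (\<Sum>i<k. r (i + m))" for k
    proof (induction k)
      case 0
      then show ?case by simp
    next
      case (Suc k)
      have "pr (k + m) * q \<le> pr (k + m) * prob (N m (m + k))"
        using q p by (intro mult_left_mono) auto
      with rec[of m "m + k"] Suc m show ?case
        by (simp add: algebra_simps)
    qed
    have sr: "summable (\<lambda>i. r (i + m))"
      using r summable_iff_shift by blast
    have bound: "q * (\<Sum>i<k. pr (i + m)) \<le> 1 + (\<Sum>i. r (i + m))" for k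
      using tel[of k] sum_le_suminf[OF sr, of "{..<k}"] r measure_nonneg[of M "N m (m + k)"]
      by (simp del: measure_nonneg)
    have "q = 0"
    proof (rule ccontr)
      assume "q \<noteq> 0"
      then have "0 < q"
        by (simp add: q_def zero_less_measure_iff)
      then have "(\<Sum>i<k. pr (i + m)) \<le> (1 + (\<Sum>i. r (i + m))) / q" for k
        using bound[of k] by (simp add: field_simps)
      then have "summable (\<lambda>i. pr (i + m))"
        using p by (intro summableI_nonneg_bounded) auto
      then show False
        using p summable_iff_shift by blast
    qed
    then show ?thesis
      using r sr by (simp add: q_def suminf_nonneg)
  qed
  have "prob (Ninf m) = 0" for m
  proof -
    have "(\<lambda>i. \<Sum>k. r (k + i)) \<longlonglongrightarrow> 0"
      using r(1) by (rule suminf_exist_split2)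
    moreover have "\<forall>\<^sub>F i in sequentially. prob (Ninf m) \<le> (\<Sum>k. r (k + i))"
      using eventually_ge_at_top[of "max K m"]
    proof eventually_elim
      case (elim i)
      \<comment> \<open>The sets \<open>Ninf\<close> increase with their index, so a bound for late
        indices covers every \<open>m\<close>, including those below \<open>K\<close>.\<close>
      have "prob (Ninf m) \<le> prob (Ninf i)"
        using elim by (intro finite_measure_mono[OF _ Ninf]) (auto simp: Ninf_def)
      also have "\<dots> \<le> (\<Sum>k. r (k + i))"
        using elim by (intro le) auto
      finally show ?case .
    qed
    ultimately have "prob (Ninf m) \<le> 0"
      by (rule tendsto_lowerbound) simp
    then show ?thesis by (simp add: measure_le_0_iff)
  qed
  then have "AE \<omega> in M. \<omega> \<notin> Ninf m" for m
    by (subst AE_iff_measurable[OF Ninf]) (auto simp: emeasure_eq_measure Ninf_def)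
  then have "AE \<omega> in M. \<forall>m. \<omega> \<notin> Ninf m"
    by (simp add: AE_all_countable)
  then show ?thesis
    by (rule AE_mp) (auto simp: Ninf_def frequently_sequentially intro!: AE_I2)
qed

section \<open>The law of the iterated logarithm for martingales\<close>

lemma filterlim_power_at_top:
  assumes "1 < (\<theta>::real)"
  shows "filterlim (\<lambda>k::nat. \<theta> ^ k) at_top sequentially"
  using assms by real_asymp

lemma powr_of_power: "0 < \<theta> \<Longrightarrow> (\<theta> ^ k) powr a = (\<theta> powr a) ^ k" for \<theta> :: real
  by (simp add: powr_realpow[symmetric] powr_powr mult.commute)

lemma summable_power_powr:
  assumes "1 < (\<theta>::real)" "a < 0"
  shows "summable (\<lambda>k. (\<theta> ^ k) powr a)"
  using assms by (simp add: powr_of_power summable_geometric powr_less_one)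

definition lil_norm :: "real \<Rightarrow> real" where
  "lil_norm w = sqrt (2 * w * ln (ln w))"

lemma lil_norm_nonneg: "exp 1 \<le> w \<Longrightarrow> 0 \<le> lil_norm w"
proof -
  assume "exp 1 \<le> w"
  then have "1 \<le> ln w" "0 < w"
    using less_le_trans[OF exp_gt_zero] ln_ge_iff by blast+
  then show "0 \<le> lil_norm w" by (simp add: lil_norm_def)
qed

text \<open>From \<open>exp 1\<close> on \<open>ln (ln w)\<close> is nonnegative, so both factors
  under the root are nonnegative and increasing.\<close>

lemma lil_norm_mono:
  assumes "exp 1 \<le> v" "v \<le> w"
  shows "lil_norm v \<le> lil_norm w"
proof -
  have v: "0 < v" using assms(1) less_le_trans[OF exp_gt_zero] by blast
  then have "1 \<le> ln v" using assms(1) by (simp add: ln_ge_iff)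
  moreover have "ln v \<le> ln w" using v assms(2) by simp
  ultimately have "0 \<le> ln (ln v)" "ln (ln v) \<le> ln (ln w)"
    by simp_all
  then show ?thesis
    using v assms(2) unfolding lil_norm_def by (intro real_sqrt_le_mono mult_mono) auto
qed

text \<open>\<open>B\<close> is a deterministic clock for the random \<open>qvar\<close>. The
  exponent \<open>\<gamma>\<close> measures a polynomial gain over the order \<open>B n\<close>,
  both for the squared increments and for the mean deviation of \<open>qvar\<close>; summed along
  powers of \<open>\<theta>\<close>, relative errors \<open>w powr - \<gamma>\<close> form a
  geometric series.\<close>

locale martingale_lil = martingale_increments P F d s c
  for P :: "'b measure" and F :: "nat \<Rightarrow> 'b measure" and d s :: "nat \<Rightarrow> 'b \<Rightarrow> real" and c :: "nat \<Rightarrow> real" +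
  fixes B :: "nat \<Rightarrow> real" and C K \<gamma> :: real
  assumes B_pos: "0 < B 0" and B_mono: "m \<le> n \<Longrightarrow> B m \<le> B n"
    and B_at_top: "filterlim B at_top sequentially"
    and B_step: "B (Suc n) \<le> B n + (c n)\<^sup>2"
    and \<gamma>: "0 < \<gamma>" "\<gamma> < 1"
    and c_small: "(c n)\<^sup>2 \<le> C * B (Suc n) powr (1 - \<gamma>)"
    and qvar_bound: "\<omega> \<in> space P \<Longrightarrow> qvar n \<omega> \<le> K * B n"
    and qvar_dev: "(\<integral>\<omega>. \<bar>qvar n \<omega> - B n\<bar> \<partial>P) \<le> C * B n powr (1 - \<gamma>)"
begin

lemma B_gt0: "0 < B n"
  using B_pos B_mono[of 0 n] by linarith

lemma C_nonneg: "0 \<le> C"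
proof -
  have "0 \<le> C * B 0 powr (1 - \<gamma>)"
    by (rule order_trans[OF _ qvar_dev[of 0]]) (auto intro: integral_nonneg_AE)
  then show ?thesis
    using B_pos by (simp add: zero_le_mult_iff powr_gt_zero)
qed

lemma K_nonneg: "0 \<le> K"
proof -
  obtain \<omega> where "\<omega> \<in> space P" using not_empty by blast
  from qvar_bound[OF this, of 0] show ?thesis
    using B_pos by (simp add: qvar_def zero_le_mult_iff)
qed

text \<open>The last time at which the clock has not passed \<open>w\<close>, when
  \<open>B 0 \<le> w\<close>; for smaller \<open>w\<close> the value is 0. Looking at the next clock
  value turns a maximum into a \<open>LEAST\<close>.\<close>

definition idx :: "real \<Rightarrow> nat" where
  "idx w = (LEAST n. w < B (Suc n))"

lemma idx_gt: "w < B (Suc (idx w))"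
proof -
  have "\<forall>\<^sub>F n in sequentially. w < B (Suc n)"
    using filterlim_compose[OF B_at_top filterlim_Suc] by (simp add: filterlim_at_top_dense)
  then have "\<exists>n. w < B (Suc n)"
    by (auto simp: eventually_sequentially)
  then show ?thesis
    unfolding idx_def by (rule LeastI_ex)
qed

lemma B_idx_le: "B 0 \<le> w \<Longrightarrow> B (idx w) \<le> w"
  using not_less_Least[of "idx w - 1" "\<lambda>n. w < B (Suc n)"]
  by (cases "idx w") (auto simp: idx_def[symmetric])

lemma le_idx: "B n \<le> w \<Longrightarrow> n \<le> idx w"
  using idx_gt[of w] B_mono[of "Suc (idx w)" n] by (meson leD le_less_trans not_less_eq_eq)

lemma idx_mono: "B 0 \<le> v \<Longrightarrow> v \<le> w \<Longrightarrow> idx v \<le> idx w"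
  using B_idx_le le_idx order_trans by blast

lemma idx_at_top: "filterlim idx sequentially at_top"
  unfolding filterlim_at_top
proof
  fix n
  show "\<forall>\<^sub>F w in at_top. n \<le> idx w"
    using eventually_ge_at_top[of "B n"] by eventually_elim (rule le_idx)
qed

text \<open>The next clock value \<open>x\<close> exceeds \<open>w\<close>, and a single step is at
  most \<open>C * x powr (1 - \<gamma>)\<close>, which is negligible against
  \<open>x\<close>.\<close>

lemma B_idx_ge:
  assumes "0 < \<delta>"
  shows "\<forall>\<^sub>F w in at_top. (1 - \<delta>) * w \<le> B (idx w)"
proof -
  have "\<forall>\<^sub>F x in at_top. C * x powr (1 - \<gamma>) \<le> \<delta> * x"
    using assms \<gamma> by real_asymp
  then obtain x0 where x0: "\<And>x. x0 \<le> x \<Longrightarrow> C * x powr (1 - \<gamma>) \<le> \<delta> * x"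
    by (auto simp: eventually_at_top_linorder)
  show ?thesis
    using eventually_ge_at_top[of "max 0 x0"]
  proof eventually_elim
    case (elim w)
    define x where "x = B (Suc (idx w))"
    have x: "w < x" by (simp add: x_def idx_gt)
    then have "C * x powr (1 - \<gamma>) \<le> \<delta> * x" using elim by (intro x0) auto
    then have "(1 - \<delta>) * x \<le> B (idx w)"
      using B_step[of "idx w"] c_small[of "idx w"] unfolding x_def[symmetric] by (simp add: algebra_simps)
    \<comment> \<open>For \<open>\<delta> > 1\<close> the factor is negative and monotonicity
      reverses; then positivity of \<open>B\<close> is enough.\<close>
    moreover have "(1 - \<delta>) * w \<le> B (idx w)" if "1 - \<delta> < 0"
    proof -
      have "(1 - \<delta>) * w \<le> 0" using that elim by (simp add: mult_nonpos_nonneg)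
      then show ?thesis using B_gt0[of "idx w"] by linarith
    qed
    moreover have "(1 - \<delta>) * w \<le> (1 - \<delta>) * x" if "0 \<le> 1 - \<delta>"
      using that x by (intro mult_left_mono) auto
    ultimately show ?case by (meson not_le order_trans)
  qed
qed

text \<open>\<open>sqrt (2 * ln (ln w) / w)\<close> is the optimal tilt for the level
  \<open>lil_norm w\<close> at variance \<open>w\<close>. The factor 2 is there because the lower
  bound also uses the doubled tilt.\<close>

lemma tilt_small:
  assumes "0 < h"
  shows "\<forall>\<^sub>F w in at_top. \<forall>j < idx w. 2 * sqrt (2 * ln (ln w) / w) * c j \<le> h"
proof -
  have "\<forall>\<^sub>F w in at_top. 8 * C * ln (ln w) / w * w powr (1 - \<gamma>) < h\<^sup>2"
  proof (rule order_tendstoD)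
    show "((\<lambda>w. 8 * C * ln (ln w) / w * w powr (1 - \<gamma>)) \<longlongrightarrow> 0) at_top"
      using \<gamma> by real_asymp
  qed (use assms in auto)
  moreover have "\<forall>\<^sub>F w in at_top. 0 \<le> ln (ln (w::real))" by real_asymp
  moreover have "\<forall>\<^sub>F w in at_top. max 1 (B 0) \<le> (w::real)" by (rule eventually_ge_at_top)
  ultimately show ?thesis
  proof eventually_elim
    case (elim w)
    show ?case
    proof safe
      fix j assume j: "j < idx w"
      have "(c j)\<^sup>2 \<le> C * B (Suc j) powr (1 - \<gamma>)" by (rule c_small)
      also have "\<dots> \<le> C * w powr (1 - \<gamma>)"
        using B_mono[of "Suc j" "idx w"] j elim B_idx_le[of w] B_gt0[of "Suc j"] C_nonneg \<gamma>
        by (intro mult_left_mono powr_mono2) auto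
      finally have cj: "(c j)\<^sup>2 \<le> C * w powr (1 - \<gamma>)" .
      have "(2 * sqrt (2 * ln (ln w) / w) * c j)\<^sup>2 = (8 * ln (ln w) / w) * (c j)\<^sup>2"
        using elim by (simp add: power_mult_distrib)
      also have "\<dots> \<le> (8 * ln (ln w) / w) * (C * w powr (1 - \<gamma>))"
        using elim cj by (intro mult_left_mono) auto
      also have "\<dots> \<le> h\<^sup>2" using elim by (simp add: mult_ac)
      finally show "2 * sqrt (2 * ln (ln w) / w) * c j \<le> h"
        using assms by (meson power2_le_imp_le less_imp_le)
    qed
  qed
qed

lemma qvar_dev_prob:
  assumes "0 < \<delta>" "0 < w" "B n \<le> w"
  shows "prob {\<omega> \<in> space P. \<delta> * w \<le> \<bar>qvar n \<omega> - B n\<bar>} \<le> C / \<delta> * w powr - \<gamma>"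
proof -
  have "integrable P (\<lambda>\<omega>. \<bar>qvar n \<omega> - B n\<bar>)"
    by (intro Bochner_Integration.integrable_abs test_integrable[of n] test_intros) auto
  then have "prob {\<omega> \<in> space P. \<delta> * w \<le> \<bar>qvar n \<omega> - B n\<bar>} \<le> (\<integral>\<omega>. \<bar>qvar n \<omega> - B n\<bar> \<partial>P) / (\<delta> * w)"
    using assms by (intro integral_Markov_inequality_measure[where A = "{}"]) auto
  also have "\<dots> \<le> C * w powr (1 - \<gamma>) / (\<delta> * w)"
  proof (intro divide_right_mono order_trans[OF qvar_dev] mult_left_mono powr_mono2)
  qed (use assms \<gamma> C_nonneg B_gt0[of n] in auto)
  also have "\<dots> = C / \<delta> * w powr - \<gamma>"
    using assms by (simp add: powr_diff powr_minus field_simps)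
  finally show ?thesis .
qed

section \<open>Upper half of the law along geometric blocks\<close>

lemma upper_block:
  assumes e: "0 < e" "e < 1"
  shows "\<forall>\<^sub>F w in at_top. prob {\<omega> \<in> space P. \<exists>j\<le>idx w. (1 + e) * lil_norm w \<le> mart j \<omega>}
    \<le> exp (- (1 + e) * ln (ln w)) + C / (e / 12) * w powr - \<gamma>"
proof -
  have "0 < e / 12" using e by simp
  from tilt_small[OF this]
  have "\<forall>\<^sub>F w in at_top. \<forall>j < idx w. 2 * sqrt (2 * ln (ln w) / w) * c j \<le> e / 12" .
  moreover have "\<forall>\<^sub>F w in at_top. 0 < ln (ln (w::real))" by real_asymp
  moreover have "\<forall>\<^sub>F w in at_top. max 1 (B 0) \<le> (w::real)" by (rule eventually_ge_at_top)
  ultimately show ?thesis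
  proof eventually_elim
    case (elim w)
    define l where "l = sqrt (2 * ln (ln w) / w)"
    define k where "k = l\<^sup>2 * (1 + 3 * (e / 12)) / 2"
    have l: "0 < l" "l\<^sup>2 = 2 * ln (ln w) / w" using elim by (auto simp: l_def)
    have k0: "0 \<le> k" using e by (simp add: k_def)
    have lc: "l * c j \<le> e / 12" if "j < idx w" for j
    proof -
      have "0 \<le> l * c j" using l c_nonneg[of j] by simp
      moreover have "2 * (l * c j) \<le> e / 12" using elim(1) that by (simp add: l_def)
      ultimately show ?thesis by linarith
    qed
    have ll: "l * lil_norm w = 2 * ln (ln w)"
    proof -
      have "l * lil_norm w = sqrt ((2 * ln (ln w)) ^ 2)"
        unfolding l_def lil_norm_def real_sqrt_mult[symmetric] using elim
        by (simp add: power2_eq_square)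
      then show ?thesis using elim(2) by (simp only: real_sqrt_abs)
    qed
    have "prob {\<omega> \<in> space P. \<exists>j\<le>idx w. (1 + e) * lil_norm w \<le> mart j \<omega>}
      \<le> exp (k * ((1 + e / 12) * w) - l * ((1 + e) * lil_norm w))
        + prob {\<omega> \<in> space P. (1 + e / 12) * w < qvar (idx w) \<omega>}"
      using e by (intro max_tail[OF l(1) lc _ k_def k0]) auto
    also have "k * ((1 + e / 12) * w) - l * ((1 + e) * lil_norm w)
      = ln (ln w) * ((1 + e / 4) * (1 + e / 12) - 2 * (1 + e))"
    proof -
      have "k * ((1 + e / 12) * w) = ln (ln w) * ((1 + e / 4) * (1 + e / 12))"
        using elim(3) by (simp add: k_def l(2))
      moreover have "l * ((1 + e) * lil_norm w) = (1 + e) * (l * lil_norm w)"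
        by (rule mult.left_commute)
      ultimately show ?thesis
        unfolding ll by (simp only: right_diff_distrib mult_ac)
    qed
    \<comment> \<open>The ideal exponent \<open>1 - 2 * (1 + e)\<close> lies below the target
      \<open>- (1 + e)\<close> by \<open>e\<close>; the two errors made with \<open>e / 12\<close>
      use less than half of that.\<close>
    also have "exp \<dots> \<le> exp (- (1 + e) * ln (ln w))"
    proof -
      have "e * e \<le> e" using e by (simp add: mult_left_le)
      then have "(1 + e / 4) * (1 + e / 12) - 2 * (1 + e) \<le> - (1 + e)"
        using e by (simp add: algebra_simps)
      then have "ln (ln w) * ((1 + e / 4) * (1 + e / 12) - 2 * (1 + e)) \<le> ln (ln w) * (- (1 + e))"
        using elim(2) by (intro mult_left_mono) auto
      then show ?thesis
        by (simp only: exp_le_cancel_iff mult.commute[of "ln (ln w)" "- (1 + e)"])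
    qed
    also have "prob {\<omega> \<in> space P. (1 + e / 12) * w < qvar (idx w) \<omega>}
        \<le> prob {\<omega> \<in> space P. e / 12 * w \<le> \<bar>qvar (idx w) \<omega> - B (idx w)\<bar>}"
    proof (rule finite_measure_mono)
      have "B (idx w) \<le> w" using B_idx_le[of w] elim(3) by simp
      then have "e / 12 * w \<le> \<bar>qvar (idx w) \<omega> - B (idx w)\<bar>" if "(1 + e / 12) * w < qvar (idx w) \<omega>" for \<omega>
        using that unfolding distrib_right by linarith
      then show "{\<omega> \<in> space P. (1 + e / 12) * w < qvar (idx w) \<omega>}
          \<subseteq> {\<omega> \<in> space P. e / 12 * w \<le> \<bar>qvar (idx w) \<omega> - B (idx w)\<bar>}"
        by blast
    qed measurable
    also have "\<dots> \<le> C / (e / 12) * w powr - \<gamma>"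
      using e elim B_idx_le[of w] by (intro qvar_dev_prob) auto
    finally show ?case by simp
  qed
qed

text \<open>As \<open>ln (\<theta> ^ k) = k * ln \<theta>\<close>, the terms are a constant times
  \<open>k powr (- (1 + e))\<close>.\<close>

lemma summable_exp_lnln:
  assumes "1 < (\<theta>::real)" "0 < e"
  shows "summable (\<lambda>k. exp (- (1 + e) * ln (ln (\<theta> ^ k))))"
proof (rule summable_comparison_test_ev)
  show "summable (\<lambda>k. (ln \<theta>) powr (- (1 + e)) * real k powr (- (1 + e)))"
    using assms by (intro summable_mult) (simp add: summable_real_powr_iff)
  show "\<forall>\<^sub>F k in sequentially. norm (exp (- (1 + e) * ln (ln (\<theta> ^ k))))
      \<le> (ln \<theta>) powr (- (1 + e)) * real k powr (- (1 + e))"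
    using eventually_gt_at_top[of 0]
  proof eventually_elim
    case (elim k)
    have "exp (- (1 + e) * ln (ln (\<theta> ^ k))) = (real k * ln \<theta>) powr (- (1 + e))"
      using assms elim by (simp add: powr_def ln_realpow)
    then show ?case
      using assms elim by (simp add: powr_mult mult.commute)
  qed
qed

lemma upper_one_sided:
  assumes e: "0 < e" "e < 1" and \<theta>: "1 < \<theta>"
  shows "AE \<omega> in P. \<forall>\<^sub>F k in sequentially. \<forall>j\<le>idx (\<theta> ^ k). mart j \<omega> < (1 + e) * lil_norm (\<theta> ^ k)"
proof -
  define E where "E k = {\<omega> \<in> space P. \<exists>j\<le>idx (\<theta> ^ k). (1 + e) * lil_norm (\<theta> ^ k) \<le> mart j \<omega>}" for k
  have E: "E k \<in> sets P" for k
    unfolding E_def by measurable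
  have ev: "\<forall>\<^sub>F k in sequentially. prob (E k)
      \<le> exp (- (1 + e) * ln (ln (\<theta> ^ k))) + C / (e / 12) * (\<theta> ^ k) powr - \<gamma>"
    unfolding E_def using eventually_compose_filterlim[OF upper_block[OF e] filterlim_power_at_top[OF \<theta>]] .
  have "summable (\<lambda>k. prob (E k))"
  proof (rule summable_comparison_test_ev)
    show "summable (\<lambda>k. exp (- (1 + e) * ln (ln (\<theta> ^ k))) + C / (e / 12) * (\<theta> ^ k) powr - \<gamma>)"
      using e \<theta> \<gamma> by (intro summable_add summable_mult summable_exp_lnln summable_power_powr) auto
  qed (use ev in simp)
  then have "AE \<omega> in P. \<forall>\<^sub>F k in sequentially. \<omega> \<in> space P - E k"
    by (intro borel_cantelli_AE1 E) (auto simp: less_top[symmetric])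
  then show ?thesis
  proof eventually_elim
    case (elim \<omega>)
    then show ?case
    proof eventually_elim
      case (elim k)
      then show ?case
        by (simp add: E_def) (metis not_le)
    qed
  qed
qed

text \<open>Variances and bounds do not see the sign of \<open>d\<close>; this turns the one-sided
  bound into one for the absolute value.\<close>

lemma negated: "martingale_lil P F (\<lambda>n \<omega>. - d n \<omega>) s c B C K \<gamma>"
proof -
  have "AE \<omega> in P. real_cond_exp P (F n) (\<lambda>\<omega>. - d n \<omega>) \<omega> = 0" for n
  proof -
    interpret sub: finite_measure_subalgebra P "F n" by (rule sub_sigma)
    have "integrable P (d n)" by (rule test_integrable[OF test_d[OF order_refl]])
    from sub.real_cond_exp_cmult[OF this, of "- 1"] cond_mean[of n] show ?thesis
      by eventually_elim simp
  qed
  then interpret neg: martingale_increments P F "\<lambda>n \<omega>. - d n \<omega>" s c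
    using subalg F_Suc d_measurable d_bound s_measurable s_nonneg s_bound cond_var
    by unfold_locales auto
  show ?thesis
    using B_pos B_mono B_at_top B_step \<gamma> c_small qvar_bound qvar_dev
    by unfold_locales (auto simp: neg.qvar_def qvar_def)
qed

lemma upper_blocks:
  assumes e: "0 < e" "e < 1" and \<theta>: "1 < \<theta>"
  shows "AE \<omega> in P. \<forall>\<^sub>F k in sequentially. \<forall>j\<le>idx (\<theta> ^ k). \<bar>mart j \<omega>\<bar> \<le> (1 + e) * lil_norm (\<theta> ^ k)"
proof -
  interpret neg: martingale_lil P F "\<lambda>n \<omega>. - d n \<omega>" s c B C K \<gamma>
    by (rule negated)
  have "neg.mart n \<omega> = - mart n \<omega>" for n \<omega>
    by (simp add: neg.mart_def mart_def sum_negf)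
  then have "AE \<omega> in P. \<forall>\<^sub>F k in sequentially. \<forall>j\<le>idx (\<theta> ^ k). - mart j \<omega> < (1 + e) * lil_norm (\<theta> ^ k)"
    using neg.upper_one_sided[OF e \<theta>] by simp
  with upper_one_sided[OF e \<theta>] show ?thesis
  proof eventually_elim
    case (elim \<omega>)
    then show ?case
      by eventually_elim (auto simp: abs_le_iff less_imp_le)
  qed
qed

text \<open>If \<open>B n\<close> lies between two consecutive powers of
  \<open>\<theta> = (1 + e)^2\<close>, then \<open>n\<close> precedes the time of the upper one.
  Returning from that power to \<open>B n\<close> costs \<open>1 + e\<close> for the root of
  \<open>\<theta>\<close> and at most another \<open>1 + e\<close> for the iterated logarithm; the
  third factor is the slack of the block bound.\<close>

lemma upper_lil:
  assumes e: "0 < e" "e < 1"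
  shows "AE \<omega> in P. \<forall>\<^sub>F n in sequentially. \<bar>mart n \<omega>\<bar> \<le> (1 + e) ^ 3 * lil_norm (B n)"
proof -
  define \<theta> where "\<theta> = (1 + e)\<^sup>2"
  have \<theta>: "1 < \<theta>" using e by (simp add: \<theta>_def one_less_power)
  have "\<forall>\<^sub>F w in at_top. ln (ln (\<theta> * w)) \<le> (1 + e) * ln (ln w)"
    using e \<theta> by real_asymp
  then have "\<forall>\<^sub>F w in at_top. ln (ln (\<theta> * w)) \<le> (1 + e) * ln (ln w) \<and> exp 1 \<le> w"
    using eventually_ge_at_top eventually_conj by blast
  then obtain w0 where w0: "\<And>w. w0 \<le> w \<Longrightarrow> ln (ln (\<theta> * w)) \<le> (1 + e) * ln (ln w)" "\<And>w. w0 \<le> w \<Longrightarrow> exp 1 \<le> w"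
    by (auto simp: eventually_at_top_linorder)
  have step: "lil_norm (\<theta> * w) \<le> (1 + e)\<^sup>2 * lil_norm w" if "w0 \<le> w" for w
  proof -
    have w: "exp 1 \<le> w" using w0 that by blast
    then have wp: "0 < w" using less_le_trans[OF exp_gt_zero] by blast
    then have "0 \<le> ln (ln w)" using w by (simp add: ln_ge_iff)
    then have "(1 + e) * ln (ln w) \<le> (1 + e)\<^sup>2 * ln (ln w)"
      using e by (intro mult_right_mono) (auto simp: power2_eq_square algebra_simps)
    with w0(1)[OF that] have "2 * (\<theta> * w) * ln (ln (\<theta> * w)) \<le> 2 * (\<theta> * w) * ((1 + e)\<^sup>2 * ln (ln w))"
      using \<theta> wp by (intro mult_left_mono) auto
    also have "\<dots> = ((1 + e)\<^sup>2)\<^sup>2 * (2 * w * ln (ln w))"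
      by (simp add: \<theta>_def power2_eq_square)
    finally have "lil_norm (\<theta> * w) \<le> sqrt (((1 + e)\<^sup>2)\<^sup>2 * (2 * w * ln (ln w)))"
      unfolding lil_norm_def by (rule real_sqrt_le_mono)
    also have "\<dots> = (1 + e)\<^sup>2 * lil_norm w"
      unfolding lil_norm_def real_sqrt_mult[of "((1 + e)\<^sup>2)\<^sup>2"] real_sqrt_abs by simp
    finally show ?thesis .
  qed
  show ?thesis
    using upper_blocks[OF e \<theta>]
  proof eventually_elim
    case (elim \<omega>)
    then obtain k0 where k0: "\<And>k j. k0 \<le> k \<Longrightarrow> j \<le> idx (\<theta> ^ k) \<Longrightarrow> \<bar>mart j \<omega>\<bar> \<le> (1 + e) * lil_norm (\<theta> ^ k)"
      by (auto simp: eventually_sequentially)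
    have "\<forall>\<^sub>F k in sequentially. w0 \<le> \<theta> ^ k"
      using filterlim_power_at_top[OF \<theta>] by (simp add: filterlim_at_top)
    then obtain k1 where k1: "\<And>k. k1 \<le> k \<Longrightarrow> w0 \<le> \<theta> ^ k"
      by (auto simp: eventually_sequentially)
    have "\<forall>\<^sub>F n in sequentially. \<theta> ^ (Suc (max k0 k1)) < B n"
      using B_at_top by (simp add: filterlim_at_top_dense)
    then show ?case
    proof eventually_elim
      case (elim n)
      define k where "k = (LEAST k. B n \<le> \<theta> ^ k)"
      have "\<exists>k. B n \<le> \<theta> ^ k"
        using filterlim_power_at_top[OF \<theta>] by (auto simp: filterlim_at_top eventually_sequentially)
      then have Bk: "B n \<le> \<theta> ^ k"
        unfolding k_def by (rule LeastI_ex)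
      have kgt: "Suc (max k0 k1) < k"
      proof (rule ccontr)
        assume "\<not> Suc (max k0 k1) < k"
        then have "\<theta> ^ k \<le> \<theta> ^ Suc (max k0 k1)"
          using \<theta> by (intro power_increasing) auto
        then show False using elim Bk by linarith
      qed
      then obtain k' where k': "k = Suc k'" by (cases k) auto
      have Bk': "\<theta> ^ k' < B n"
        using not_less_Least[of k' "\<lambda>k. B n \<le> \<theta> ^ k"] by (simp add: k_def[symmetric] k')
      have kk: "k0 \<le> k" "w0 \<le> \<theta> ^ k'" using kgt k1[of k'] k' by auto
      have "\<bar>mart n \<omega>\<bar> \<le> (1 + e) * lil_norm (\<theta> ^ k)"
        by (rule k0[OF kk(1) le_idx[OF Bk]])
      also have "\<dots> \<le> (1 + e) * ((1 + e)\<^sup>2 * lil_norm (\<theta> ^ k'))"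
        using step[OF kk(2)] e by (simp add: k')
      also have "\<dots> \<le> (1 + e) * ((1 + e)\<^sup>2 * lil_norm (B n))"
        using lil_norm_mono[OF w0(2)[OF kk(2)], of "B n"] Bk' e by (intro mult_left_mono) auto
      finally show ?case by (simp add: power3_eq_cube power2_eq_square mult.assoc)
    qed
  qed
qed


section \<open>Lower half of the law along widely spaced blocks\<close>

lemma lower_block:
  assumes e: "0 < e" "e < 1" and \<theta>: "128 / e\<^sup>2 \<le> \<theta>"
    and l: "l = sqrt (2 * (ln (ln w) / (1 + 3 * e)) / w)"
    and Bk: "Bk = {\<omega> \<in> space P. (1 - e) * l * w < mart (idx w) \<omega> - mart (idx (w / \<theta>)) \<omega>}"
    and ev: "\<forall>j < idx w. 2 * sqrt (2 * ln (ln w) / w) * c j \<le> e\<^sup>2 / 256"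
      "(1 - e\<^sup>2 / 128) * w \<le> B (idx w)" "4 * (1 + 3 * e) \<le> ln (ln w) * e\<^sup>2" "\<theta> * B 0 \<le> w" "1 \<le> w"
    and A: "A \<in> sets (F (idx (w / \<theta>)))"
  shows "exp (- ln (ln w)) / 2 * prob A
      - (w powr (- \<gamma> / 2) * exp (8 * K * (ln (ln w) / (1 + 3 * e))) + 256 * C / e\<^sup>2 * w powr (- \<gamma> / 2)) / 2
    \<le> prob (A \<inter> Bk)"
proof -
  \<comment> \<open>Dividing by \<open>1 + 3 * e\<close> offsets the loss in
    \<open>lower_tail\<close>: \<open>exp (- (1 + 3 * e) * r)\<close> becomes
    \<open>1 / ln w\<close>, which is harmonic along powers of \<open>\<theta>\<close>.\<close>
  define r where "r = ln (ln w) / (1 + 3 * e)"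
  define \<delta> where "\<delta> = e\<^sup>2 / 32"
  \<comment> \<open>\<open>prob bad\<close> is of order \<open>w powr - \<gamma>\<close> and
    \<open>exp (8 * K * r)\<close> is only a power of \<open>ln w\<close>, so this \<open>t\<close>
    makes both error terms decay polynomially.\<close>
  define t where "t = w powr (- \<gamma> / 2)"
  define bad where "bad = {\<omega> \<in> space P. qvar (idx w) \<omega> - qvar (idx (w / \<theta>)) \<omega>
      \<notin> {(1 - \<delta>) * w..(1 + \<delta>) * w}}"
  have e2: "0 < e\<^sup>2" "e\<^sup>2 \<le> e"
    using e by (auto simp: power2_eq_square mult_left_le)
  have "128 / 1 \<le> 128 / e\<^sup>2"
    using e e2 by (intro divide_left_mono) auto
  then have \<theta>1: "1 < \<theta>" "0 < \<theta>"
    using \<theta> by auto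
  have w\<theta>: "B 0 \<le> w / \<theta>" "w / \<theta> \<le> w"
    using \<theta>1 ev by (auto simp: field_simps)
  have lnw: "0 < ln (ln w)"
    using ev(3) e e2 by (smt (verit) zero_less_mult_pos2)
  have l0: "0 < l" "l\<^sup>2 = 2 * r / w"
    using e lnw ev by (auto simp: l r_def)
  have mn: "idx (w / \<theta>) \<le> idx w"
    by (rule idx_mono[OF w\<theta>])
  have t0: "0 < t" using ev by (simp add: t_def)
  have Bw: "B (idx w) \<le> w" "B (idx (w / \<theta>)) \<le> w / \<theta>"
    using B_idx_le w\<theta> by auto
  \<comment> \<open>The large ratio \<open>\<theta>\<close> makes the variance before the block at
    most a quarter of the tolerance \<open>\<delta> * w\<close>.\<close>
  have Bm: "B (idx (w / \<theta>)) \<le> \<delta> / 4 * w"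
  proof -
    have "1 / \<theta> \<le> e\<^sup>2 / 128" using \<theta> \<theta>1 e2 by (simp add: field_simps)
    then have "1 / \<theta> * w \<le> e\<^sup>2 / 128 * w" using ev(5) by (intro mult_right_mono) auto
    moreover have "1 / \<theta> * w = w / \<theta>" "e\<^sup>2 / 128 * w = \<delta> / 4 * w" by (simp_all add: \<delta>_def)
    ultimately show ?thesis using Bw(2) by linarith
  qed
  \<comment> \<open>The tolerance is split into four quarters, called \<open>t\<close> inside this
    fact only: two for the deviations of \<open>qvar\<close>, one for the clock falling short of
    \<open>w\<close>, one for the variance before the block.\<close>
  have close: "w - 4 * t \<le> v1 - v2 \<and> v1 - v2 \<le> w + 4 * t"
    if "\<bar>v1 - b1\<bar> < t" "\<bar>v2 - b2\<bar> < t" "w - t \<le> b1" "b1 \<le> w" "b2 \<le> t" "0 < b2"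
    for v1 b1 t v2 b2 w :: real
    using that by linarith
  have "prob bad \<le> prob ({\<omega> \<in> space P. \<delta> / 4 * w \<le> \<bar>qvar (idx w) \<omega> - B (idx w)\<bar>}
      \<union> {\<omega> \<in> space P. \<delta> / 4 * w \<le> \<bar>qvar (idx (w / \<theta>)) \<omega> - B (idx (w / \<theta>))\<bar>})"
  proof (rule finite_measure_mono)
    show "bad \<subseteq> {\<omega> \<in> space P. \<delta> / 4 * w \<le> \<bar>qvar (idx w) \<omega> - B (idx w)\<bar>}
      \<union> {\<omega> \<in> space P. \<delta> / 4 * w \<le> \<bar>qvar (idx (w / \<theta>)) \<omega> - B (idx (w / \<theta>))\<bar>}"
    proof (rule subsetI, rule ccontr)
      fix \<omega> assume "\<omega> \<in> bad" and n: "\<omega> \<notin> {\<omega> \<in> space P. \<delta> / 4 * w \<le> \<bar>qvar (idx w) \<omega> - B (idx w)\<bar>}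
      \<union> {\<omega> \<in> space P. \<delta> / 4 * w \<le> \<bar>qvar (idx (w / \<theta>)) \<omega> - B (idx (w / \<theta>))\<bar>}"
      then have *: "\<not> ((1 - \<delta>) * w \<le> qvar (idx w) \<omega> - qvar (idx (w / \<theta>)) \<omega> \<and>
          qvar (idx w) \<omega> - qvar (idx (w / \<theta>)) \<omega> \<le> (1 + \<delta>) * w)" and "\<omega> \<in> space P"
        by (auto simp: bad_def)
      with n have "\<bar>qvar (idx w) \<omega> - B (idx w)\<bar> < \<delta> / 4 * w"
        "\<bar>qvar (idx (w / \<theta>)) \<omega> - B (idx (w / \<theta>))\<bar> < \<delta> / 4 * w"
        by auto
      moreover have "(1 - \<delta> / 4) * w \<le> B (idx w)" using ev(2) by (simp add: \<delta>_def)
      moreover have "(1 - \<delta>) * w = w - 4 * (\<delta> / 4 * w)" "(1 + \<delta>) * w = w + 4 * (\<delta> / 4 * w)"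
        "(1 - \<delta> / 4) * w = w - \<delta> / 4 * w" "0 \<le> \<delta> / 4 * w"
        using ev e2 by (simp_all add: \<delta>_def algebra_simps)
      ultimately have "(1 - \<delta>) * w \<le> qvar (idx w) \<omega> - qvar (idx (w / \<theta>)) \<omega>"
        "qvar (idx w) \<omega> - qvar (idx (w / \<theta>)) \<omega> \<le> (1 + \<delta>) * w"
        using close[of "qvar (idx w) \<omega>" "B (idx w)" "\<delta> / 4 * w" "qvar (idx (w / \<theta>)) \<omega>" "B (idx (w / \<theta>))" w]
          Bw(1) Bm B_gt0[of "idx (w / \<theta>)"] by simp_all
      with * show False by blast
    qed
  qed measurable
  also have "\<dots> \<le> C / (\<delta> / 4) * w powr - \<gamma> + C / (\<delta> / 4) * w powr - \<gamma>"
    using ev e2 Bw w\<theta>(2) by (intro order_trans[OF measure_Un_le] add_mono qvar_dev_prob) (auto simp: \<delta>_def)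
  finally have pbad: "prob bad \<le> 256 * C / e\<^sup>2 * w powr - \<gamma>"
    by (simp add: \<delta>_def)
  have tt: "w powr - \<gamma> / t = w powr (- \<gamma> / 2)"
    using ev by (simp add: t_def flip: powr_diff)
  have "prob bad / t \<le> 256 * C / e\<^sup>2 * w powr - \<gamma> / t"
    using pbad t0 by (intro divide_right_mono) auto
  also have "\<dots> = 256 * C / e\<^sup>2 * (w powr - \<gamma> / t)"
    by simp
  also have "\<dots> = 256 * C / e\<^sup>2 * w powr (- \<gamma> / 2)"
    by (simp only: tt)
  finally have pbt: "prob bad / t \<le> 256 * C / e\<^sup>2 * w powr (- \<gamma> / 2)" .
  have "exp (- (1 + 3 * e) * r) * prob A / 2 - (t * exp (8 * K * r) + prob bad / t) / 2
    \<le> prob (A \<inter> {\<omega> \<in> space P. (1 - e) * l * w < mart (idx w) \<omega> - mart (idx (w / \<theta>)) \<omega>})"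
  proof (rule lower_tail[OF mn A l0(1) _ t0 _ _ e _ _ _ _ _ bad_def])
    \<comment> \<open>The \<open>h\<close> of \<open>lower_tail\<close> is
      \<open>e\<^sup>2 / 256\<close>. Then \<open>4 * h + \<delta>\<close> is
      \<open>3 / 64 * e\<^sup>2\<close>, and the product term fits into the remaining
      \<open>1 / 64 * e\<^sup>2\<close>.\<close>
    show "2 * l * c j \<le> e\<^sup>2 / 256" if "j < idx w" for j
    proof -
      have "ln (ln w) / (1 + 3 * e) \<le> ln (ln w) / 1"
        using e lnw by (intro divide_left_mono) auto
      then have "l \<le> sqrt (2 * ln (ln w) / w)"
        unfolding l using ev by (intro real_sqrt_le_mono divide_right_mono) auto
      then have "2 * l * c j \<le> 2 * sqrt (2 * ln (ln w) / w) * c j"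
        using c_nonneg by (intro mult_right_mono) auto
      with ev(1) that show ?thesis by fastforce
    qed
    have "e\<^sup>2 * e\<^sup>2 \<le> e\<^sup>2 * 1" using e e2 by (intro mult_left_mono) auto
    moreover have "4 * (e\<^sup>2 / 256) + \<delta> + 3 * (e\<^sup>2 / 256) * \<delta> = 3 / 64 * e\<^sup>2 + 3 / 8192 * (e\<^sup>2 * e\<^sup>2)"
      by (simp add: \<delta>_def)
    ultimately show "4 * (e\<^sup>2 / 256) + \<delta> + 3 * (e\<^sup>2 / 256) * \<delta> \<le> e\<^sup>2 / 16"
      using e2(1) by linarith
    show "r = l\<^sup>2 * w / 2" using l0 ev by simp
    show "4 \<le> r * e\<^sup>2" using ev e by (simp add: r_def field_simps)
    show "qvar (idx w) \<omega> - qvar (idx (w / \<theta>)) \<omega> \<le> K * w" if "\<omega> \<in> space P" for \<omega>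
    proof -
      have "0 \<le> qvar (idx (w / \<theta>)) \<omega>"
        using that by (auto simp: qvar_def s_nonneg intro!: sum_nonneg)
      moreover have "K * B (idx w) \<le> K * w" using Bw K_nonneg by (intro mult_left_mono)
      ultimately show ?thesis using qvar_bound[OF that, of "idx w"] by linarith
    qed
  qed (use ev e2 in \<open>auto simp: \<delta>_def\<close>)
  moreover have "- (1 + 3 * e) * r = - ln (ln w)"
  proof -
    have "(1 + 3 * e) * r = ln (ln w)"
      using e by (simp add: r_def)
    then show ?thesis by (simp only: mult_minus_left)
  qed
  ultimately have fin: "exp (- ln (ln w)) * prob A / 2 - (t * exp (8 * K * r) + prob bad / t) / 2 \<le> prob (A \<inter> Bk)"
    by (simp only: Bk)
  have "exp (- ln (ln w)) / 2 * prob A - (t * exp (8 * K * r) + 256 * C / e\<^sup>2 * t) / 2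
      \<le> exp (- ln (ln w)) * prob A / 2 - (t * exp (8 * K * r) + prob bad / t) / 2"
    using pbt[folded t_def] by (intro diff_mono divide_right_mono add_left_mono) simp_all
  also note fin
  finally show ?thesis
    unfolding r_def t_def .
qed

text \<open>Infinitely many blocks succeed, and the position at the start of a block is removed by
  the upper bound, which is small there because the variance is smaller by the factor
  \<open>128 / e\<^sup>2\<close>. The sign condition \<open>pos\<close> allows
  \<open>lil_norm (w k)\<close> to be lowered to the norm at the actual clock value.\<close>

lemma lower_lil:
  assumes e: "0 < e" "e < 1" and pos: "0 \<le> (1 - e) * sqrt (1 / (1 + 3 * e)) - e"
  shows "AE \<omega> in P. \<exists>\<^sub>F n in sequentially.
    ((1 - e) * sqrt (1 / (1 + 3 * e)) - e) * lil_norm (B n) \<le> \<bar>mart n \<omega>\<bar>"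
proof -
  define \<theta> where "\<theta> = 128 / e\<^sup>2"
  have e2: "0 < e\<^sup>2" "e\<^sup>2 \<le> 1"
    using e by (auto simp: power_le_one)
  have \<theta>: "128 \<le> \<theta>" "1 < \<theta>"
    using e2 by (auto simp: \<theta>_def field_simps)
  define w where "w k = \<theta> ^ Suc k" for k :: nat
  define l where "l k = sqrt (2 * (ln (ln (w k)) / (1 + 3 * e)) / w k)" for k
  define Bk where "Bk k = {\<omega> \<in> space P. (1 - e) * l k * w k < mart (idx (w k)) \<omega> - mart (idx (\<theta> ^ k)) \<omega>}" for k
  define pr where "pr k = exp (- ln (ln (w k))) / 2" for k
  define rr where "rr k = (w k powr (- \<gamma> / 2) * exp (8 * K * (ln (ln (w k)) / (1 + 3 * e)))
      + 256 * C / e\<^sup>2 * w k powr (- \<gamma> / 2)) / 2" for k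
  have wk: "w k / \<theta> = \<theta> ^ k" "1 \<le> w k" for k
    using \<theta> one_le_power[of \<theta> "Suc k"] by (auto simp: w_def)
  have w_top: "filterlim w at_top sequentially"
    unfolding w_def by (rule filterlim_compose[OF filterlim_power_at_top[OF \<theta>(2)] filterlim_Suc])
  have "\<forall>\<^sub>F w in at_top. 4 * (1 + 3 * e) \<le> ln (ln w) * e\<^sup>2"
    using e by real_asymp
  moreover have "\<forall>\<^sub>F w in at_top. \<forall>j < idx w. 2 * sqrt (2 * ln (ln w) / w) * c j \<le> e\<^sup>2 / 256"
    using e by (intro tilt_small) auto
  moreover have "\<forall>\<^sub>F w in at_top. (1 - e\<^sup>2 / 128) * w \<le> B (idx w)"
    using e by (intro B_idx_ge) auto
  moreover have "\<forall>\<^sub>F w in at_top. max (2 * exp 1) (\<theta> * B 0) \<le> w"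
    by (rule eventually_ge_at_top)
  ultimately have "\<forall>\<^sub>F w in at_top. 4 * (1 + 3 * e) \<le> ln (ln w) * e\<^sup>2
      \<and> (\<forall>j < idx w. 2 * sqrt (2 * ln (ln w) / w) * c j \<le> e\<^sup>2 / 256)
      \<and> (1 - e\<^sup>2 / 128) * w \<le> B (idx w) \<and> max (2 * exp 1) (\<theta> * B 0) \<le> w"
    by eventually_elim simp
  from eventually_compose_filterlim[OF this w_top]
  obtain k0 where k0: "\<And>k. k0 \<le> k \<Longrightarrow> 4 * (1 + 3 * e) \<le> ln (ln (w k)) * e\<^sup>2"
    "\<And>k. k0 \<le> k \<Longrightarrow> \<forall>j < idx (w k). 2 * sqrt (2 * ln (ln (w k)) / w k) * c j \<le> e\<^sup>2 / 256"
    "\<And>k. k0 \<le> k \<Longrightarrow> (1 - e\<^sup>2 / 128) * w k \<le> B (idx (w k))"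
    "\<And>k. k0 \<le> k \<Longrightarrow> max (2 * exp 1) (\<theta> * B 0) \<le> w k"
    unfolding eventually_sequentially by blast
  have Bk_sets: "Bk k \<in> sets P" for k
    unfolding Bk_def by measurable
  have Bk_F: "Bk k \<in> sets (F n)" if "idx (w k) \<le> n" "idx (\<theta> ^ k) \<le> n" for k n
  proof -
    have [measurable]: "mart i \<in> borel_measurable (F n)" if "i \<le> n" for i
      using test_mart[OF that] by (simp only: test_def)
    have "{\<omega> \<in> space (F n). (1 - e) * l k * w k < mart (idx (w k)) \<omega> - mart (idx (\<theta> ^ k)) \<omega>} \<in> sets (F n)"
      using that by measurable
    then show ?thesis by (simp add: Bk_def)
  qed
  have io: "AE \<omega> in P. \<exists>\<^sub>F k in sequentially. \<omega> \<in> Bk k"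
  proof (rule AE_infinitely_often[where pr = pr and r = rr and K = k0])
    show "Bk k \<in> events" for k by (rule Bk_sets)
    show "0 \<le> pr k" for k by (simp add: pr_def)
    show "0 \<le> rr k" for k using C_nonneg by (simp add: rr_def)
    have pr: "pr k = inverse (2 * ln \<theta>) * inverse (real (Suc k))" for k
    proof -
      have "ln (w k) = real (Suc k) * ln \<theta>"
        using \<theta> by (simp add: w_def ln_realpow del: power_Suc)
      moreover have "0 < real (Suc k) * ln \<theta>" using \<theta> by simp
      ultimately show ?thesis
        by (simp add: pr_def exp_minus field_simps)
    qed
    show "\<not> summable pr"
    proof
      assume "summable pr"
      then have "summable (\<lambda>k. (2 * ln \<theta>) * pr k)" by (rule summable_mult)
      then have "summable (\<lambda>k. inverse (real (Suc k)))"
        using \<theta> by (simp add: pr)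
      then show False
        using not_summable_harmonic[where 'a = real] summable_Suc_iff[of "\<lambda>k. inverse (real k)"] by simp
    qed
    \<comment> \<open>The exponential is a power of \<open>ln w\<close>, hence absorbed by half of
      the polynomial decay.\<close>
    have "\<forall>\<^sub>F w in at_top. exp (8 * K * (ln (ln w) / (1 + 3 * e))) * w powr (- \<gamma> / 2) \<le> w powr (- \<gamma> / 4)"
    proof -
      have "\<forall>\<^sub>F w in at_top. exp (8 * K / (1 + 3 * e) * ln (ln w)) * w powr (- \<gamma> / 2) \<le> w powr (- \<gamma> / 4)"
        using \<gamma> by real_asymp
      then show ?thesis by simp
    qed
    from eventually_compose_filterlim[OF this w_top]
    have "\<forall>\<^sub>F k in sequentially. norm (rr k) \<le> w k powr (- \<gamma> / 4) + 256 * C / e\<^sup>2 * w k powr (- \<gamma> / 2)"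
    proof eventually_elim
      case (elim k)
      have "0 \<le> rr k" using C_nonneg by (simp add: rr_def)
      moreover have "rr k \<le> w k powr (- \<gamma> / 4) + 256 * C / e\<^sup>2 * w k powr (- \<gamma> / 2)"
      proof -
        have "rr k \<le> 2 * rr k" using \<open>0 \<le> rr k\<close> by simp
        also have "\<dots> \<le> w k powr (- \<gamma> / 4) + 256 * C / e\<^sup>2 * w k powr (- \<gamma> / 2)"
          using elim unfolding rr_def by (simp add: mult.commute)
        finally show ?thesis .
      qed
      ultimately show ?case by simp
    qed
    then show "summable rr"
    proof (rule summable_comparison_test_ev)
      have "summable (\<lambda>k. w k powr a)" if "a < 0" for a
        using summable_power_powr[OF \<theta>(2) that] unfolding w_def by (subst summable_Suc_iff)
      then show "summable (\<lambda>k. w k powr (- \<gamma> / 4) + 256 * C / e\<^sup>2 * w k powr (- \<gamma> / 2))"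
        using \<gamma> by (intro summable_add summable_mult) auto
    qed
    fix i k assume ik: "i \<le> k" "k0 \<le> i"
    have B0: "B 0 \<le> \<theta> ^ j" if "k0 \<le> j" for j
      using k0(4)[OF that] \<theta> by (simp add: w_def)
    \<comment> \<open>Earlier blocks end no later than the current one starts, so their events
      belong to its past.\<close>
    have A: "space P - (\<Union>j\<in>{i..<k}. Bk j) \<in> sets (F (idx (w k / \<theta>)))"
    proof -
      have "Bk j \<in> sets (F (idx (\<theta> ^ k)))" if "j \<in> {i..<k}" for j
      proof (rule Bk_F)
        have j: "k0 \<le> j" "Suc j \<le> k" using that ik by auto
        show "idx (w j) \<le> idx (\<theta> ^ k)" "idx (\<theta> ^ j) \<le> idx (\<theta> ^ k)"
          unfolding w_def using j \<theta> B0 by (auto intro!: idx_mono power_increasing simp del: power_Suc)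
      qed
      then have "space (F (idx (\<theta> ^ k))) - (\<Union>j\<in>{i..<k}. Bk j) \<in> sets (F (idx (\<theta> ^ k)))"
        by (intro sets.compl_sets sets.finite_UN) auto
      then show ?thesis by (simp add: wk)
    qed
    have k: "k0 \<le> k" using ik by simp
    have "exp (- ln (ln (w k))) / 2 * prob (space P - (\<Union>j\<in>{i..<k}. Bk j))
      - (w k powr (- \<gamma> / 2) * exp (8 * K * (ln (ln (w k)) / (1 + 3 * e))) + 256 * C / e\<^sup>2 * w k powr (- \<gamma> / 2)) / 2
      \<le> prob ((space P - (\<Union>j\<in>{i..<k}. Bk j)) \<inter> Bk k)"
    proof (rule lower_block[OF e _ l_def _ k0(2)[OF k] k0(3)[OF k] k0(1)[OF k] _ wk(2) A])
      show "128 / e\<^sup>2 \<le> \<theta>" by (simp add: \<theta>_def)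
      show "\<theta> * B 0 \<le> w k" using k0(4)[OF k] by simp
      show "Bk k = {\<omega> \<in> space P. (1 - e) * l k * w k < mart (idx (w k)) \<omega> - mart (idx (w k / \<theta>)) \<omega>}"
        by (simp add: Bk_def wk)
    qed
    then show "pr k * prob (space P - (\<Union>j\<in>{i..<k}. Bk j)) - rr k
      \<le> prob ((space P - (\<Union>j\<in>{i..<k}. Bk j)) \<inter> Bk k)"
      by (simp only: pr_def rr_def)
  qed
  have "AE \<omega> in P. \<forall>\<^sub>F k in sequentially. \<forall>j\<le>idx (\<theta> ^ k). \<bar>mart j \<omega>\<bar> \<le> (1 + 1 / 2) * lil_norm (\<theta> ^ k)"
    using upper_blocks[of "1 / 2" \<theta>] \<theta> by simp
  with io show ?thesis
  proof eventually_elim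
    case (elim \<omega>)
    have ev: "\<forall>\<^sub>F k in sequentially. \<omega> \<in> Bk k \<longrightarrow>
        ((1 - e) * sqrt (1 / (1 + 3 * e)) - e) * lil_norm (B (idx (w k))) \<le> \<bar>mart (idx (w k)) \<omega>\<bar>"
      using elim(2) eventually_ge_at_top[of k0]
    proof eventually_elim
      case (elim k)
      \<comment> \<open>The final estimate as linear arithmetic: \<open>p\<close> stands for
        \<open>lil_norm (\<theta> ^ k)\<close> and \<open>q\<close> for
        \<open>e * lil_norm (w k)\<close>.\<close>
      have combine: "z \<le> \<bar>u\<bar>"
        if "x < u - v" "\<bar>v\<bar> \<le> (1 + 1 / 2) * p" "4 * p \<le> 2 * q" "x = x'" "z \<le> z'" "z' = x' - q" "0 \<le> q"
        for u v x x' z z' p q :: real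
      proof -
        have "- v \<le> 3 / 2 * p" using that(2) by (simp add: abs_le_iff)
        with that have "z \<le> u" by linarith
        then show ?thesis by simp
      qed
      show ?case
      proof
        assume "\<omega> \<in> Bk k"
        then have "(1 - e) * l k * w k < mart (idx (w k)) \<omega> - mart (idx (\<theta> ^ k)) \<omega>"
          by (simp add: Bk_def)
        moreover have "\<bar>mart (idx (\<theta> ^ k)) \<omega>\<bar> \<le> (1 + 1 / 2) * lil_norm (\<theta> ^ k)"
          using elim by blast
        moreover have "4 * lil_norm (\<theta> ^ k) \<le> 2 * (e * lil_norm (w k))"
        proof -
          have w2: "2 * exp 1 \<le> w k" using k0(4)[OF elim(2)] by simp
          have p: "0 < \<theta> ^ k" "1 \<le> \<theta> ^ k" using \<theta> by auto
          have "0 \<le> ln (ln (w k))"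
            using k0(1)[OF elim(2)] e e2 by (smt (verit) zero_less_mult_pos2)
          moreover have "ln (ln (\<theta> ^ k)) \<le> ln (ln (w k))"
          \<comment> \<open>At \<open>k = 0\<close> the inner logarithm is 0 and
            \<open>ln 0 = 0\<close> by convention, outside the range where \<open>ln\<close> is
            monotone.\<close>
          proof (cases "k = 0")
            case True
            then show ?thesis using \<open>0 \<le> ln (ln (w k))\<close> by simp
          next
            case False
            then have "0 < ln (\<theta> ^ k)" using \<theta> by simp
            moreover have "\<theta> ^ k \<le> w k" using \<theta> by (simp add: w_def)
            ultimately show ?thesis
              using p by (intro iffD2[OF ln_le_cancel_iff]) (auto intro: less_le_trans)
          qed
          ultimately have "2 * \<theta> ^ k * ln (ln (\<theta> ^ k)) \<le> 2 * \<theta> ^ k * ln (ln (w k))"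
            "0 \<le> 2 * \<theta> ^ k * ln (ln (w k))"
            using p by (auto intro!: mult_left_mono)
          \<comment> \<open>\<open>16\<close> is the square of the factor 4, and
            \<open>512 = (2 * e)\<^sup>2 * \<theta>\<close>.\<close>
          then have "16 * (2 * \<theta> ^ k * ln (ln (\<theta> ^ k))) \<le> 512 * (2 * \<theta> ^ k * ln (ln (w k)))"
            by linarith
          also have "\<dots> = (2 * e)\<^sup>2 * (2 * w k * ln (ln (w k)))"
            using e by (simp add: w_def \<theta>_def field_simps)
          finally have "sqrt (4\<^sup>2 * (2 * \<theta> ^ k * ln (ln (\<theta> ^ k)))) \<le> sqrt ((2 * e)\<^sup>2 * (2 * w k * ln (ln (w k))))"
            by (intro real_sqrt_le_mono) simp
          then show ?thesis
            unfolding lil_norm_def real_sqrt_mult[of "4\<^sup>2"] real_sqrt_mult[of "(2 * e)\<^sup>2"] real_sqrt_abs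
            using e by simp
        qed
        moreover have "(1 - e) * l k * w k = (1 - e) * sqrt (1 / (1 + 3 * e)) * lil_norm (w k)"
        proof -
          have "l k * w k = sqrt (2 * (ln (ln (w k)) / (1 + 3 * e)) / w k * (w k)\<^sup>2)"
            unfolding l_def real_sqrt_mult using wk(2)[of k] by simp
          also have "\<dots> = sqrt (1 / (1 + 3 * e) * (2 * w k * ln (ln (w k))))"
            using wk(2)[of k] by (intro arg_cong[where f = sqrt]) (simp add: power2_eq_square)
          also have "\<dots> = sqrt (1 / (1 + 3 * e)) * lil_norm (w k)"
            unfolding lil_norm_def by (rule real_sqrt_mult)
          finally show ?thesis by simp
        qed
        moreover have "lil_norm (B (idx (w k))) \<le> lil_norm (w k)" "0 \<le> lil_norm (w k)"
        proof -
          \<comment> \<open>The clock value is at least half of \<open>w k\<close>, so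
            \<open>2 * exp 1 \<le> w k\<close> keeps it in the range where \<open>lil_norm\<close>
            is monotone.\<close>
          have "2 * exp 1 \<le> w k" "B 0 \<le> w k"
            using k0(4)[OF elim(2)] \<theta> B_gt0[of 0] by (auto intro: order_trans[rotated])
          moreover have "(1 - e\<^sup>2 / 128) * w k \<ge> 1 / 2 * w k"
            using e2 wk(2)[of k] by (intro mult_right_mono) auto
          ultimately have "exp 1 \<le> B (idx (w k))" "exp 1 \<le> w k" "B (idx (w k)) \<le> w k"
            using k0(3)[OF elim(2)] B_idx_le[of "w k"] exp_gt_zero[of "1::real"] by linarith+
          then show "lil_norm (B (idx (w k))) \<le> lil_norm (w k)" "0 \<le> lil_norm (w k)"
            using lil_norm_mono lil_norm_nonneg by auto
        qed
        moreover have "((1 - e) * sqrt (1 / (1 + 3 * e)) - e) * lil_norm (B (idx (w k)))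
            \<le> ((1 - e) * sqrt (1 / (1 + 3 * e)) - e) * lil_norm (w k)"
          using pos calculation(5) by (intro mult_left_mono)
        moreover have "((1 - e) * sqrt (1 / (1 + 3 * e)) - e) * lil_norm (w k)
            = (1 - e) * sqrt (1 / (1 + 3 * e)) * lil_norm (w k) - e * lil_norm (w k)"
          by (simp add: left_diff_distrib)
        moreover have "0 \<le> e * lil_norm (w k)"
          using e calculation(6) by simp
        ultimately show "((1 - e) * sqrt (1 / (1 + 3 * e)) - e) * lil_norm (B (idx (w k))) \<le> \<bar>mart (idx (w k)) \<omega>\<bar>"
          by (elim combine)
      qed
    qed
    show ?case
    proof (rule ccontr)
      assume "\<not> ?case"
      then have "\<forall>\<^sub>F n in sequentially.
          \<not> ((1 - e) * sqrt (1 / (1 + 3 * e)) - e) * lil_norm (B n) \<le> \<bar>mart n \<omega>\<bar>"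
        by (simp add: not_frequently)
      from eventually_compose_filterlim[OF this filterlim_compose[OF idx_at_top w_top]] ev
      have "\<forall>\<^sub>F k in sequentially. \<omega> \<notin> Bk k"
        by eventually_elim blast
      then show False
        using elim(1) by (simp add: frequently_def)
    qed
  qed
qed

theorem lil:
  "AE \<omega> in P. limsup (\<lambda>n. ereal (\<bar>mart n \<omega>\<bar> / lil_norm (B n))) = 1"
proof -
  \<comment> \<open>Null sets are collected over a countable sequence of tolerances; the shift by 2
    keeps them strictly below 1.\<close>
  define u where "u i = inverse (real (Suc (Suc i)))" for i
  have u: "0 < u i" "u i < 1" for i
    by (auto simp: u_def field_simps)
  define v where "v e = (1 - e) * sqrt (1 / (1 + 3 * e)) - (e::real)" for e
  have u_lim: "filterlim u (at_right 0) sequentially"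
    unfolding u_def by real_asymp
  have v_lim: "(v \<longlongrightarrow> 1) (at_right 0)"
    unfolding v_def by real_asymp
  have "AE \<omega> in P. \<forall>i. \<forall>\<^sub>F n in sequentially. \<bar>mart n \<omega>\<bar> \<le> (1 + u i) ^ 3 * lil_norm (B n)"
    unfolding AE_all_countable using upper_lil u by blast
  \<comment> \<open>\<open>v\<close> is negative at \<open>u 0 = 1 / 2\<close>, where
    \<open>lower_lil\<close> does not apply; hence the guard.\<close>
  moreover have "AE \<omega> in P. \<forall>i. 0 \<le> v (u i) \<longrightarrow>
      (\<exists>\<^sub>F n in sequentially. v (u i) * lil_norm (B n) \<le> \<bar>mart n \<omega>\<bar>)"
    unfolding AE_all_countable
  proof
    fix i
    show "AE \<omega> in P. 0 \<le> v (u i) \<longrightarrow> (\<exists>\<^sub>F n in sequentially. v (u i) * lil_norm (B n) \<le> \<bar>mart n \<omega>\<bar>)"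
      using lower_lil[OF u, of i] unfolding v_def by (cases "0 \<le> v (u i)") (auto simp: v_def)
  qed
  ultimately show ?thesis
  proof eventually_elim
    case (elim \<omega>)
    let ?L = "limsup (\<lambda>n. ereal (\<bar>mart n \<omega>\<bar> / lil_norm (B n)))"
    have norm_pos: "\<forall>\<^sub>F n in sequentially. 0 < lil_norm (B n)"
    proof -
      have "\<forall>\<^sub>F w in at_top. 0 < lil_norm w"
        unfolding lil_norm_def by real_asymp
      from eventually_compose_filterlim[OF this B_at_top] show ?thesis .
    qed
    have up: "?L \<le> ereal ((1 + u i) ^ 3)" for i
    proof (rule Limsup_bounded)
      from elim(1)[rule_format, of i] norm_pos
      show "\<forall>\<^sub>F n in sequentially. ereal (\<bar>mart n \<omega>\<bar> / lil_norm (B n)) \<le> ereal ((1 + u i) ^ 3)"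
        by eventually_elim (simp add: divide_le_eq)
    qed
    have lo: "ereal (v (u i)) \<le> ?L" if "0 \<le> v (u i)" for i
    proof (rule ccontr)
      assume "\<not> ereal (v (u i)) \<le> ?L"
      then have "\<forall>\<^sub>F n in sequentially. ereal (\<bar>mart n \<omega>\<bar> / lil_norm (B n)) < ereal (v (u i))"
        by (intro Limsup_lessD) simp
      with norm_pos have "\<forall>\<^sub>F n in sequentially. \<not> v (u i) * lil_norm (B n) \<le> \<bar>mart n \<omega>\<bar>"
        by eventually_elim (simp add: divide_less_eq)
      then show False
        using elim(2) that by (simp add: frequently_def)
    qed
    have "((\<lambda>e. (1 + e) ^ 3) \<longlongrightarrow> (1::real)) (at_right 0)"
      by real_asymp
    from filterlim_compose[OF this u_lim]
    have "(\<lambda>i. ereal ((1 + u i) ^ 3)) \<longlonglongrightarrow> ereal 1"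
      by simp
    then have "?L \<le> ereal 1"
      using up by (intro tendsto_lowerbound[where f = "\<lambda>i. ereal ((1 + u i) ^ 3)"]) auto
    moreover have "ereal 1 \<le> ?L"
    proof (rule tendsto_upperbound)
      show vl: "(\<lambda>i. ereal (v (u i))) \<longlonglongrightarrow> ereal 1"
        using filterlim_compose[OF v_lim u_lim] by simp
      have "\<forall>\<^sub>F i in sequentially. 0 < v (u i)"
        using order_tendstoD(1)[OF filterlim_compose[OF v_lim u_lim], of 0] by simp
      then show "\<forall>\<^sub>F i in sequentially. ereal (v (u i)) \<le> ?L"
        by eventually_elim (simp add: lo)
    qed simp
    ultimately show ?case
      by (simp add: one_ereal_def)
  qed
qed

end

section \<open>Moments of the martingale\<close>

context martingale_increments
begin

lemma integral_mart_sq: "(\<integral>\<omega>. (mart n \<omega>)\<^sup>2 \<partial>P) = (\<integral>\<omega>. qvar n \<omega> \<partial>P)"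
proof (induction n)
  case 0
  then show ?case by (simp add: mart_def qvar_def)
next
  case (Suc n)
  note I = test_integrable[of "Suc n"]
  have "(\<integral>\<omega>. (mart (Suc n) \<omega>)\<^sup>2 \<partial>P)
      = (\<integral>\<omega>. (mart n \<omega>)\<^sup>2 + 2 * (mart n \<omega> * d n \<omega>) + 1 * (d n \<omega>)\<^sup>2 \<partial>P)"
    by (simp add: mart_def power2_eq_square algebra_simps)
  also have "\<dots> = (\<integral>\<omega>. (mart n \<omega>)\<^sup>2 \<partial>P) + 2 * (\<integral>\<omega>. mart n \<omega> * d n \<omega> \<partial>P) + (\<integral>\<omega>. 1 * (d n \<omega>)\<^sup>2 \<partial>P)"
  proof -
    have "integrable P (\<lambda>\<omega>. (mart n \<omega>)\<^sup>2)" "integrable P (\<lambda>\<omega>. mart n \<omega> * d n \<omega>)"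
      "integrable P (\<lambda>\<omega>. 1 * (d n \<omega>)\<^sup>2)"
      by (intro I test_intros le_SucI order_refl)+
    then show ?thesis by simp
  qed
  also have "(\<integral>\<omega>. mart n \<omega> * d n \<omega> \<partial>P) = 0"
    by (intro integral_mult_d test_mart) simp
  also have "(\<integral>\<omega>. 1 * (d n \<omega>)\<^sup>2 \<partial>P) = (\<integral>\<omega>. 1 * s n \<omega> \<partial>P)"
    by (intro integral_mult_d2) simp
  also have "(\<integral>\<omega>. (mart n \<omega>)\<^sup>2 \<partial>P) + 2 * 0 + (\<integral>\<omega>. 1 * s n \<omega> \<partial>P) = (\<integral>\<omega>. qvar n \<omega> + s n \<omega> \<partial>P)"
  proof -
    have "integrable P (qvar n)" "integrable P (s n)"
      by (intro I test_intros le_SucI order_refl)+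
    then show ?thesis using Suc by simp
  qed
  finally show ?case by (simp add: qvar_def)
qed

text \<open>The variance of \<open>\<bar>mart n\<bar>\<close> is nonnegative, so its mean is at most
  the root of its second moment.\<close>

lemma integral_abs_mart_le: "(\<integral>\<omega>. \<bar>mart n \<omega>\<bar> \<partial>P) \<le> sqrt (\<integral>\<omega>. qvar n \<omega> \<partial>P)"
proof -
  define z where "z = (\<integral>\<omega>. \<bar>mart n \<omega>\<bar> \<partial>P)"
  have t: "test n (mart n)" by (rule test_mart) simp
  have i: "integrable P (\<lambda>\<omega>. (mart n \<omega>)\<^sup>2)" "integrable P (\<lambda>\<omega>. \<bar>mart n \<omega>\<bar>)"
    by (intro test_integrable[OF test_power[OF t]] Bochner_Integration.integrable_abs test_integrable[OF t])+
  have "0 \<le> (\<integral>\<omega>. (\<bar>mart n \<omega>\<bar> - z)\<^sup>2 \<partial>P)"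
    by (intro integral_nonneg_AE) auto
  also have "\<dots> = (\<integral>\<omega>. (mart n \<omega>)\<^sup>2 - 2 * z * \<bar>mart n \<omega>\<bar> + z\<^sup>2 \<partial>P)"
    by (simp add: power2_diff algebra_simps)
  also have "\<dots> = (\<integral>\<omega>. (mart n \<omega>)\<^sup>2 \<partial>P) - z\<^sup>2"
    using i by (simp add: z_def[symmetric] prob_space power2_eq_square)
  finally have "z\<^sup>2 \<le> (\<integral>\<omega>. qvar n \<omega> \<partial>P)"
    by (simp add: integral_mart_sq)
  then show ?thesis
    unfolding z_def[symmetric] by (rule real_le_rsqrt)
qed

end

section \<open>Growth of the normalising coefficients\<close>

text \<open>The constant absorbs finitely many initial terms, so that asymptotic bounds can be
  summed from the first index on.\<close>

lemma eventually_le_mult_imp_le_mult: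
  fixes u v :: "nat \<Rightarrow> real"
  assumes ev: "\<forall>\<^sub>F n in sequentially. u n \<le> C * v n" and v: "\<And>n. 1 \<le> n \<Longrightarrow> 0 < v n"
  obtains C' where "0 < C'" "\<And>n. 1 \<le> n \<Longrightarrow> u n \<le> C' * v n"
proof -
  obtain n0 where n0: "\<And>n. n0 \<le> n \<Longrightarrow> u n \<le> C * v n"
    using ev by (auto simp: eventually_sequentially)
  define C' where "C' = 1 + \<bar>C\<bar> + (\<Sum>i<n0. \<bar>u i / v i\<bar>)"
  have S0: "0 \<le> (\<Sum>i<n0. \<bar>u i / v i\<bar>)"
    by (simp add: sum_nonneg)
  have "u n \<le> C' * v n" if n: "1 \<le> n" for n
  proof (cases "n0 \<le> n")
    case True
    have "u n \<le> C * v n" by (rule n0[OF True])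
    also have "\<dots> \<le> C' * v n"
      using v[OF n] S0 by (intro mult_right_mono) (auto simp: C'_def)
    finally show ?thesis .
  next
    case False
    have "u n = u n / v n * v n" using v[OF n] by simp
    also have "\<dots> \<le> \<bar>u n / v n\<bar> * v n" using v[OF n] by (intro mult_right_mono abs_ge_self) auto
    also have "\<bar>u n / v n\<bar> \<le> (\<Sum>i<n0. \<bar>u i / v i\<bar>)"
      using False by (intro member_le_sum) auto
    also have "\<dots> \<le> C'" by (simp add: C'_def)
    finally show ?thesis using v[OF n] by (simp add: mult_right_mono)
  qed
  moreover have "0 < C'" using S0 by (simp add: C'_def)
  ultimately show ?thesis using that by blast
qed

text \<open>Weighted AM-GM takes the place of the mean value theorem and includes
  \<open>x = 0\<close>. Applied to consecutive values of \<open>Q\<close>, the right side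
  telescopes.\<close>

lemma concave_powr_increment:
  fixes x y r :: real
  assumes "0 \<le> x" "x \<le> y" "0 < y" "0 < r" "r \<le> 1"
  shows "r * ((y - x) * y powr (r - 1)) \<le> y powr r - x powr r"
proof -
  have "x powr r * y powr (1 - r) \<le> r * x + (1 - r) * y"
    using assms by (cases "x = 0") (auto intro: Youngs_inequality_0)
  then have "x powr r * y powr (1 - r) * y powr (r - 1) \<le> (r * x + (1 - r) * y) * y powr (r - 1)"
    by (intro mult_right_mono) auto
  moreover have "y powr (1 - r) * y powr (r - 1) = 1"
    using assms by (simp flip: powr_add)
  moreover have "y * y powr (r - 1) = y powr r"
    using assms by (simp add: powr_diff)
  ultimately show ?thesis
    by (simp add: algebra_simps)
qed

text \<open>At \<open>n = 0\<close> the recursion reads \<open>a 1 = a 0\<close>, since division by zero yields zero.\<close>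

locale drift_coefficients =
  fixes a y :: "nat \<Rightarrow> real"
  assumes a_0: "a 0 = 1"
    and a_Suc: "a (Suc n) = a n * (1 + y n / real n)"
    and y_abs: "\<bar>y n\<bar> \<le> 1"
    and y_1: "- 1 < y 1"
    and y_half: "\<forall>\<^sub>F n in sequentially. y n \<le> 1 / 2"
begin

text \<open>The sum in \<open>A_coef\<close> without the factors \<open>1 - (E X_k)\<^sup>2\<close>:
  it depends on the coefficients alone and dominates the quadratic variation.\<close>

definition Q :: "nat \<Rightarrow> real" where
  "Q n = (\<Sum>i<n. 1 / (a (Suc i))\<^sup>2)"

lemma Q_Suc: "Q (Suc n) = Q n + 1 / (a (Suc n))\<^sup>2"
  by (simp add: Q_def)

lemma a_1: "a (Suc 0) = 1"
  using a_Suc[of 0] a_0 by simp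

lemma factor_pos: "0 < 1 + y n / real n"
proof -
  consider "n = 0" | "n = 1" | "2 \<le> n" by linarith
  then show ?thesis
  proof cases
    case 3
    then have "- 1 < y n / real n"
      using y_abs[of n] by (simp add: abs_le_iff field_simps)
    then show ?thesis by simp
  qed (use y_1 in auto)
qed

lemma factor_ge: "1 - 1 / real n \<le> 1 + y n / real n"
proof -
  have "(- 1) / real n \<le> y n / real n"
    using y_abs[of n] by (intro divide_right_mono) (auto simp: abs_le_iff)
  then show ?thesis by simp
qed

lemma a_pos: "0 < a n"
  by (induction n) (simp_all add: a_0 a_Suc factor_pos)

lemma Q_nonneg: "0 \<le> Q n"
  by (auto simp: Q_def intro: sum_nonneg)

lemma Q_mono: "m \<le> n \<Longrightarrow> Q m \<le> Q n"
  unfolding Q_def by (intro sum_mono2) auto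

lemma Q_ge_1: "1 \<le> n \<Longrightarrow> 1 \<le> Q n"
  using Q_mono[of 1 n] by (simp add: Q_def a_1)

text \<open>The coefficients cannot drop too fast: since
  \<open>n * (1 - 1 / n)^2 = n - 2 + 1 / n\<close>, \<open>factor_ge\<close> bounds
  \<open>(n - 2) / a_(n+1)^2\<close> by \<open>n / a_n^2\<close> when \<open>n > 2\<close>. The
  missing \<open>3 / a_(n+1)^2\<close> is three times the new term of \<open>Q\<close>, which fixes
  the constant.\<close>

lemma weight_le_Q:
  assumes "1 \<le> n"
  shows "real n / (a n)\<^sup>2 \<le> 3 * Q n"
  using assms
proof (induction n rule: dec_induct)
  case base
  then show ?case by (simp add: Q_def a_1)
next
  case (step n)
  have n: "1 \<le> n" using step by simp
  have "(real n - 2) / (a (Suc n))\<^sup>2 \<le> 3 * Q n"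
  proof (cases "n \<le> 2")
    case True
    then have "(real n - 2) / (a (Suc n))\<^sup>2 \<le> 0" by (simp add: divide_nonpos_nonneg)
    then show ?thesis using Q_nonneg[of n] by linarith
  next
    case False
    define z where "z = 1 - 1 / real n"
    have z: "0 < z" using False by (simp add: z_def)
    have "z \<le> 1 + y n / real n"
      unfolding z_def by (rule factor_ge)
    then have az: "a n * z \<le> a (Suc n)"
      unfolding a_Suc using a_pos[of n] by (intro mult_left_mono) auto
    have "real n - 2 \<le> real n * z\<^sup>2"
      using n by (simp add: z_def power2_eq_square field_simps)
    moreover have "0 < (a n * z)\<^sup>2" using z a_pos[of n] by simp
    moreover have "(a n * z)\<^sup>2 \<le> (a (Suc n))\<^sup>2"
      using az z a_pos[of n] by (intro power_mono) auto
    ultimately have "(real n - 2) / (a (Suc n))\<^sup>2 \<le> real n * z\<^sup>2 / (a n * z)\<^sup>2"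
      by (intro frac_le) auto
    also have "\<dots> = real n / (a n)\<^sup>2"
      using z by (simp add: power_mult_distrib)
    also have "\<dots> \<le> 3 * Q n" using step n by simp
    finally show ?thesis .
  qed
  then show ?case
    by (simp add: Q_Suc diff_divide_distrib add_divide_distrib)
qed

lemma a_sq_linear:
  obtains C where "0 < C" "\<And>n. 1 \<le> n \<Longrightarrow> (a n)\<^sup>2 \<le> C * real n"
proof -
  obtain n0 where n0: "\<And>n. n0 \<le> n \<Longrightarrow> y n \<le> 1 / 2"
    using y_half by (auto simp: eventually_sequentially)
  define m where "m = max 1 n0"
  \<comment> \<open>The induction closes for \<open>C * (n - 1 / 2)\<close>, because
    \<open>(n - 1 / 2) * (1 + 1 / (2 * n))^2 \<le> n + 1 / 2\<close>; as \<open>m \<ge> 1\<close>,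
    the factor 2 covers the base case.\<close>
  define C where "C = 2 * (a m)\<^sup>2"
  have "(a n)\<^sup>2 \<le> C * (real n - 1 / 2)" if "m \<le> n" for n
    using that
  proof (induction n rule: dec_induct)
    case base
    have "C * (1 / 2) \<le> C * (real m - 1 / 2)"
      by (intro mult_left_mono) (auto simp: m_def C_def)
    then show ?case by (simp add: C_def)
  next
    case (step n)
    have n: "1 \<le> n" "y n \<le> 1 / 2" using step n0[of n] by (auto simp: m_def)
    have f: "1 + y n / real n \<le> 1 + 1 / (2 * real n)"
      using n by (simp add: field_simps)
    have "(a (Suc n))\<^sup>2 = (a n)\<^sup>2 * (1 + y n / real n)\<^sup>2"
      by (simp add: a_Suc power_mult_distrib)
    also have "\<dots> \<le> (C * (real n - 1 / 2)) * (1 + 1 / (2 * real n))\<^sup>2"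
      using step f factor_pos[of n] n by (intro mult_mono power_mono) (auto simp: C_def)
    also have "\<dots> = C * ((real n - 1 / 2) * (1 + 1 / (2 * real n))\<^sup>2)" by simp
    also have "\<dots> \<le> C * (real (Suc n) - 1 / 2)"
    proof (rule mult_left_mono)
      have "(real n - 1 / 2) * (1 + 1 / (2 * real n))\<^sup>2
          = real n + 1 / 2 - (1 / (4 * real n) + 1 / (8 * (real n)\<^sup>2))"
        using n by (simp add: power2_eq_square field_simps)
      moreover have "0 \<le> 1 / (4 * real n) + 1 / (8 * (real n)\<^sup>2)" by simp
      ultimately show "(real n - 1 / 2) * (1 + 1 / (2 * real n))\<^sup>2 \<le> real (Suc n) - 1 / 2"
        unfolding of_nat_Suc by linarith
    qed (simp add: C_def)
    finally show ?case .
  qed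
  moreover have "C * (real n - 1 / 2) \<le> C * real n" for n
    by (intro mult_left_mono) (auto simp: C_def)
  ultimately have "\<forall>\<^sub>F n in sequentially. (a n)\<^sup>2 \<le> C * real n"
    by (meson eventually_sequentiallyI order_trans)
  then show ?thesis
    by (rule eventually_le_mult_imp_le_mult) (use that in auto)
qed

text \<open>Linear growth of the squared coefficients gives comparison with the harmonic series; at
  the threshold \<open>1 / 2\<close> the divergence may be only logarithmic.\<close>

lemma Q_at_top: "filterlim Q at_top sequentially"
proof -
  obtain C where C: "0 < C" "\<And>n. 1 \<le> n \<Longrightarrow> (a n)\<^sup>2 \<le> C * real n"
    by (rule a_sq_linear) blast
  have "\<not> summable (\<lambda>i. 1 / (a (Suc i))\<^sup>2)"
  proof
    assume s: "summable (\<lambda>i. 1 / (a (Suc i))\<^sup>2)"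
    have "summable (\<lambda>i. inverse (real (Suc i)) / C)"
    proof (rule summable_comparison_test'[OF s])
      fix i :: nat
      have "1 / (C * real (Suc i)) \<le> 1 / (a (Suc i))\<^sup>2"
        using C(1) C(2)[of "Suc i"] a_pos[of "Suc i"] by (intro divide_left_mono) auto
      then show "norm (inverse (real (Suc i)) / C) \<le> 1 / (a (Suc i))\<^sup>2"
        using C(1) by (simp add: inverse_eq_divide mult.commute)
    qed
    then have "summable (\<lambda>i. inverse (real (Suc i)) / C * C)" by (rule summable_mult2)
    then show False
      using C not_summable_harmonic[where 'a = real] summable_Suc_iff[of "\<lambda>k. inverse (real k)"] by simp
  qed
  moreover have "summable (\<lambda>i. 1 / (a (Suc i))\<^sup>2)" if "\<And>n. Q n \<le> z" for z
    using that unfolding Q_def by (intro summableI_nonneg_bounded) auto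
  ultimately have "\<exists>n. z \<le> Q n" for z
    by (meson linear)
  then show ?thesis
    unfolding filterlim_at_top eventually_sequentially by (meson Q_mono order_trans)
qed

text \<open>The quantity obeys \<open>x_(n+1) = x_n * (1 + y n / n)^2 + 1\<close>, which for
  \<open>y n \<le> 1 / 2\<close> grows at most like \<open>n * ln n\<close>. The exponent
  \<open>3 / 2\<close> leaves room for an elementary induction and, being below 2, still gives
  polynomial decay of \<open>a n * sqrt (Q n) / n\<close>.\<close>

lemma a_sq_Q_bound:
  obtains C where "0 < C" "\<And>n. 1 \<le> n \<Longrightarrow> (a n)\<^sup>2 * Q n \<le> C * (real n * sqrt (real n))"
proof -
  obtain n0 where n0: "\<And>n. n0 \<le> n \<Longrightarrow> y n \<le> 1 / 2"
    using y_half by (auto simp: eventually_sequentially)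
  define m where "m = max 1 n0"
  \<comment> \<open>With \<open>4 \<le> C\<close> and \<open>1 \<le> q\<close> the reserve
    \<open>C * q / 4\<close> pays for the added 1 in the recursion.\<close>
  define C where "C = max 4 ((a m)\<^sup>2 * Q m)"
  have "(a n)\<^sup>2 * Q n \<le> C * (real n * sqrt (real n))" if "m \<le> n" for n
    using that
  proof (induction n rule: dec_induct)
    case base
    have "1 \<le> real m" "1 \<le> sqrt (real m)"
      by (auto simp: m_def)
    then have "C * 1 \<le> C * (real m * sqrt (real m))"
      using mult_mono[of 1 "real m" 1 "sqrt (real m)"] by (intro mult_left_mono) (auto simp: C_def)
    then show ?case by (simp add: C_def)
  next
    case (step n)
    have n: "1 \<le> n" "y n \<le> 1 / 2" using step n0[of n] by (auto simp: m_def)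
    have f: "1 + y n / real n \<le> 1 + 1 / (2 * real n)"
      using n by (simp add: field_simps)
    have C4: "4 \<le> C" by (simp add: C_def)
    define q where "q = sqrt (real n)"
    have q: "1 \<le> q" "q\<^sup>2 = real n" using n by (auto simp: q_def)
    have "(a (Suc n))\<^sup>2 * Q (Suc n) = (a (Suc n))\<^sup>2 * Q n + 1"
      using a_pos[of "Suc n"] by (simp add: Q_Suc distrib_left)
    also have "\<dots> = (a n)\<^sup>2 * Q n * (1 + y n / real n)\<^sup>2 + 1"
      by (simp only: a_Suc power_mult_distrib mult_ac)
    also have "\<dots> \<le> C * (real n * q) * (1 + 1 / (2 * real n))\<^sup>2 + 1"
    proof (rule add_right_mono, rule mult_mono)
      show "(1 + y n / real n)\<^sup>2 \<le> (1 + 1 / (2 * real n))\<^sup>2"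
        using f factor_pos[of n] by (intro power_mono) auto
    qed (use step C4 in \<open>auto simp: q_def\<close>)
    also have "\<dots> \<le> C * (q * (real n + 3 / 2))"
    proof -
      have "real n * (1 + 1 / (2 * real n))\<^sup>2 = real n + 1 + 1 / (4 * real n)"
        using n by (simp add: power2_eq_square field_simps)
      moreover have "1 / (4 * real n) \<le> 1 / 4" using n by (simp add: field_simps)
      ultimately have 1: "real n * (1 + 1 / (2 * real n))\<^sup>2 \<le> real n + 3 / 2 - 1 / 4" by linarith
      have "C * (real n * q) * (1 + 1 / (2 * real n))\<^sup>2 = C * q * (real n * (1 + 1 / (2 * real n))\<^sup>2)"
        by simp
      also have "\<dots> \<le> C * q * (real n + 3 / 2 - 1 / 4)"
        using 1 C4 q by (intro mult_left_mono) auto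
      also have "\<dots> = C * (q * (real n + 3 / 2)) - C * q / 4"
        by (simp add: algebra_simps)
      finally show ?thesis using mult_mono[of 4 C 1 q] C4 q by simp
    qed
    also have "\<dots> \<le> C * (real (Suc n) * sqrt (real (Suc n)))"
    proof (rule mult_left_mono)
      \<comment> \<open>\<open>3 / 2\<close> is chosen so that \<open>n * (n + 3 / 2)^2\<close> and
        \<open>(n + 1)^3\<close> agree in degrees 3 and 2.\<close>
      have "(q * (real n + 3 / 2))\<^sup>2 = real n * (real n + 3 / 2)\<^sup>2"
        by (simp add: power_mult_distrib q)
      also have "\<dots> \<le> (real (Suc n))\<^sup>2 * real (Suc n)"
        by (simp add: power2_eq_square algebra_simps)
      also have "\<dots> = (real (Suc n) * sqrt (real (Suc n)))\<^sup>2"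
        by (simp only: power_mult_distrib real_sqrt_pow2 of_nat_0_le_iff)
      finally show "q * (real n + 3 / 2) \<le> real (Suc n) * sqrt (real (Suc n))"
        by (rule power2_le_imp_le) simp
    qed (use C4 in simp)
    finally show ?case .
  qed
  then have "\<forall>\<^sub>F n in sequentially. (a n)\<^sup>2 * Q n \<le> C * (real n * sqrt (real n))"
    by (rule eventually_sequentiallyI)
  then show ?thesis
    by (rule eventually_le_mult_imp_le_mult) (use that in auto)
qed

text \<open>The crude growth \<open>Q n = O(n^3)\<close>, from
  \<open>a n \<ge> a 2 / (n - 1)\<close>, converts decay in the index into decay in
  \<open>Q\<close>; \<open>1 / 12\<close> is a third of \<open>1 / 4\<close>.\<close>

lemma powr_index_le_Q:
  obtains C where "0 < C" "\<And>n. 1 \<le> n \<Longrightarrow> real n powr (- (1 / 4)) \<le> C * Q n powr (- (1 / 12))"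
proof -
  define D where "D = 1 + 1 / (a 2)\<^sup>2"
  have D: "1 \<le> D" by (simp add: D_def)
  \<comment> \<open>The product of the \<open>1 - 1 / j\<close> telescopes from \<open>j = 2\<close>
    on; at \<open>j = 1\<close> that lower bound would be 0, so this factor stays inside
    \<open>a 2\<close>.\<close>
  have low: "a 2 / (real n - 1) \<le> a n" if "2 \<le> n" for n
    using that
  proof (induction n rule: dec_induct)
    case base
    then show ?case by simp
  next
    case (step n)
    have "a 2 / (real (Suc n) - 1) = a 2 / (real n - 1) * (1 - 1 / real n)"
      using step by (simp add: field_simps)
    also have "\<dots> \<le> a n * (1 + y n / real n)"
    proof (rule mult_mono)
      show "1 - 1 / real n \<le> 1 + y n / real n"
        by (rule factor_ge)
    qed (use step a_pos[of n] in auto)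
    finally show ?case by (simp add: a_Suc)
  qed
  have wt: "1 / (a (Suc i))\<^sup>2 \<le> D * (real (Suc i))\<^sup>2" for i
  proof (cases "i = 0")
    case True
    then show ?thesis using D by (simp add: a_1)
  next
    case False
    then have "a 2 / real i \<le> a (Suc i)" using low[of "Suc i"] by simp
    then have "(a 2 / real i)\<^sup>2 \<le> (a (Suc i))\<^sup>2"
      using a_pos[of 2] by (intro power_mono) auto
    then have "1 / (a (Suc i))\<^sup>2 \<le> 1 / (a 2 / real i)\<^sup>2"
      using a_pos[of 2] a_pos[of "Suc i"] False by (intro divide_left_mono) auto
    also have "\<dots> = 1 / (a 2)\<^sup>2 * (real i)\<^sup>2" by (simp add: power_divide)
    also have "\<dots> \<le> D * (real (Suc i))\<^sup>2"
      by (intro mult_mono power_mono) (auto simp: D_def)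
    finally show ?thesis .
  qed
  have Q3: "Q n \<le> D * real n ^ 3" for n
  proof -
    have "Q n \<le> (\<Sum>i<n. D * (real n)\<^sup>2)"
      unfolding Q_def
    proof (rule sum_mono)
      fix i assume "i \<in> {..<n}"
      then have "D * (real (Suc i))\<^sup>2 \<le> D * (real n)\<^sup>2"
        using D by (intro mult_left_mono power_mono) auto
      then show "1 / (a (Suc i))\<^sup>2 \<le> D * (real n)\<^sup>2" using wt[of i] by linarith
    qed
    then show ?thesis by (simp add: power2_eq_square power3_eq_cube mult_ac)
  qed
  show ?thesis
  proof (rule that)
    show "0 < D powr (1 / 12)" using D by simp
    fix n :: nat assume n: "1 \<le> n"
    have "(D * real n ^ 3) powr (- (1 / 12)) \<le> Q n powr (- (1 / 12))"
      using Q3[of n] Q_ge_1[OF n] by (intro powr_mono2') auto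
    moreover have "(D * real n ^ 3) powr (- (1 / 12)) = D powr (- (1 / 12)) * real n powr (- (1 / 4))"
      using D n by (simp add: powr_mult powr_powr flip: powr_numeral)
    ultimately have "D powr (1 / 12) * (D powr (- (1 / 12)) * real n powr (- (1 / 4)))
        \<le> D powr (1 / 12) * Q n powr (- (1 / 12))"
      by (intro mult_left_mono) auto
    moreover have "D powr (1 / 12) * D powr (- (1 / 12)) = 1"
      using D by (simp flip: powr_add)
    ultimately show "real n powr (- (1 / 4)) \<le> D powr (1 / 12) * Q n powr (- (1 / 12))"
      by (simp flip: mult.assoc)
  qed
qed

text \<open>A discrete integral of \<open>Q powr (- (1 / 12))\<close> with respect to
  \<open>Q\<close>, the weights being the increments of \<open>Q\<close>.\<close>

lemma weighted_sum_bound: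
  obtains C where "0 < C"
    "\<And>n. (\<Sum>i<n. 1 / (a (Suc i))\<^sup>2 * real (Suc i) powr (- (1 / 4))) \<le> C * Q n powr (11 / 12)"
proof -
  obtain C where C: "0 < C" "\<And>n. 1 \<le> n \<Longrightarrow> real n powr (- (1 / 4)) \<le> C * Q n powr (- (1 / 12))"
    by (rule powr_index_le_Q) blast
  have "(\<Sum>i<n. 1 / (a (Suc i))\<^sup>2 * real (Suc i) powr (- (1 / 4))) \<le> C * (12 / 11) * Q n powr (11 / 12)" for n
  proof (induction n)
    case 0
    then show ?case by (simp add: Q_def)
  next
    case (Suc n)
    have "1 / (a (Suc n))\<^sup>2 * real (Suc n) powr (- (1 / 4))
        \<le> 1 / (a (Suc n))\<^sup>2 * (C * Q (Suc n) powr (- (1 / 12)))"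
      using C(2)[of "Suc n"] by (intro mult_left_mono) auto
    also have "\<dots> = C * ((Q (Suc n) - Q n) * Q (Suc n) powr (- (1 / 12)))"
      by (simp add: Q_Suc)
    also have "\<dots> \<le> C * (12 / 11 * (Q (Suc n) powr (11 / 12) - Q n powr (11 / 12)))"
      using concave_powr_increment[of "Q n" "Q (Suc n)" "11 / 12"] Q_nonneg[of n] Q_mono[of n "Suc n"]
        Q_ge_1[of "Suc n"] C(1) by (intro mult_left_mono) auto
    finally show ?case using Suc by (simp add: algebra_simps)
  qed
  then show ?thesis using C(1) by (intro that[of "C * (12 / 11)"]) auto
qed

end

section \<open>The martingale of the walk\<close>

lemma space_past [simp]: "space (past P X n) = space P"
  unfolding past_def by (rule space_measure_of) auto

lemma sets_past:
  "sets (past P X n) = sigma_sets (space P) {X k -` B \<inter> space P | k B. k \<in> {1..n} \<and> B \<in> sets borel}"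
  unfolding past_def by (rule sets_measure_of) auto

lemma measurable_past: "k \<in> {1..n} \<Longrightarrow> X k \<in> borel_measurable (past P X n)"
  by (rule measurableI) (auto simp: sets_past intro!: sigma_sets.Basic)

section \<open>One-step predictions of the walk\<close>

context derw
begin

definition memory :: "nat \<Rightarrow> real" where
  "memory n = (2 * p - 1) * g \<alpha> (Suc n)"

text \<open>The part of the conditional mean that does not depend on the past. The first step uses
  \<open>q\<close> in place of an average over earlier steps, hence its separate value.\<close>

definition drift :: "nat \<Rightarrow> real" where
  "drift n = (if n = 0 then g \<alpha> 1 * (2 * q - 1) + (1 - g \<alpha> 1) * (2 * f (T x) - 1)
    else (1 - g \<alpha> (Suc n)) * (2 * f ((T ^^ Suc n) x) - 1))"

text \<open>The conditional mean of \<open>X (n + 1)\<close> given the past. At \<open>n = 0\<close>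
  the quotient is 0, so \<open>pred 0\<close> is \<open>drift 0\<close>.\<close>

definition pred :: "nat \<Rightarrow> 'b \<Rightarrow> real" where
  "pred n \<omega> = memory n * (walk X n \<omega> / real n) + drift n"

lemma g_unit: "1 \<le> n \<Longrightarrow> 0 \<le> g \<alpha> n" "1 \<le> n \<Longrightarrow> g \<alpha> n \<le> 1"
  using g_range[OF \<alpha>_dom] by auto

lemma orbit_in_space: "(T ^^ n) x \<in> space M"
  by (induction n) (auto simp: x_in intro: measurable_space[OF T_measurable])

lemma f_orbit: "0 \<le> f ((T ^^ n) x)" "f ((T ^^ n) x) \<le> 1"
  using f_range[OF orbit_in_space[of n]] by auto

lemma memory_abs: "\<bar>memory n\<bar> \<le> g \<alpha> (Suc n)" "\<bar>memory n\<bar> \<le> 1"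
proof -
  have "\<bar>2 * p - 1\<bar> \<le> 1" using p_range by (auto simp: abs_le_iff)
  then show 1: "\<bar>memory n\<bar> \<le> g \<alpha> (Suc n)"
    using g_unit[of "Suc n"] by (simp add: memory_def abs_mult mult_left_le_one_le)
  then show "\<bar>memory n\<bar> \<le> 1" using g_unit[of "Suc n"] by simp
qed

lemma X_abs: "\<omega> \<in> space P \<Longrightarrow> \<bar>X (Suc n) \<omega>\<bar> \<le> 1" and X_sq: "\<omega> \<in> space P \<Longrightarrow> (X (Suc n) \<omega>)\<^sup>2 = 1"
  using X_values[of "Suc n" \<omega>] by auto

lemma walk_Suc: "walk X (Suc n) \<omega> = walk X n \<omega> + X (Suc n) \<omega>"
  by (simp add: walk_def)

lemma walk_0 [simp]: "walk X 0 \<omega> = 0"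
  by (simp add: walk_def)

lemma walk_abs: "\<omega> \<in> space P \<Longrightarrow> \<bar>walk X n \<omega>\<bar> \<le> real n"
proof (induction n)
  case (Suc n)
  then show ?case
    using X_abs[of \<omega> n] abs_triangle_ineq[of "walk X n \<omega>" "X (Suc n) \<omega>"] by (simp add: walk_Suc)
qed simp

lemma walk_mean_abs: "\<omega> \<in> space P \<Longrightarrow> \<bar>walk X n \<omega> / real n\<bar> \<le> 1"
  using walk_abs[of \<omega> n] by (cases "n = 0") (auto simp: field_simps)

lemma drift_abs: "\<bar>drift 0\<bar> \<le> 1" "1 \<le> n \<Longrightarrow> \<bar>drift n\<bar> \<le> 1 - g \<alpha> (Suc n)"
proof -
  have fb: "\<bar>2 * f ((T ^^ n) x) - 1\<bar> \<le> 1" for n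
    using f_orbit[of n] by (auto simp: abs_le_iff)
  have "\<bar>2 * f (T x) - 1\<bar> \<le> 1" "\<bar>2 * q - 1\<bar> \<le> 1"
    using fb[of 1] q_range by (auto simp: abs_le_iff)
  then have "\<bar>g \<alpha> 1 * (2 * q - 1)\<bar> \<le> g \<alpha> 1" "\<bar>(1 - g \<alpha> 1) * (2 * f (T x) - 1)\<bar> \<le> 1 - g \<alpha> 1"
    using g_unit[of 1] by (auto simp: abs_mult intro: mult_left_le)
  then show "\<bar>drift 0\<bar> \<le> 1" by (simp add: drift_def)
  show "\<bar>drift n\<bar> \<le> 1 - g \<alpha> (Suc n)" if "1 \<le> n"
    using that g_unit[of "Suc n"] fb[of "Suc n"] by (auto simp: drift_def abs_mult simp del: funpow.simps intro: mult_left_le)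
qed

text \<open>After the first step, memory and drift are bounded by the complementary weights
  \<open>g \<alpha> (n + 1)\<close> and \<open>1 - g \<alpha> (n + 1)\<close>.\<close>

lemma affine_abs:
  assumes "\<bar>z\<bar> \<le> 1"
  shows "\<bar>memory n * (if n = 0 then 0 else z) + drift n\<bar> \<le> 1"
proof (cases "n = 0")
  case True
  then show ?thesis using drift_abs by simp
next
  case False
  have "\<bar>memory n * z\<bar> \<le> \<bar>memory n\<bar>"
    using assms by (simp add: abs_mult mult_left_le)
  then show ?thesis
    using False memory_abs(1)[of n] drift_abs(2)[of n] by simp
qed

lemma pred_abs: "\<omega> \<in> space P \<Longrightarrow> \<bar>pred n \<omega>\<bar> \<le> 1"
  using affine_abs[OF walk_mean_abs, of \<omega> n n] by (auto simp: pred_def split: if_splits)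

lemma past_subalgebra: "subalgebra P (past P X n)"
proof -
  have "X k -` B \<inter> space P \<in> sets P" if "k \<in> {1..n}" "B \<in> sets borel" for k B
    using X_measurable[of k] that by (auto intro: measurable_sets)
  then show ?thesis
    unfolding subalgebra_def sets_past by (auto intro!: sets.sigma_sets_subset)
qed

lemma past_Suc: "sets (past P X n) \<subseteq> sets (past P X (Suc n))"
  unfolding sets_past by (rule sigma_sets_mono') fastforce

lemma walk_measurable: "walk X n \<in> borel_measurable (past P X n)"
  unfolding walk_def[abs_def] by (intro borel_measurable_sum measurable_past)

lemma pred_measurable: "pred n \<in> borel_measurable (past P X n)"
  unfolding pred_def[abs_def] using walk_measurable[of n] by measurable

lemma past_measurable_P: "Z \<in> borel_measurable (past P X n) \<Longrightarrow> Z \<in> borel_measurable P"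
  using measurable_from_subalg[OF past_subalgebra] .

lemma X_integrable: "integrable P (X (Suc n))"
  using X_measurable[of "Suc n"] X_abs by (intro walk.integrable_const_bound[where B = 1]) auto

text \<open>The bridge from the transition law to the martingale. Writing \<open>X\<close> as
  \<open>2 * indicator E - 1\<close> reduces it to the conditional probability of an upward
  step.\<close>

lemma integral_mult_X:
  assumes Z: "Z \<in> borel_measurable (past P X n)" and K: "\<And>\<omega>. \<omega> \<in> space P \<Longrightarrow> \<bar>Z \<omega>\<bar> \<le> K"
  shows "(\<integral>\<omega>. Z \<omega> * X (Suc n) \<omega> \<partial>P) = (\<integral>\<omega>. Z \<omega> * pred n \<omega> \<partial>P)"
proof -
  define E where "E = {\<omega> \<in> space P. X (Suc n) \<omega> = 1}"
  have ZP [measurable]: "Z \<in> borel_measurable P"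
    by (rule past_measurable_P[OF Z])
  have [measurable]: "X (Suc n) \<in> borel_measurable P"
    by (rule X_measurable) simp
  have E [measurable]: "E \<in> sets P" unfolding E_def by measurable
  have XE: "X (Suc n) \<omega> = 2 * indicator E \<omega> - 1" if "\<omega> \<in> space P" for \<omega>
    using X_values[of "Suc n" \<omega>] that by (auto simp: E_def indicator_def)
  have K0: "0 \<le> K"
    using K walk.not_empty by (meson abs_ge_zero all_not_in_conv order_trans)
  have iZ: "integrable P Z"
    using K by (intro walk.integrable_const_bound[where B = K]) auto
  have iZE: "integrable P (\<lambda>\<omega>. Z \<omega> * indicator E \<omega>)"
    using K K0 by (intro walk.integrable_const_bound[where B = K]) (auto simp: indicator_def)
  have "(\<integral>\<omega>. Z \<omega> * X (Suc n) \<omega> \<partial>P) = (\<integral>\<omega>. 2 * (Z \<omega> * indicator E \<omega>) - Z \<omega> \<partial>P)"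
    by (intro Bochner_Integration.integral_cong) (simp_all add: XE right_diff_distrib)
  also have "\<dots> = 2 * (\<integral>\<omega>. Z \<omega> * indicator E \<omega> \<partial>P) - (\<integral>\<omega>. Z \<omega> \<partial>P)"
    using iZ iZE by simp
  finally have 1: "(\<integral>\<omega>. Z \<omega> * X (Suc n) \<omega> \<partial>P) = 2 * (\<integral>\<omega>. Z \<omega> * indicator E \<omega> \<partial>P) - (\<integral>\<omega>. Z \<omega> \<partial>P)" .
  show ?thesis
  proof (cases "n = 0")
    case True
    \<comment> \<open>At \<open>n = 0\<close> the past is the trivial sigma-algebra, so
      \<open>Z\<close> is constant and the unconditional \<open>first_step\<close> takes the place
      of \<open>next_step\<close>.\<close>
    obtain \<omega>0 where \<omega>0: "\<omega>0 \<in> space P" using walk.not_empty by blast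
    have "sets (past P X 0) = {{}, space P}"
      by (simp add: sets_past sigma_sets_empty_eq)
    moreover have "Z -` {Z \<omega>0} \<inter> space (past P X 0) \<in> sets (past P X 0)"
      using Z True by (intro measurable_sets[of Z _ borel]) auto
    ultimately have "Z -` {Z \<omega>0} \<inter> space P = space P"
      using \<omega>0 by auto
    then have Zc: "Z \<omega> = Z \<omega>0" if "\<omega> \<in> space P" for \<omega>
      using that by auto
    have "(\<integral>\<omega>. Z \<omega> * indicator E \<omega> \<partial>P) = (\<integral>\<omega>. Z \<omega>0 * indicator E \<omega> \<partial>P)"
      by (rule Bochner_Integration.integral_cong) (auto dest: Zc)
    also have "\<dots> = Z \<omega>0 * (g \<alpha> 1 * q + (1 - g \<alpha> 1) * f (T x))"
      using E first_step True by (simp add: E_def)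
    finally have A: "(\<integral>\<omega>. Z \<omega> * indicator E \<omega> \<partial>P) = Z \<omega>0 * (g \<alpha> 1 * q + (1 - g \<alpha> 1) * f (T x))" .
    have B: "(\<integral>\<omega>. Z \<omega> \<partial>P) = Z \<omega>0"
      using Bochner_Integration.integral_cong[OF refl Zc, of P] by (simp add: walk.prob_space)
    have "(\<integral>\<omega>. Z \<omega> * pred n \<omega> \<partial>P) = (\<integral>\<omega>. Z \<omega>0 * drift 0 \<partial>P)"
      using True by (intro Bochner_Integration.integral_cong) (auto dest: Zc simp: pred_def)
    then show ?thesis
      unfolding 1 A B by (simp add: walk.prob_space drift_def algebra_simps)
  next
    case False
    interpret sub: finite_measure_subalgebra P "past P X n"
      by unfold_locales (rule past_subalgebra)
    let ?c = "real_cond_exp P (past P X n) (indicat_real E)"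
    have ind: "indicat_real E \<in> borel_measurable P" by measurable
    note ce = sub.real_cond_exp_intg[OF iZE Z ind]
    have "AE \<omega> in P. 2 * (Z \<omega> * ?c \<omega>) - Z \<omega> = Z \<omega> * pred n \<omega>"
    proof -
      have "AE \<omega> in P. ?c \<omega> = g \<alpha> (n + 1) * (1 / (2 * real n) * (\<Sum>k = 1..n. 1 + (2 * p - 1) * X k \<omega> * 1))
          + (1 - g \<alpha> (n + 1)) * dyn_weight T f x (n + 1) 1"
        using next_step[of n 1] False unfolding E_def by simp
      then show ?thesis
      proof eventually_elim
        case (elim \<omega>)
        have S: "(\<Sum>k = 1..n. 1 + (2 * p - 1) * X k \<omega> * 1) = real n + (2 * p - 1) * walk X n \<omega>"
          by (simp add: walk_def sum.distrib sum_distrib_left)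
        define z where "z = f ((T ^^ Suc n) x)"
        have C: "?c \<omega> = g \<alpha> (Suc n) * (1 / (2 * real n) * (real n + (2 * p - 1) * walk X n \<omega>)) + (1 - g \<alpha> (Suc n)) * z"
          using elim unfolding S by (simp add: z_def dyn_weight_def del: funpow.simps)
        have D: "pred n \<omega> = (2 * p - 1) * g \<alpha> (Suc n) * (walk X n \<omega> / real n) + (1 - g \<alpha> (Suc n)) * (2 * z - 1)"
          using False by (simp add: pred_def memory_def drift_def z_def del: funpow.simps)
        have "2 * ?c \<omega> - 1 = pred n \<omega>"
          unfolding C D using False by (simp add: field_simps)
        moreover have "2 * (Z \<omega> * ?c \<omega>) - Z \<omega> = Z \<omega> * (2 * ?c \<omega> - 1)"
          by (simp add: right_diff_distrib)
        ultimately show ?case by (simp only:)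
      qed
    qed
    then have "(\<integral>\<omega>. Z \<omega> * pred n \<omega> \<partial>P) = (\<integral>\<omega>. 2 * (Z \<omega> * ?c \<omega>) - Z \<omega> \<partial>P)"
      using past_measurable_P[OF pred_measurable] by (intro integral_cong_AE) auto
    also have "\<dots> = 2 * (\<integral>\<omega>. Z \<omega> * ?c \<omega> \<partial>P) - (\<integral>\<omega>. Z \<omega> \<partial>P)"
      using iZ ce(1) by simp
    finally show ?thesis using 1 ce(2) by simp
  qed
qed

lemma integral_pred: "(\<integral>\<omega>. pred n \<omega> \<partial>P) = (\<integral>\<omega>. X (Suc n) \<omega> \<partial>P)"
  using integral_mult_X[of "\<lambda>_. 1" n 1] by simp

lemma walk_integrable: "integrable P (walk X n)"
  using past_measurable_P[OF walk_measurable] walk_abs by (intro walk.integrable_const_bound[where B = "real n"]) auto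

lemma expectation_X: "(\<integral>\<omega>. X (Suc n) \<omega> \<partial>P) = memory n * ((\<integral>\<omega>. walk X n \<omega> \<partial>P) / real n) + drift n"
proof -
  have "(\<integral>\<omega>. pred n \<omega> \<partial>P) = (\<integral>\<omega>. memory n * (walk X n \<omega> / real n) + drift n \<partial>P)"
    by (simp add: pred_def)
  also have "\<dots> = memory n * ((\<integral>\<omega>. walk X n \<omega> \<partial>P) / real n) + drift n"
    using walk_integrable[of n] by (simp add: walk.prob_space)
  finally show ?thesis by (simp add: integral_pred)
qed

text \<open>The drift cancels, leaving a multiple of the centred walk. This yields both the
  normalisation by \<open>a\<close> and the mean deviation of the quadratic variation.\<close>

lemma pred_deviation:
  "pred n \<omega> - (\<integral>\<omega>. X (Suc n) \<omega> \<partial>P) = memory n * ((walk X n \<omega> - (\<integral>\<omega>. walk X n \<omega> \<partial>P)) / real n)"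
  by (simp add: pred_def expectation_X diff_divide_distrib right_diff_distrib)

section \<open>The normalised martingale and its iterated logarithm\<close>

abbreviation a where "a \<equiv> a_coef p g \<alpha>"

lemma a_coef_0: "a 0 = 1"
  by (simp add: a_coef_def)

lemma a_coef_Suc: "a (Suc n) = a n * (1 + memory n / real n)"
  by (cases "n = 0") (simp_all add: a_coef_def memory_def prod.atLeastLessThan_Suc)

text \<open>The excluded case \<open>g \<alpha> 2 = 1\<close>, \<open>p = 0\<close> is exactly the
  one in which the factor \<open>1 + memory 1\<close> of the product vanishes.\<close>

lemma memory_1: "- 1 < memory 1"
proof -
  have "- g \<alpha> 2 \<le> memory 1" using memory_abs(1)[of 1] by (simp add: abs_le_iff numeral_2_eq_2)
  show ?thesis
  proof (cases "g \<alpha> 2 = 1")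
    case True
    then have "0 < p" using nondegenerate p_range by auto
    with True show ?thesis by (simp add: memory_def numeral_2_eq_2)
  next
    case False
    then have "g \<alpha> 2 < 1" using g_unit(2)[of 2] by simp
    with \<open>- g \<alpha> 2 \<le> memory 1\<close> show ?thesis by simp
  qed
qed

lemma mean_walk_abs: "\<bar>(\<integral>\<omega>. walk X n \<omega> \<partial>P)\<bar> \<le> real n"
proof -
  have "\<bar>(\<integral>\<omega>. walk X n \<omega> \<partial>P)\<bar> \<le> (\<integral>\<omega>. \<bar>walk X n \<omega>\<bar> \<partial>P)"
    by (rule integral_abs_bound)
  also have "\<dots> \<le> (\<integral>\<omega>. real n \<partial>P)"
    using walk_abs walk_integrable[of n] by (intro integral_mono) auto
  finally show ?thesis by (simp add: walk.prob_space)
qed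

lemma mean_walk_Suc:
  "(\<integral>\<omega>. walk X (Suc n) \<omega> \<partial>P) = (\<integral>\<omega>. walk X n \<omega> \<partial>P) + (\<integral>\<omega>. X (Suc n) \<omega> \<partial>P)"
proof -
  have "(\<integral>\<omega>. walk X (Suc n) \<omega> \<partial>P) = (\<integral>\<omega>. walk X n \<omega> + X (Suc n) \<omega> \<partial>P)"
    by (intro Bochner_Integration.integral_cong) (simp_all add: walk_Suc)
  then show ?thesis
    using walk_integrable[of n] X_integrable[of n] by simp
qed

definition incr :: "nat \<Rightarrow> 'b \<Rightarrow> real" where
  "incr n \<omega> = (X (Suc n) \<omega> - pred n \<omega>) / a (Suc n)"

text \<open>The conditional variance of \<open>incr n\<close>: as \<open>X\<close> squares to 1, its
  conditional variance is \<open>1 - pred\<^sup>2\<close>.\<close>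

definition incr_var :: "nat \<Rightarrow> 'b \<Rightarrow> real" where
  "incr_var n \<omega> = (1 - (pred n \<omega>)\<^sup>2) / (a (Suc n))\<^sup>2"

lemma incr_martingale:
  assumes a_pos: "\<And>n. 0 < a n"
  shows "martingale_increments P (past P X) incr incr_var (\<lambda>n. 2 / a (Suc n))"
proof
  fix n
  show "subalgebra P (past P X n)" by (rule past_subalgebra)
  show "sets (past P X n) \<subseteq> sets (past P X (Suc n))" by (rule past_Suc)
  have predS: "pred n \<in> borel_measurable (past P X (Suc n))"
    by (rule measurable_from_subalg[OF _ pred_measurable]) (simp add: subalgebra_def past_Suc)
  have XS: "X (Suc n) \<in> borel_measurable (past P X (Suc n))"
    by (rule measurable_past) simp
  show dm: "incr n \<in> borel_measurable (past P X (Suc n))"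
    unfolding incr_def[abs_def] using XS predS by measurable
  show sm: "incr_var n \<in> borel_measurable (past P X n)"
    unfolding incr_var_def[abs_def] using pred_measurable[of n] by measurable
  have p2: "(pred n \<omega>)\<^sup>2 \<le> 1" if "\<omega> \<in> space P" for \<omega>
    using pred_abs[OF that, of n] by (simp add: abs_square_le_1)
  show db: "\<bar>incr n \<omega>\<bar> \<le> 2 / a (Suc n)" if "\<omega> \<in> space P" for \<omega>
  proof -
    have "\<bar>X (Suc n) \<omega> - pred n \<omega>\<bar> \<le> 2"
      using X_abs[OF that, of n] pred_abs[OF that, of n] by linarith
    then show ?thesis
      using a_pos[of "Suc n"] by (simp add: incr_def divide_right_mono)
  qed
  show s0: "0 \<le> incr_var n \<omega>" if "\<omega> \<in> space P" for \<omega>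
    using p2[OF that] by (simp add: incr_var_def)
  show sb: "incr_var n \<omega> \<le> (2 / a (Suc n))\<^sup>2" if "\<omega> \<in> space P" for \<omega>
  proof -
    have "1 - (pred n \<omega>)\<^sup>2 \<le> 2\<^sup>2"
      by (rule order_trans[of _ 1]) auto
    then show ?thesis
      unfolding incr_var_def power_divide by (rule divide_right_mono) simp
  qed
  interpret sub: finite_measure_subalgebra P "past P X n"
    by unfold_locales (rule past_subalgebra)
  have [measurable]: "X (Suc n) \<in> borel_measurable P" "pred n \<in> borel_measurable P"
    using X_measurable[of "Suc n"] past_measurable_P[OF pred_measurable] by auto
  have dP [measurable]: "incr n \<in> borel_measurable P" and sP [measurable]: "incr_var n \<in> borel_measurable P"
    by (rule past_measurable_P[OF dm], rule past_measurable_P[OF sm])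
  have int: "integrable P (\<lambda>\<omega>. Z \<omega> * Y \<omega>)"
    if [measurable]: "Z \<in> borel_measurable P" "Y \<in> borel_measurable P"
      and "\<And>\<omega>. \<omega> \<in> space P \<Longrightarrow> \<bar>Z \<omega>\<bar> \<le> 1" "\<And>\<omega>. \<omega> \<in> space P \<Longrightarrow> \<bar>Y \<omega>\<bar> \<le> 1" for Z Y :: "'b \<Rightarrow> real"
    using that(3,4) by (intro walk.integrable_const_bound[where B = 1])
      (auto simp: abs_mult intro!: mult_le_one)
  have orth: "(\<integral>\<omega>. Z \<omega> * (X (Suc n) \<omega> - pred n \<omega>) \<partial>P) = 0"
    if Z: "Z \<in> borel_measurable (past P X n)" "\<And>\<omega>. \<omega> \<in> space P \<Longrightarrow> \<bar>Z \<omega>\<bar> \<le> 1" for Z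
  proof -
    have [measurable]: "Z \<in> borel_measurable P" by (rule past_measurable_P[OF Z(1)])
    have "integrable P (\<lambda>\<omega>. Z \<omega> * X (Suc n) \<omega>)" "integrable P (\<lambda>\<omega>. Z \<omega> * pred n \<omega>)"
      using Z X_abs pred_abs by (auto intro!: int)
    then show ?thesis
      using integral_mult_X[OF Z] by (simp add: right_diff_distrib)
  qed
  have iB: "integrable P h" if "h \<in> borel_measurable P" "\<And>\<omega>. \<omega> \<in> space P \<Longrightarrow> \<bar>h \<omega>\<bar> \<le> K" for h and K :: real
    using that by (intro walk.integrable_const_bound[where B = K]) auto
  have ind1: "\<bar>indicator A \<omega> :: real\<bar> \<le> 1" for A and \<omega> :: 'b
    by (simp add: indicator_def)
  show "AE \<omega> in P. real_cond_exp P (past P X n) (incr n) \<omega> = 0"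
  proof (rule sub.real_cond_exp_charact)
    fix A assume A: "A \<in> sets (past P X n)"
    have "(\<integral>\<omega>\<in>A. incr n \<omega> \<partial>P) = (\<integral>\<omega>. indicator A \<omega> * (X (Suc n) \<omega> - pred n \<omega>) / a (Suc n) \<partial>P)"
      by (simp add: set_lebesgue_integral_def incr_def)
    also have "\<dots> = (\<integral>\<omega>. indicator A \<omega> * (X (Suc n) \<omega> - pred n \<omega>) \<partial>P) / a (Suc n)"
      by (rule integral_divide_zero)
    also have "(\<integral>\<omega>. indicator A \<omega> * (X (Suc n) \<omega> - pred n \<omega>) \<partial>P) = 0"
      using A ind1 by (intro orth) auto
    finally show "(\<integral>\<omega>\<in>A. incr n \<omega> \<partial>P) = (\<integral>\<omega>\<in>A. 0 \<partial>P)"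
      by simp
  qed (use iB[OF dP db] in auto)
  show "AE \<omega> in P. real_cond_exp P (past P X n) (\<lambda>\<omega>. (incr n \<omega>)\<^sup>2) \<omega> = incr_var n \<omega>"
  proof (rule sub.real_cond_exp_charact)
    have b: "\<bar>(incr n \<omega>)\<^sup>2\<bar> \<le> (2 / a (Suc n))\<^sup>2" "\<bar>incr_var n \<omega>\<bar> \<le> (2 / a (Suc n))\<^sup>2" if "\<omega> \<in> space P" for \<omega>
      using power_mono[OF db[OF that] abs_ge_zero, of 2] s0[OF that] sb[OF that] by auto
    show i1: "integrable P (\<lambda>\<omega>. (incr n \<omega>)\<^sup>2)" and i2: "integrable P (incr_var n)"
      by (rule iB[OF _ b(1)], measurable) (rule iB[OF sP b(2)])
    show "incr_var n \<in> borel_measurable (past P X n)" by (rule sm)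
    fix A assume A: "A \<in> sets (past P X n)"
    then have AP: "A \<in> sets P" using past_subalgebra by (auto simp: subalgebra_def)
    \<comment> \<open>Because \<open>X\<close> squares to 1, the difference is a multiple of
      \<open>pred n * (X (Suc n) - pred n)\<close>, whose integral over any event of the past
      vanishes.\<close>
    have *: "(incr n \<omega>)\<^sup>2 - incr_var n \<omega> = - 2 / (a (Suc n))\<^sup>2 * (pred n \<omega> * (X (Suc n) \<omega> - pred n \<omega>))"
      if "\<omega> \<in> space P" for \<omega>
    proof -
      have "(X (Suc n) \<omega> - pred n \<omega>)\<^sup>2 - (1 - (pred n \<omega>)\<^sup>2) = - 2 * (pred n \<omega> * (X (Suc n) \<omega> - pred n \<omega>))"
        using X_sq[OF that, of n] by (simp add: power2_eq_square algebra_simps)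
      then show ?thesis
        unfolding incr_def incr_var_def power_divide diff_divide_distrib[symmetric] by simp
    qed
    have "(\<integral>\<omega>\<in>A. (incr n \<omega>)\<^sup>2 \<partial>P) - (\<integral>\<omega>\<in>A. incr_var n \<omega> \<partial>P) = (\<integral>\<omega>\<in>A. (incr n \<omega>)\<^sup>2 - incr_var n \<omega> \<partial>P)"
      using integrable_mult_indicator[OF AP i1] integrable_mult_indicator[OF AP i2]
      by (intro set_integral_diff(2)[symmetric]) (simp_all add: set_integrable_def)
    also have "\<dots> = (\<integral>\<omega>. - 2 / (a (Suc n))\<^sup>2 * (indicator A \<omega> * pred n \<omega> * (X (Suc n) \<omega> - pred n \<omega>)) \<partial>P)"
      unfolding set_lebesgue_integral_def by (intro Bochner_Integration.integral_cong) (auto simp: *)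
    also have "\<dots> = - 2 / (a (Suc n))\<^sup>2 * (\<integral>\<omega>. indicator A \<omega> * pred n \<omega> * (X (Suc n) \<omega> - pred n \<omega>) \<partial>P)"
      by (rule integral_mult_right_zero)
    also have "(\<integral>\<omega>. indicator A \<omega> * pred n \<omega> * (X (Suc n) \<omega> - pred n \<omega>) \<partial>P) = 0"
    proof (rule orth)
      show "(\<lambda>\<omega>. indicator A \<omega> * pred n \<omega>) \<in> borel_measurable (past P X n)"
        using A pred_measurable[of n] by measurable
    qed (use pred_abs in \<open>auto simp: indicator_def\<close>)
    finally show "(\<integral>\<omega>\<in>A. (incr n \<omega>)\<^sup>2 \<partial>P) = (\<integral>\<omega>\<in>A. incr_var n \<omega> \<partial>P)" by simp
  qed
qed

lemma lil_walk:
  assumes half: "\<forall>\<^sub>F n in sequentially. memory n \<le> 1 / 2"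
    and \<delta>: "0 < \<delta>" and nondeg: "\<forall>\<^sub>F n in sequentially. (\<integral>\<omega>. X (Suc n) \<omega> \<partial>P)\<^sup>2 \<le> 1 - \<delta>"
  shows "AE \<omega> in P. limsup (\<lambda>n. ereal (\<bar>walk X n \<omega> - integral\<^sup>L P (walk X n)\<bar> /
    (a n * A_coef p g \<alpha> P X n * sqrt (ln (ln (A_coef p g \<alpha> P X n)))))) = ereal (sqrt 2)"
proof -
  interpret co: drift_coefficients a memory
    by unfold_locales (rule a_coef_0 a_coef_Suc memory_abs(2) memory_1 half)+
  interpret mi: martingale_increments P "past P X" incr incr_var "\<lambda>n. 2 / a (Suc n)"
    by (rule incr_martingale[OF co.a_pos])
  define e where "e n = (\<integral>\<omega>. X (Suc n) \<omega> \<partial>P)" for n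
  \<comment> \<open>This is \<open>1 + A_n^2\<close>. The added 1 makes the clock positive at time
    0; it is undone by \<open>h\<close> at the end.\<close>
  define B where "B n = 1 + (\<Sum>i<n. (1 - (e i)\<^sup>2) / (a (Suc i))\<^sup>2)" for n
  have e1: "\<bar>e n\<bar> \<le> 1" for n
  proof -
    have "\<bar>e n\<bar> \<le> (\<integral>\<omega>. \<bar>X (Suc n) \<omega>\<bar> \<partial>P)"
      unfolding e_def by (rule integral_abs_bound)
    also have "\<dots> \<le> (\<integral>\<omega>. 1 \<partial>P)"
      using X_abs X_integrable[of n] by (intro integral_mono) auto
    finally show ?thesis by (simp add: walk.prob_space)
  qed
  have e2: "(e n)\<^sup>2 \<le> 1" for n
    using e1[of n] by (simp add: abs_square_le_1)
  have B_Suc: "B (Suc n) = B n + (1 - (e n)\<^sup>2) / (a (Suc n))\<^sup>2" for n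
    by (simp add: B_def)
  have B_mono: "B m \<le> B n" if "m \<le> n" for m n
    using that by (rule lift_Suc_mono_le[rotated]) (simp add: B_Suc e2)
  have B1: "1 \<le> B n" for n
    using B_mono[of 0 n] by (simp add: B_def)
  have BQ: "B n \<le> 1 + co.Q n" for n
    unfolding B_def co.Q_def by (intro add_left_mono sum_mono divide_right_mono) auto
  obtain K where K: "1 \<le> K" "\<And>n. co.Q n \<le> K * B n"
  proof -
    obtain n0 where n0: "\<And>n. n0 \<le> n \<Longrightarrow> (e n)\<^sup>2 \<le> 1 - \<delta>"
      using nondeg by (auto simp: eventually_sequentially e_def)
    \<comment> \<open>Up to \<open>n0\<close> the value \<open>Q n0\<close> suffices; afterwards
      each term of \<open>Q\<close> is at most \<open>1 / \<delta>\<close> times the corresponding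
      term of \<open>B\<close>.\<close>
    have "co.Q n \<le> co.Q n0 + 1 / \<delta> * (B n - 1)" for n
    proof (induction n)
      case 0
      then show ?case using co.Q_nonneg by (simp add: co.Q_def B_def)
    next
      case (Suc n)
      show ?case
      proof (cases "n < n0")
        case True
        then have "co.Q (Suc n) \<le> co.Q n0" by (intro co.Q_mono) simp
        then show ?thesis using B1[of "Suc n"] \<delta> by (simp add: add_increasing2)
      next
        case False
        then have "\<delta> \<le> 1 - (e n)\<^sup>2" using n0[of n] by simp
        then have "1 \<le> 1 / \<delta> * (1 - (e n)\<^sup>2)" using \<delta> by (simp add: field_simps)
        then have "1 / (a (Suc n))\<^sup>2 \<le> 1 / \<delta> * (1 - (e n)\<^sup>2) / (a (Suc n))\<^sup>2"
          by (intro divide_right_mono) auto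
        also have "\<dots> = 1 / \<delta> * (B (Suc n) - 1) - 1 / \<delta> * (B n - 1)"
          unfolding B_Suc by (simp add: algebra_simps)
        finally show ?thesis
          using Suc unfolding co.Q_Suc by linarith
      qed
    qed
    then have "co.Q n \<le> (1 + co.Q n0 + 1 / \<delta>) * B n" for n
    proof -
      have "co.Q n0 * 1 \<le> co.Q n0 * B n" "1 / \<delta> * (B n - 1) \<le> 1 / \<delta> * B n"
        using B1[of n] \<delta> co.Q_nonneg[of n0] by (intro mult_left_mono; simp)+
      moreover have "(1 + co.Q n0 + 1 / \<delta>) * B n = B n + co.Q n0 * B n + 1 / \<delta> * B n"
        by (simp only: distrib_right mult_1)
      ultimately show ?thesis
        using \<open>co.Q n \<le> co.Q n0 + 1 / \<delta> * (B n - 1)\<close> B1[of n] by linarith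
    qed
    moreover have "1 \<le> 1 + co.Q n0 + 1 / \<delta>"
      using \<delta> co.Q_nonneg[of n0] by simp
    ultimately show ?thesis
      using that by blast
  qed
  have Qpow: "co.Q n powr (11 / 12) \<le> K * B n powr (1 - 1 / 12)" for n
  proof -
    have "co.Q n powr (11 / 12) \<le> (K * B n) powr (11 / 12)"
      using K(2) co.Q_nonneg by (intro powr_mono2) auto
    also have "\<dots> = K powr (11 / 12) * B n powr (11 / 12)"
      using K B1[of n] by (simp add: powr_mult)
    also have "\<dots> \<le> K * B n powr (11 / 12)"
      using K(1) powr_mono[of "11 / 12" 1 K] by (intro mult_right_mono) auto
    finally show ?thesis by simp
  qed
  \<comment> \<open>\<open>1 + memory n / n\<close> is \<open>a (Suc n) / a n\<close>, so division
    by \<open>a\<close> turns the recursion of the centred walk into a plain sum.\<close>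
  have mart: "mi.mart n \<omega> = (walk X n \<omega> - integral\<^sup>L P (walk X n)) / a n" for n \<omega>
  proof (induction n)
    case 0
    then show ?case by (simp add: mi.mart_def)
  next
    case (Suc n)
    define D where "D = walk X n \<omega> - integral\<^sup>L P (walk X n)"
    have "walk X (Suc n) \<omega> - integral\<^sup>L P (walk X (Suc n)) = D + (X (Suc n) \<omega> - e n)"
      unfolding mean_walk_Suc by (simp add: walk_Suc D_def e_def)
    also have "\<dots> = D * (1 + memory n / real n) + (X (Suc n) \<omega> - pred n \<omega>)"
    proof -
      have "pred n \<omega> - e n = memory n * (D / real n)"
        using pred_deviation[of n \<omega>] by (simp only: e_def D_def)
      moreover have "D * (1 + memory n / real n) = D + memory n * (D / real n)"
        by (simp add: distrib_left)
      ultimately show ?thesis by linarith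
    qed
    finally have "(walk X (Suc n) \<omega> - integral\<^sup>L P (walk X (Suc n))) / a (Suc n)
        = D * (1 + memory n / real n) / a (Suc n) + incr n \<omega>"
      by (simp add: incr_def add_divide_distrib)
    also have "D * (1 + memory n / real n) / a (Suc n) = D / a n"
      using co.factor_pos[of n] by (simp add: a_coef_Suc)
    finally show ?case
      using Suc by (simp add: mi.mart_def D_def)
  qed
  have qvar_Q: "mi.qvar n \<omega> \<le> co.Q n" for n \<omega>
    unfolding mi.qvar_def co.Q_def incr_var_def by (intro sum_mono divide_right_mono) auto
  have mart_L1: "(\<integral>\<omega>. \<bar>mi.mart n \<omega>\<bar> \<partial>P) \<le> sqrt (co.Q n)" for n
  proof -
    have "(\<integral>\<omega>. mi.qvar n \<omega> \<partial>P) \<le> (\<integral>\<omega>. co.Q n \<partial>P)"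
      using qvar_Q by (intro integral_mono mi.test_integrable[of n] mi.test_intros) auto
    then have "(\<integral>\<omega>. mi.qvar n \<omega> \<partial>P) \<le> co.Q n" by (simp add: walk.prob_space)
    then show ?thesis
      by (intro order_trans[OF mi.integral_abs_mart_le] real_sqrt_le_mono)
  qed
  obtain C1 where C1: "0 < C1" "\<And>n. 1 \<le> n \<Longrightarrow> real n powr (- (1 / 4)) \<le> C1 * co.Q n powr (- (1 / 12))"
    by (rule co.powr_index_le_Q) blast
  obtain C2 where C2: "0 < C2"
    "\<And>n. (\<Sum>i<n. 1 / (a (Suc i))\<^sup>2 * real (Suc i) powr (- (1 / 4))) \<le> C2 * co.Q n powr (11 / 12)"
    by (rule co.weighted_sum_bound) blast
  obtain C3 where C3: "0 < C3" "\<And>n. 1 \<le> n \<Longrightarrow> (a n)\<^sup>2 * co.Q n \<le> C3 * (real n * sqrt (real n))"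
    by (rule co.a_sq_Q_bound) blast
  \<comment> \<open>The square of the left side is at most \<open>C3 / sqrt n\<close>, hence the
    exponent \<open>1 / 4\<close>. Moving from \<open>n\<close> to \<open>n + 1\<close> uses
    \<open>sqrt (n + 1) \<le> 2 * sqrt n\<close>, hence \<open>2 * C3\<close>; at
    \<open>n = 0\<close> the left side is 0.\<close>
  have L1_rate: "a n * sqrt (co.Q n) / real n \<le> sqrt (2 * C3) * real (Suc n) powr (- (1 / 4))" for n
  proof (cases "n = 0")
    case False
    then have n: "1 \<le> n" by simp
    define q where "q = sqrt (real n)"
    have q: "0 < q" "real n = q\<^sup>2" using n by (auto simp: q_def)
    have "(a n * sqrt (co.Q n) / real n)\<^sup>2 = (a n)\<^sup>2 * co.Q n / (real n)\<^sup>2"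
      using co.Q_nonneg[of n] by (simp add: power_mult_distrib power_divide)
    also have "\<dots> \<le> C3 * (real n * q) / (real n)\<^sup>2"
      using C3(2)[OF n] by (intro divide_right_mono) (auto simp: q_def)
    also have "\<dots> = C3 / q"
      using q n by (simp add: power2_eq_square field_simps)
    also have "\<dots> \<le> 2 * C3 / sqrt (real (Suc n))"
    proof -
      have "sqrt (real (Suc n)) \<le> sqrt (4 * real n)" using n by (intro real_sqrt_le_mono) auto
      also have "\<dots> = 2 * q" by (simp add: q_def real_sqrt_mult)
      finally have "2 * C3 / (2 * q) \<le> 2 * C3 / sqrt (real (Suc n))"
        using C3(1) q by (intro divide_left_mono) auto
      then show ?thesis by simp
    qed
    also have "\<dots> = (sqrt (2 * C3) * real (Suc n) powr (- (1 / 4)))\<^sup>2"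
    proof -
      have "(real (Suc n) powr (- (1 / 4)))\<^sup>2 = real (Suc n) powr (- (1 / 2))"
        by (simp add: power2_eq_square flip: powr_add)
      also have "\<dots> = 1 / sqrt (real (Suc n))"
        by (simp add: powr_minus powr_half_sqrt inverse_eq_divide)
      finally show ?thesis using C3(1) by (simp add: power_mult_distrib)
    qed
    finally show ?thesis
      by (rule power2_le_imp_le) (use C3(1) in simp)
  qed (use C3 in simp)
  define C where "C = 1 + 12 * C1 * K + 2 * sqrt (2 * C3) * C2 * K"
  have C: "12 * C1 * K \<le> C" "1 + 2 * sqrt (2 * C3) * C2 * K \<le> C"
    using C1(1) C2(1) C3(1) K(1) by (auto simp: C_def)
  interpret martingale_lil P "past P X" incr incr_var "\<lambda>n. 2 / a (Suc n)" B C K "1 / 12"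
  proof
    show "0 < B 0" by (simp add: B_def)
    show "B m \<le> B n" if "m \<le> n" for m n using that by (rule B_mono)
    show "filterlim B at_top sequentially"
    proof (rule filterlim_at_top_mono)
      show "filterlim (\<lambda>n. 1 / K * co.Q n) at_top sequentially"
        using K(1) by (intro filterlim_tendsto_pos_mult_at_top[OF tendsto_const _ co.Q_at_top]) auto
      show "\<forall>\<^sub>F n in sequentially. 1 / K * co.Q n \<le> B n"
        using K by (intro always_eventually) (auto simp: field_simps)
    qed
    show "B (Suc n) \<le> B n + (2 / a (Suc n))\<^sup>2" for n
    proof -
      have "1 - (e n)\<^sup>2 \<le> 2\<^sup>2" by (rule order_trans[of _ 1]) auto
      then show ?thesis
        unfolding B_Suc power_divide by (intro add_left_mono divide_right_mono) auto
    qed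
    show "(2 / a (Suc n))\<^sup>2 \<le> C * B (Suc n) powr (1 - 1 / 12)" for n
    proof -
      define N where "N = Suc n"
      have N: "1 \<le> N" "1 \<le> real N" by (auto simp: N_def)
      have Q1: "1 \<le> co.Q N" by (rule co.Q_ge_1[OF N(1)])
      \<comment> \<open>\<open>4 / N\<close> is weakened to a multiple of
        \<open>N powr (- (1 / 4))\<close>, the power that \<open>powr_index_le_Q\<close> converts
        into one of \<open>Q\<close>.\<close>
      have "(2 / a N)\<^sup>2 = 4 / real N * (real N / (a N)\<^sup>2)"
        using N by (simp add: power_divide)
      also have "\<dots> \<le> 4 * real N powr (- (1 / 4)) * (3 * co.Q N)"
      proof (rule mult_mono)
        have "real N powr (- 1) \<le> real N powr (- (1 / 4))"
          using N by (intro powr_mono) auto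
        then show "4 / real N \<le> 4 * real N powr (- (1 / 4))"
          using N by (simp add: powr_minus_divide)
        show "real N / (a N)\<^sup>2 \<le> 3 * co.Q N" by (rule co.weight_le_Q[OF N(1)])
      qed auto
      also have "\<dots> \<le> 4 * (C1 * co.Q N powr (- (1 / 12))) * (3 * co.Q N)"
        using C1(2)[OF N(1)] Q1 by (intro mult_right_mono) auto
      also have "\<dots> = 12 * C1 * co.Q N powr (11 / 12)"
        using powr_add[of "co.Q N" "- (1 / 12)" 1] Q1 by simp
      also have "\<dots> \<le> 12 * C1 * (K * B N powr (1 - 1 / 12))"
        using C1(1) Qpow[of N] by (intro mult_left_mono) auto
      also have "\<dots> = (12 * C1 * K) * B N powr (1 - 1 / 12)" by simp
      also have "\<dots> \<le> C * B N powr (1 - 1 / 12)"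
        using C by (intro mult_right_mono) auto
      finally show ?thesis by (simp only: N_def)
    qed
    show "mi.qvar n \<omega> \<le> K * B n" for n \<omega>
      by (rule order_trans[OF qvar_Q K(2)])
    show "(\<integral>\<omega>. \<bar>mi.qvar n \<omega> - B n\<bar> \<partial>P) \<le> C * B n powr (1 - 1 / 12)" for n
    proof -
      \<comment> \<open>Termwise \<open>(e k)\<^sup>2 - (pred k)\<^sup>2\<close> factors, and
        \<open>pred k - e k\<close> is controlled by the centred walk over \<open>k\<close>, that is
        by \<open>a k / k * mart k\<close>. The leading 1 is the one added in
        \<open>B\<close>.\<close>
      have pw: "\<bar>mi.qvar n \<omega> - B n\<bar> \<le> 1 + (\<Sum>k<n. 2 / (a (Suc k))\<^sup>2 * (a k / real k * \<bar>mi.mart k \<omega>\<bar>))"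
        if w: "\<omega> \<in> space P" for \<omega>
      proof -
        have "\<bar>incr_var k \<omega> - (1 - (e k)\<^sup>2) / (a (Suc k))\<^sup>2\<bar>
            \<le> 2 / (a (Suc k))\<^sup>2 * (a k / real k * \<bar>mi.mart k \<omega>\<bar>)" for k
        proof -
          have "\<bar>pred k \<omega> - e k\<bar> = \<bar>memory k\<bar> * (a k / real k * \<bar>mi.mart k \<omega>\<bar>)"
            using co.a_pos[of k] by (simp add: pred_deviation e_def mart abs_mult)
          also have "\<dots> \<le> 1 * (a k / real k * \<bar>mi.mart k \<omega>\<bar>)"
            using memory_abs(2) co.a_pos[of k] by (intro mult_right_mono) auto
          finally have 1: "\<bar>pred k \<omega> - e k\<bar> \<le> a k / real k * \<bar>mi.mart k \<omega>\<bar>" by simp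
          have "(e k)\<^sup>2 - (pred k \<omega>)\<^sup>2 = (e k + pred k \<omega>) * (e k - pred k \<omega>)"
            by (simp add: power2_eq_square algebra_simps)
          then have "\<bar>(e k)\<^sup>2 - (pred k \<omega>)\<^sup>2\<bar> = \<bar>e k + pred k \<omega>\<bar> * \<bar>pred k \<omega> - e k\<bar>"
            by (simp only: abs_mult abs_minus_commute[of "e k" "pred k \<omega>"])
          also have "\<dots> \<le> 2 * (a k / real k * \<bar>mi.mart k \<omega>\<bar>)"
            using 1 e1[of k] pred_abs[OF w, of k] by (intro mult_mono) auto
          finally have "\<bar>(e k)\<^sup>2 - (pred k \<omega>)\<^sup>2\<bar> / (a (Suc k))\<^sup>2
              \<le> 2 * (a k / real k * \<bar>mi.mart k \<omega>\<bar>) / (a (Suc k))\<^sup>2"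
            by (intro divide_right_mono) auto
          moreover have "incr_var k \<omega> - (1 - (e k)\<^sup>2) / (a (Suc k))\<^sup>2 = ((e k)\<^sup>2 - (pred k \<omega>)\<^sup>2) / (a (Suc k))\<^sup>2"
            by (simp add: incr_var_def diff_divide_distrib)
          ultimately show ?thesis by (simp add: abs_divide mult.commute)
        qed
        then have "\<bar>\<Sum>k<n. incr_var k \<omega> - (1 - (e k)\<^sup>2) / (a (Suc k))\<^sup>2\<bar>
            \<le> (\<Sum>k<n. 2 / (a (Suc k))\<^sup>2 * (a k / real k * \<bar>mi.mart k \<omega>\<bar>))"
          by (intro order_trans[OF sum_abs] sum_mono)
        moreover have "mi.qvar n \<omega> - B n = (\<Sum>k<n. incr_var k \<omega> - (1 - (e k)\<^sup>2) / (a (Suc k))\<^sup>2) - 1"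
          by (simp add: mi.qvar_def B_def sum_subtractf)
        ultimately show ?thesis by linarith
      qed
      have iM: "integrable P (\<lambda>\<omega>. \<bar>mi.mart k \<omega>\<bar>)" for k
        by (intro Bochner_Integration.integrable_abs mi.test_integrable[of k] mi.test_intros) auto
      have "integrable P (\<lambda>\<omega>. \<bar>mi.qvar n \<omega> - B n\<bar>)"
        by (intro Bochner_Integration.integrable_abs mi.test_integrable[of n] mi.test_intros) auto
      then have "(\<integral>\<omega>. \<bar>mi.qvar n \<omega> - B n\<bar> \<partial>P)
          \<le> (\<integral>\<omega>. 1 + (\<Sum>k<n. 2 / (a (Suc k))\<^sup>2 * (a k / real k * \<bar>mi.mart k \<omega>\<bar>)) \<partial>P)"
        using pw iM by (intro integral_mono) auto
      also have "\<dots> = 1 + (\<Sum>k<n. 2 / (a (Suc k))\<^sup>2 * (a k / real k * (\<integral>\<omega>. \<bar>mi.mart k \<omega>\<bar> \<partial>P)))"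
        using iM by (simp add: walk.prob_space)
      also have "\<dots> \<le> 1 + (\<Sum>k<n. 2 * sqrt (2 * C3) * (1 / (a (Suc k))\<^sup>2 * real (Suc k) powr (- (1 / 4))))"
      proof (intro add_left_mono sum_mono)
        fix k
        have "a k / real k * (\<integral>\<omega>. \<bar>mi.mart k \<omega>\<bar> \<partial>P) \<le> a k / real k * sqrt (co.Q k)"
          using mart_L1[of k] co.a_pos[of k] by (intro mult_left_mono) auto
        also have "\<dots> \<le> sqrt (2 * C3) * real (Suc k) powr (- (1 / 4))"
          using L1_rate[of k] by simp
        finally have "2 / (a (Suc k))\<^sup>2 * (a k / real k * (\<integral>\<omega>. \<bar>mi.mart k \<omega>\<bar> \<partial>P))
            \<le> 2 / (a (Suc k))\<^sup>2 * (sqrt (2 * C3) * real (Suc k) powr (- (1 / 4)))"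
          by (intro mult_left_mono) auto
        then show "2 / (a (Suc k))\<^sup>2 * (a k / real k * (\<integral>\<omega>. \<bar>mi.mart k \<omega>\<bar> \<partial>P))
            \<le> 2 * sqrt (2 * C3) * (1 / (a (Suc k))\<^sup>2 * real (Suc k) powr (- (1 / 4)))"
          by (simp add: mult_ac)
      qed
      also have "\<dots> = 1 + 2 * sqrt (2 * C3) * (\<Sum>k<n. 1 / (a (Suc k))\<^sup>2 * real (Suc k) powr (- (1 / 4)))"
        by (simp only: sum_distrib_left)
      also have "\<dots> \<le> 1 + 2 * sqrt (2 * C3) * (C2 * (K * B n powr (1 - 1 / 12)))"
        using C2(1) C3(1) Qpow[of n]
        by (intro add_left_mono mult_left_mono order_trans[OF C2(2)]) auto
      also have "\<dots> \<le> 1 * B n powr (1 - 1 / 12) + 2 * sqrt (2 * C3) * (C2 * (K * B n powr (1 - 1 / 12)))"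
        using B1[of n] by (simp add: ge_one_powr_ge_zero)
      also have "\<dots> = (1 + 2 * sqrt (2 * C3) * C2 * K) * B n powr (1 - 1 / 12)"
        by (simp add: algebra_simps)
      also have "\<dots> \<le> C * B n powr (1 - 1 / 12)"
        using C(2) by (intro mult_right_mono) auto
      finally show ?thesis .
    qed
  qed simp_all
  \<comment> \<open>The ratio of the two normalisations. The iterated logarithms of \<open>b\<close>
    and of \<open>sqrt (b - 1)\<close> are asymptotically equal, so only the 2 inside
    \<open>lil_norm\<close> survives.\<close>
  define h where "h b = lil_norm b / (sqrt (b - 1) * sqrt (ln (ln (sqrt (b - 1)))))" for b
  have "(h \<longlongrightarrow> 2 powr (1 / 2)) at_top"
    unfolding h_def lil_norm_def by real_asymp
  then have "(h \<longlongrightarrow> sqrt 2) at_top"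
    by (simp add: powr_half_sqrt)
  from filterlim_compose[OF this B_at_top]
  have h_lim: "(\<lambda>n. ereal (h (B n))) \<longlonglongrightarrow> ereal (sqrt 2)" by simp
  have A: "A_coef p g \<alpha> P X n = sqrt (B n - 1)" for n
    unfolding A_coef_def B_def e_def
    by (simp add: sum.atLeast1_atMost_eq)
  have "\<forall>\<^sub>F b in at_top. 0 < lil_norm b"
    unfolding lil_norm_def by real_asymp
  from eventually_compose_filterlim[OF this B_at_top]
  have norm_pos: "\<forall>\<^sub>F n in sequentially. 0 < lil_norm (B n)" .
  show ?thesis
    using lil
  proof eventually_elim
    case (elim \<omega>)
    have "limsup (\<lambda>n. ereal (\<bar>walk X n \<omega> - integral\<^sup>L P (walk X n)\<bar> /
        (a n * A_coef p g \<alpha> P X n * sqrt (ln (ln (A_coef p g \<alpha> P X n))))))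
      = limsup (\<lambda>n. ereal (h (B n)) * ereal (\<bar>mi.mart n \<omega>\<bar> / lil_norm (B n)))"
    proof (rule Limsup_eq)
      show "\<forall>\<^sub>F n in sequentially. ereal (\<bar>walk X n \<omega> - integral\<^sup>L P (walk X n)\<bar> /
        (a n * A_coef p g \<alpha> P X n * sqrt (ln (ln (A_coef p g \<alpha> P X n)))))
        = ereal (h (B n)) * ereal (\<bar>mi.mart n \<omega>\<bar> / lil_norm (B n))"
        using norm_pos
      proof eventually_elim
        case (elim n)
        then show ?case
          using co.a_pos[of n] by (simp add: A h_def mart)
      qed
    qed
    also have "\<dots> = ereal (sqrt 2) * limsup (\<lambda>n. ereal (\<bar>mi.mart n \<omega>\<bar> / lil_norm (B n)))"
      by (rule ereal_limsup_lim_mult[OF h_lim]) auto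
    also have "\<dots> = ereal (sqrt 2)"
      using elim by simp
    finally show ?case .
  qed
qed

end

section \<open>Non-degeneracy of the increments\<close>

text \<open>A repulsion from slope 1: the larger \<open>u n / n\<close>, the more
  \<open>r n * (1 + u n / n)\<close> takes off the next step. The excess over the line of slope
  \<open>\<rho>\<close> is contracted and stays bounded.\<close>

lemma linear_drift_bound:
  fixes u r :: "nat \<Rightarrow> real"
  assumes rec: "\<And>n. u (Suc n) \<le> u n + 1 - r n * (1 + u n / real n)"
    and u: "\<And>n. - real n \<le> u n" and c: "0 < c" "c \<le> 1" and r: "\<forall>\<^sub>F n in sequentially. c \<le> r n"
  shows "\<forall>\<^sub>F n in sequentially. u n \<le> (1 - c / 2) * real n"
proof -
  obtain n0 where n0: "\<And>n. n0 \<le> n \<Longrightarrow> c \<le> r n"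
    using r by (auto simp: eventually_sequentially)
  define m where "m = max 1 n0"
  \<comment> \<open>the fixed point of \<open>v \<mapsto> 1 - c * (1 + v)\<close>, towards which \<open>u n / n\<close> is pushed\<close>
  define \<rho> where "\<rho> = (1 - c) / (1 + c)"
  have \<rho>: "1 - c - c * \<rho> = \<rho>" "\<rho> \<le> 1 - c"
    using c by (auto simp: \<rho>_def field_simps)
  define U where "U = max 0 (u m - \<rho> * real m)"
  have bound: "u n - \<rho> * real n \<le> U" if "m \<le> n" for n
    using that
  proof (induction n rule: dec_induct)
    case base
    then show ?case by (simp add: U_def)
  next
    case (step n)
    have n: "1 \<le> n" "n0 \<le> n" using step by (auto simp: m_def)
    \<comment> \<open>The lower bound on \<open>u\<close> makes this nonnegative, so replacing
      \<open>r n\<close> by the smaller \<open>c\<close> can only raise the estimate.\<close>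
    have "0 \<le> 1 + u n / real n" using u[of n] n by (simp add: field_simps)
    then have "c * (1 + u n / real n) \<le> r n * (1 + u n / real n)"
      using n0[OF n(2)] by (intro mult_right_mono)
    then have "u (Suc n) - \<rho> * real (Suc n) \<le> u n + 1 - c * (1 + u n / real n) - \<rho> * real (Suc n)"
      using rec[of n] by linarith
    also have "\<dots> = (u n - \<rho> * real n) * (1 - c / real n) + (1 - c - c * \<rho> - \<rho>)"
      using n by (simp add: field_simps)
    also have "\<dots> = (u n - \<rho> * real n) * (1 - c / real n)"
      using \<rho> by simp
    also have "\<dots> \<le> U * (1 - c / real n)"
      using step c n by (intro mult_right_mono) (auto simp: field_simps)
    also have "\<dots> \<le> U"
      using c n by (intro mult_left_le) (auto simp: U_def)
    finally show ?case .
  qed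
  have "\<forall>\<^sub>F n in sequentially. U \<le> c / 2 * real n"
    using c by real_asymp
  with eventually_ge_at_top[of m] show ?thesis
  proof eventually_elim
    case (elim n)
    have "\<rho> * real n \<le> (1 - c) * real n" using \<rho> by (intro mult_right_mono) auto
    with bound[OF elim(1)] elim(2) show ?case by (simp add: algebra_simps)
  qed
qed

lemma square_gap:
  fixes z :: real
  assumes "\<bar>z\<bar> \<le> 1 - \<kappa>" "0 < \<kappa>"
  shows "z\<^sup>2 \<le> 1 - \<kappa>"
proof -
  have "\<bar>z\<bar> * \<bar>z\<bar> \<le> (1 - \<kappa>) * 1"
    using assms by (intro mult_mono) auto
  then show ?thesis by (simp add: power2_eq_square)
qed

lemma eventually_ge_liminf:
  assumes "0 < liminf (\<lambda>n. ereal (h n))"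
  obtains c where "0 < c" "\<forall>\<^sub>F n in sequentially. c \<le> h n"
proof -
  obtain c where c: "0 < ereal c" "ereal c < liminf (\<lambda>n. ereal (h n))"
    using ereal_dense2[OF assms] by blast
  from less_LiminfD[OF c(2)] have "\<forall>\<^sub>F n in sequentially. c \<le> h n"
    by eventually_elim simp
  then show ?thesis using c(1) that by simp
qed

lemma eventually_le_limsup:
  assumes "limsup (\<lambda>n. ereal (h n)) < 1"
  obtains c where "0 < c" "\<forall>\<^sub>F n in sequentially. h n \<le> 1 - c"
proof -
  obtain c where c: "limsup (\<lambda>n. ereal (h n)) < ereal c" "ereal c < 1"
    using ereal_dense2[OF assms] by blast
  from Limsup_lessD[OF c(1)] have "\<forall>\<^sub>F n in sequentially. h n \<le> 1 - (1 - c)"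
    by eventually_elim simp
  moreover have "0 < 1 - c" using c(2) by (simp flip: one_ereal_def add: ereal_less)
  ultimately show ?thesis using that by blast
qed

section \<open>Means of the increments stay away from 1 in absolute value\<close>

context derw
begin

lemma expectation_X_abs:
  assumes "1 \<le> n" "\<bar>(\<integral>\<omega>. walk X n \<omega> \<partial>P)\<bar> \<le> z * real n"
  shows "\<bar>(\<integral>\<omega>. X (Suc n) \<omega> \<partial>P)\<bar> \<le> \<bar>memory n\<bar> * z + \<bar>drift n\<bar>"
proof -
  have "\<bar>(\<integral>\<omega>. walk X n \<omega> \<partial>P) / real n\<bar> \<le> z"
    using assms by (simp add: abs_divide divide_le_eq)
  then have "\<bar>memory n\<bar> * \<bar>(\<integral>\<omega>. walk X n \<omega> \<partial>P) / real n\<bar> \<le> \<bar>memory n\<bar> * z"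
    by (intro mult_left_mono) auto
  then show ?thesis
    unfolding expectation_X using abs_triangle_ineq[of "memory n * ((\<integral>\<omega>. walk X n \<omega> \<partial>P) / real n)" "drift n"]
    unfolding abs_mult by linarith
qed

text \<open>For \<open>0 < p < 1\<close> the strict inequality
  \<open>\<bar>2 * p - 1\<bar> < 1\<close> leaves a gap at once; \<open>p = 0\<close> needs
  information on the mean walk.\<close>

lemma nondegenerate_memory:
  assumes p: "p < 1" and c: "0 < c" and ev: "\<forall>\<^sub>F n in sequentially. c \<le> g \<alpha> (Suc n)"
  shows "\<exists>\<kappa>>0. \<forall>\<^sub>F n in sequentially. \<bar>(\<integral>\<omega>. X (Suc n) \<omega> \<partial>P)\<bar> \<le> 1 - \<kappa>"
proof (cases "p = 0")
  case False
  then have p': "\<bar>2 * p - 1\<bar> < 1" using p p_range by (auto simp: abs_less_iff)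
  show ?thesis
  proof (intro exI conjI)
    show "0 < c * (1 - \<bar>2 * p - 1\<bar>)" using c p' by simp
    show "\<forall>\<^sub>F n in sequentially. \<bar>(\<integral>\<omega>. X (Suc n) \<omega> \<partial>P)\<bar> \<le> 1 - c * (1 - \<bar>2 * p - 1\<bar>)"
      using ev eventually_ge_at_top[of 1]
    proof eventually_elim
      case (elim n)
      have "\<bar>(\<integral>\<omega>. X (Suc n) \<omega> \<partial>P)\<bar> \<le> \<bar>memory n\<bar> * 1 + \<bar>drift n\<bar>"
        using elim mean_walk_abs[of n] by (intro expectation_X_abs) auto
      also have "\<dots> \<le> \<bar>2 * p - 1\<bar> * g \<alpha> (Suc n) + (1 - g \<alpha> (Suc n))"
        using drift_abs(2)[OF elim(2)] g_unit[of "Suc n"] by (simp add: memory_def abs_mult)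
      also have "\<dots> = 1 - g \<alpha> (Suc n) * (1 - \<bar>2 * p - 1\<bar>)"
        by (simp add: algebra_simps)
      also have "\<dots> \<le> 1 - c * (1 - \<bar>2 * p - 1\<bar>)"
        using elim p' by (intro diff_left_mono mult_right_mono) auto
      finally show ?case .
    qed
  qed
next
  case True
  \<comment> \<open>With \<open>p = 0\<close> the memory only reverses the mean walk, and bounding
    it by absolute values gives no more than 1. The gap comes from the mean walk staying off the
    slopes 1 and -1, by \<open>linear_drift_bound\<close> for both signs
    \<open>\<sigma>\<close>.\<close>
  define u where "u n = (\<integral>\<omega>. walk X n \<omega> \<partial>P)" for n
  define c' where "c' = min c 1"
  have c': "0 < c'" "c' \<le> 1" "\<forall>\<^sub>F n in sequentially. c' \<le> g \<alpha> (Suc n)"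
    using c ev by (auto simp: c'_def elim: eventually_mono)
  have mem: "memory n = - g \<alpha> (Suc n)" for n
    unfolding memory_def by (simp add: True)
  have drift1: "\<bar>drift n\<bar> \<le> 1 - g \<alpha> (Suc n)" if "1 \<le> n" for n
    using drift_abs(2)[OF that] .
  have step: "\<sigma> * u (Suc n) \<le> \<sigma> * u n + 1 - g \<alpha> (Suc n) * (1 + \<sigma> * u n / real n)"
    if \<sigma>: "\<bar>\<sigma>\<bar> = 1" and n: "1 \<le> n" for \<sigma> n
  proof -
    have "\<sigma> * u (Suc n) = \<sigma> * u n + (memory n * (\<sigma> * u n / real n) + \<sigma> * drift n)"
      unfolding u_def mean_walk_Suc expectation_X by (simp add: algebra_simps)
    moreover have "\<sigma> * drift n \<le> 1 - g \<alpha> (Suc n)"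
      by (rule abs_le_D1) (use drift1[OF n] \<sigma> in \<open>simp add: abs_mult\<close>)
    ultimately show ?thesis by (simp add: mem algebra_simps)
  qed
  have half: "\<forall>\<^sub>F n in sequentially. \<sigma> * u n \<le> (1 - c' / 2) * real n" if \<sigma>: "\<bar>\<sigma>\<bar> = 1" for \<sigma> :: real
  proof -
    define r where "r n = (if n = 0 then - 2 else g \<alpha> (Suc n))" for n
    show ?thesis
    proof (rule linear_drift_bound[where r = r])
      have su: "\<bar>\<sigma> * u n\<bar> \<le> real n" for n
        using mean_walk_abs[of n] \<sigma> by (simp add: abs_mult u_def)
      show "- real n \<le> \<sigma> * u n" for n
        using su[of n] by (simp add: abs_le_iff)
      show "\<sigma> * u (Suc n) \<le> \<sigma> * u n + 1 - r n * (1 + \<sigma> * u n / real n)" for n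
      proof (cases "n = 0")
        case True
        then show ?thesis using su[of 1] su[of 0] by (simp add: r_def abs_le_iff)
      next
        case False
        then show ?thesis using step[OF \<sigma>, of n] by (simp add: r_def)
      qed
      show "\<forall>\<^sub>F n in sequentially. c' \<le> r n"
        using c'(3) eventually_ge_at_top[of 1] by eventually_elim (simp add: r_def)
    qed (use c' in auto)
  qed
  show ?thesis
  proof (intro exI conjI)
    show "0 < c' * (c' / 2)" using c' by simp
    show "\<forall>\<^sub>F n in sequentially. \<bar>(\<integral>\<omega>. X (Suc n) \<omega> \<partial>P)\<bar> \<le> 1 - c' * (c' / 2)"
      using half[of 1, simplified] half[of "- 1", simplified] c'(3) eventually_ge_at_top[of 1]
    proof eventually_elim
      case (elim n)
      have "\<bar>(\<integral>\<omega>. X (Suc n) \<omega> \<partial>P)\<bar> \<le> \<bar>memory n\<bar> * (1 - c' / 2) + \<bar>drift n\<bar>"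
        using elim by (intro expectation_X_abs) (auto simp: u_def abs_le_iff)
      also have "\<dots> \<le> g \<alpha> (Suc n) * (1 - c' / 2) + (1 - g \<alpha> (Suc n))"
        using drift1[OF elim(4)] g_unit[of "Suc n"] by (simp add: mem)
      also have "\<dots> = 1 - g \<alpha> (Suc n) * (c' / 2)"
        by (simp add: algebra_simps)
      also have "\<dots> \<le> 1 - c' * (c' / 2)"
        using elim c' by (intro diff_left_mono mult_right_mono) auto
      finally show ?case .
    qed
  qed
qed

text \<open>The dynamical part has weight at least \<open>\<delta>\<close>, and its mean is at
  distance at least \<open>2 * \<delta>\<close> from 1 and -1; the gap is the product.\<close>

lemma nondegenerate_orbit:
  assumes \<delta>: "0 < \<delta>"
    and ev: "\<forall>\<^sub>F n in sequentially. \<delta> \<le> f ((T ^^ n) x)" "\<forall>\<^sub>F n in sequentially. f ((T ^^ n) x) \<le> 1 - \<delta>"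
      "\<forall>\<^sub>F n in sequentially. g \<alpha> n \<le> 1 - \<delta>"
  shows "\<exists>\<kappa>>0. \<forall>\<^sub>F n in sequentially. \<bar>(\<integral>\<omega>. X (Suc n) \<omega> \<partial>P)\<bar> \<le> 1 - \<kappa>"
proof (intro exI conjI)
  show "0 < 2 * \<delta> * \<delta>" using \<delta> by simp
  have ev': "\<forall>\<^sub>F n in sequentially. \<delta> \<le> f ((T ^^ Suc n) x)" "\<forall>\<^sub>F n in sequentially. f ((T ^^ Suc n) x) \<le> 1 - \<delta>"
      "\<forall>\<^sub>F n in sequentially. g \<alpha> (Suc n) \<le> 1 - \<delta>"
    by (rule eventually_compose_filterlim[OF _ filterlim_Suc] ev)+
  show "\<forall>\<^sub>F n in sequentially. \<bar>(\<integral>\<omega>. X (Suc n) \<omega> \<partial>P)\<bar> \<le> 1 - 2 * \<delta> * \<delta>"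
    using ev' eventually_ge_at_top[of 1]
  proof eventually_elim
    case (elim n)
    define z where "z = f ((T ^^ Suc n) x)"
    have z: "\<bar>2 * z - 1\<bar> \<le> 1 - 2 * \<delta>"
      using elim unfolding z_def by (auto simp: abs_le_iff)
    have "\<bar>(\<integral>\<omega>. X (Suc n) \<omega> \<partial>P)\<bar> \<le> \<bar>memory n\<bar> * 1 + \<bar>drift n\<bar>"
      using elim mean_walk_abs[of n] by (intro expectation_X_abs) auto
    also have "\<bar>drift n\<bar> = (1 - g \<alpha> (Suc n)) * \<bar>2 * z - 1\<bar>"
      using elim g_unit[of "Suc n"] by (simp add: drift_def z_def abs_mult del: funpow.simps)
    also have "\<bar>memory n\<bar> * 1 + \<dots> \<le> g \<alpha> (Suc n) + (1 - g \<alpha> (Suc n)) * (1 - 2 * \<delta>)"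
      using memory_abs(1)[of n] z g_unit[of "Suc n"] by (intro add_mono mult_left_mono) auto
    also have "\<dots> = 1 - 2 * \<delta> * (1 - g \<alpha> (Suc n))"
      by (simp add: algebra_simps)
    also have "\<dots> \<le> 1 - 2 * \<delta> * \<delta>"
      using elim \<delta> by (intro diff_left_mono mult_left_mono) auto
    finally show ?case .
  qed
qed

lemma ell_range: "0 \<le> ell_inf g \<alpha>" "ell_inf g \<alpha> \<le> ell_sup g \<alpha>" "ell_sup g \<alpha> \<le> 1"
proof -
  have ev: "\<forall>\<^sub>F n in sequentially. 0 \<le> ereal (g \<alpha> n)" "\<forall>\<^sub>F n in sequentially. ereal (g \<alpha> n) \<le> 1"
    using eventually_ge_at_top[of 1] by (eventually_elim; simp add: g_unit)+
  show "0 \<le> ell_inf g \<alpha>" unfolding ell_inf_def by (rule Liminf_bounded[OF ev(1)])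
  show "ell_sup g \<alpha> \<le> 1" unfolding ell_sup_def by (rule Limsup_bounded[OF ev(2)])
  show "ell_inf g \<alpha> \<le> ell_sup g \<alpha>"
    unfolding ell_inf_def ell_sup_def by (rule Liminf_le_Limsup) simp
qed

text \<open>Under (i) the memory provides the gap; in every other case \<open>f\<close> stays away
  from 0 and 1 along the orbit and \<open>g\<close> stays away from 1.\<close>

lemma nondegenerate_increments:
  assumes "(p < 1 \<and> ell_inf g \<alpha> > 0) \<or>
      (ereal p * ell_sup g \<alpha> < 1 \<and>
       (p = 1 \<longrightarrow>
          orbit_inf T f x > 0 \<and>
          orbit_sup T f x < (1 - ell_sup g \<alpha>) / (1 - ell_inf g \<alpha>)) \<and>
       (ell_inf g \<alpha> = 0 \<longrightarrow>
          orbit_inf T f x > 0 \<and>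
          orbit_sup T f x < 1 - ereal p * ell_sup g \<alpha> \<and>
          ell_sup g \<alpha> < 1))"
  shows "\<exists>\<kappa>>0. \<forall>\<^sub>F n in sequentially. \<bar>(\<integral>\<omega>. X (Suc n) \<omega> \<partial>P)\<bar> \<le> 1 - \<kappa>"
proof (cases "p < 1 \<and> ell_inf g \<alpha> > 0")
  case True
  then obtain c where c: "0 < c" "\<forall>\<^sub>F n in sequentially. c \<le> g \<alpha> n"
    unfolding ell_inf_def using eventually_ge_liminf by blast
  then show ?thesis
    using True by (intro nondegenerate_memory[of c] eventually_compose_filterlim[OF c(2) filterlim_Suc]) auto
next
  case False
  obtain li where li: "ell_inf g \<alpha> = ereal li"
    using ell_range by (cases "ell_inf g \<alpha>") auto
  obtain ls where ls: "ell_sup g \<alpha> = ereal ls"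
    using ell_range by (cases "ell_sup g \<alpha>") auto
  have r: "0 \<le> li" "li \<le> ls" "ls \<le> 1"
    using ell_range unfolding li ls by simp_all
  have "orbit_inf T f x > 0 \<and> orbit_sup T f x < 1 \<and> ell_sup g \<alpha> < 1"
  proof (cases "p = 1")
    case True
    \<comment> \<open>For \<open>p = 1\<close> the bound on \<open>p * ell_sup\<close> reads
      \<open>ell_sup < 1\<close>, so the quotient in (D1) has a positive denominator and is at most
      1.\<close>
    then have *: "ls < 1" "orbit_inf T f x > 0"
      "orbit_sup T f x < (1 - ell_sup g \<alpha>) / (1 - ell_inf g \<alpha>)"
      using assms by (auto simp: ls)
    have "(1 - ell_sup g \<alpha>) / (1 - ell_inf g \<alpha>) = ereal ((1 - ls) / (1 - li))"
      using r *(1) by (simp add: li ls one_ereal_def)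
    also have "\<dots> \<le> 1"
      using r *(1) by (simp add: one_ereal_def)
    finally show ?thesis
      using * by (auto simp: ls)
  next
    case False
    \<comment> \<open>If \<open>p < 1\<close> and (i) fails, then \<open>ell_inf\<close> is 0 and
      (D2) applies.\<close>
    then have "p < 1" using p_range by auto
    with \<open>\<not> (p < 1 \<and> ell_inf g \<alpha> > 0)\<close> have "ell_inf g \<alpha> = 0"
      using ell_range(1) by auto
    then have *: "orbit_inf T f x > 0" "orbit_sup T f x < 1 - ereal p * ell_sup g \<alpha>" "ell_sup g \<alpha> < 1"
      using assms by auto
    have "1 - ereal p * ell_sup g \<alpha> \<le> 1"
      using p_range r by (simp add: ls one_ereal_def)
    then show ?thesis using * by auto
  qed
  then obtain c1 c2 c3 where c: "0 < c1" "\<forall>\<^sub>F n in sequentially. c1 \<le> f ((T ^^ n) x)"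
    "0 < c2" "\<forall>\<^sub>F n in sequentially. f ((T ^^ n) x) \<le> 1 - c2"
    "0 < c3" "\<forall>\<^sub>F n in sequentially. g \<alpha> n \<le> 1 - c3"
    unfolding orbit_inf_def orbit_sup_def ell_sup_def by (metis eventually_ge_liminf eventually_le_limsup)
  show ?thesis
  proof (rule nondegenerate_orbit[of "min c1 (min c2 c3)"])
    show "0 < min c1 (min c2 c3)" using c by simp
  qed (use c in \<open>auto elim: eventually_mono\<close>)
qed

text \<open>\<open>1 / (4 * p - 2)\<close> is the value of \<open>g\<close> at which
  \<open>(2 * p - 1) * g\<close> equals \<open>1 / 2\<close>; for \<open>p \<le> 3 / 4\<close> that
  value is never exceeded, as \<open>2 * p - 1 \<le> 1 / 2\<close>.\<close>

lemma memory_half: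
  assumes "p \<le> 3 / 4 \<or> ell_sup g \<alpha> < ereal (1 / (4 * p - 2))"
  shows "\<forall>\<^sub>F n in sequentially. memory n \<le> 1 / 2"
proof (cases "p \<le> 3 / 4")
  case True
  have "memory n \<le> 1 / 2" for n
  proof -
    have "memory n \<le> 1 / 2 * g \<alpha> (Suc n)"
      unfolding memory_def using True g_unit[of "Suc n"] by (intro mult_right_mono) auto
    then show ?thesis using g_unit[of "Suc n"] by simp
  qed
  then show ?thesis by simp
next
  case False
  then have "limsup (\<lambda>n. ereal (g \<alpha> n)) < ereal (1 / (4 * p - 2))"
    using assms by (simp add: ell_sup_def)
  from Limsup_lessD[OF this] have "\<forall>\<^sub>F n in sequentially. g \<alpha> (Suc n) < 1 / (4 * p - 2)"
    by (subst eventually_sequentially_Suc) simp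
  then show ?thesis
  proof eventually_elim
    case (elim n)
    then have "(2 * p - 1) * g \<alpha> (Suc n) \<le> (2 * p - 1) * (1 / (4 * p - 2))"
      using False by (intro mult_left_mono) auto
    also have "\<dots> = 1 / 2" using False by (simp add: field_simps)
    finally show ?case by (simp add: memory_def)
  qed
qed

end

theorem theorem6:
  fixes M :: "'a measure" and T :: "'a \<Rightarrow> 'a" and f :: "'a \<Rightarrow> real"
    and p q :: real and R :: "(real \<times> nat) set" and g :: "real \<Rightarrow> nat \<Rightarrow> real" and \<alpha> :: real
    and x :: 'a and P :: "'b measure" and X :: "nat \<Rightarrow> 'b \<Rightarrow> real"
  assumes "derw M T f p q R g \<alpha> x P X"
    and "p \<le> 3 / 4 \<or> ell_sup g \<alpha> < ereal (1 / (4 * p - 2))"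
    and "(p < 1 \<and> ell_inf g \<alpha> > 0) \<or>
      (ereal p * ell_sup g \<alpha> < 1 \<and>
       (p = 1 \<longrightarrow>
          orbit_inf T f x > 0 \<and>
          orbit_sup T f x < (1 - ell_sup g \<alpha>) / (1 - ell_inf g \<alpha>)) \<and>
       (ell_inf g \<alpha> = 0 \<longrightarrow>
          orbit_inf T f x > 0 \<and>
          orbit_sup T f x < 1 - ereal p * ell_sup g \<alpha> \<and>
          ell_sup g \<alpha> < 1))"
  shows "AE \<omega> in P.
    limsup (\<lambda>n. ereal (\<bar>walk X n \<omega> - integral\<^sup>L P (walk X n)\<bar> /
        (a_coef p g \<alpha> n * A_coef p g \<alpha> P X n * sqrt (ln (ln (A_coef p g \<alpha> P X n))))))
      = ereal (sqrt 2)"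
proof -
  interpret derw M T f p q R g \<alpha> x P X by (rule assms(1))
  obtain \<kappa> where \<kappa>: "0 < \<kappa>" "\<forall>\<^sub>F n in sequentially. \<bar>(\<integral>\<omega>. X (Suc n) \<omega> \<partial>P)\<bar> \<le> 1 - \<kappa>"
    using nondegenerate_increments[OF assms(3)] by blast
  from \<kappa>(2) have "\<forall>\<^sub>F n in sequentially. (\<integral>\<omega>. X (Suc n) \<omega> \<partial>P)\<^sup>2 \<le> 1 - \<kappa>"
    by eventually_elim (rule square_gap[OF _ \<kappa>(1)])
  then show ?thesis
    by (rule lil_walk[OF memory_half[OF assms(2)] \<kappa>(1)])
qed

end
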